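(* Consider the two-type bandit problem with an endogenous arm-reservoir (Model 2) described in the context. The expected cumulative regret of the policy $\pi$ given by Algorithm ALG2 satisfies $$\limsup_{n\to\infty}\frac{\mathbb{E}R_n^{\pi}}{\log n}\leqslant\left(\frac{16c}{\Delta}\right)\sum_{k=0}^{\infty}\exp\left(-\beta_\Delta\sum_{j=0}^{k-1}g(2j)\right),$$ where $\beta_\Delta:=\frac{1}{2}\bar{\Phi}(f(T_0))$, with $\bar{\Phi}(v):=\frac{1}{\sqrt{2\pi}}\int_v^\infty e^{-u^2/2}\,du$ for $v>0$, $T_0:=\left\lceil\frac{64}{\Delta^2}\log^2\left(\frac{64}{\Delta^2}\right)\right\rceil$, and $f(x):=x+4\sqrt{x\log x}$ for $x\geqslant1$.
   Context: Bandit problem. There are two arm-types, $\mathcal{K}=\{1,2\}$, with mean rewards $\mu_1>\mu_2$; the gap is $\Delta:=\mu_1-\mu_2>0$. Type 1 is called optimal, type 2 inferior. One arm is played at each time $t\in\{1,\dots,n\}$, where $n$ is the horizon of play. At time $t$ one either replays a previously played arm or plays a new arm queried from the reservoir. An arm queried at time $t$ is of type 1 with probability $\alpha(t)$ and of type 2 otherwise. Types are never observed. The $j$-th pull of arm $i$ yields a $[0,1]$-valued reward $X_{i,j}$ whose mean is $\mu_k$ if arm $i$ has type $k$; rewards are independent across arms and time (for a fixed arm they have a constant mean but need not be identically distributed). $N_i(t)$ denotes the number of pulls of arm $i$ up to time $t$. Regret. For a policy $\pi$ playing arm $\pi_t$ at time $t$, $R_n^{\pi}:=\sum_{t=1}^{n}(\mu_1-X_{\pi_t,N_{\pi_t}(t)})$;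 $\mathbb{E}R_n^\pi=\mathbb{E}\sum_{t=1}^{n}(\mu_1-\mu_{\kappa(\pi_t)})$, where $\kappa(\pi_t)\in\{1,2\}$ is the type of the arm played at time $t$. Expectations are over rewards, policy randomization and reservoir randomness. Endogenous reservoir (Model 2): $\alpha(t)=g(\mathcal{J}_{t-1})$, where $g:\mathbb{N}\cup\{0\}\to(0,c]$ is a non-increasing deterministic mapping with $g(0)=c\in(0,1)$, and $\mathcal{J}_t$ is the number of reservoir queries made up to and including time $t$, with $\mathcal{J}_0:=0$. Algorithm ALG2 (Nested UCB). It runs in epochs; within each epoch, $t$ denotes the local time, reset at the start of the epoch, and $N_i(t)$ counts pulls within the epoch. New epoch: at local times 1 and 2, query and play two new arms from the reservoir (call them arms 1 and 2), observing $X_{1,1},X_{2,1}$. Set $m\leftarrow1$ and draw one independent standard Gaussian sample $\mathcal{Z}$ (one sample per epoch). Then for $t=3,4,\dots$: if $\left|\mathcal{Z}+\sum_{j=1}^{m}(X_{1,j}-X_{2,j})\right|<4\sqrt{m\log m}$, permanently discard both arms and start a new epoch; otherwise play an arm $i_t\in\arg\max_{i\in\{1,2\}}\left(\frac{\sum_{j=1}^{N_i(t-1)}X_{i,j}}{N_i(t-1)}+\sqrt{\frac{2\log(t-1)}{N_i(t-1)}}\right)$, observe its reward, and if $m<\min_{i\in\{1,2\}}N_i(t)$ set $m\leftarrow m+1$. The policy does not depend on $n$; it is run for $n$ total plays. The right-hand side series may be $+\infty$; an empty sum equals $0$. *)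

theory Defs
  imports "HOL-Probability.Probability"
begin

section \<open>The two-type bandit with an endogenous reservoir\<close>

datatype arm_type = Optimal | Inferior

text \<open>
  Arms are labelled in the order in which they are queried, starting with 0, so an arm queried at
  time \<open>t\<close> carries the label \<open>J (t - 1)\<close>, the number of earlier queries, and its probability
  \<open>\<alpha> t = g (J (t - 1))\<close> of being optimal is \<open>g i\<close> for arm \<open>i\<close>. \<open>X i j\<close> is the reward of the
  \<open>j\<close>-th pull, \<open>j \<ge> 1\<close>, of arm \<open>i\<close>. The types being random, the assumptions on the rewards of an
  arm are imposed conditionally on its type; both values of the type have positive probability, so
  \<open>uniform_measure\<close> is the conditional probability here.
\<close>

definition arm_space :: "(arm_type \<times> (nat \<Rightarrow> real)) measure" where
  "arm_space = count_space UNIV \<Otimes>\<^sub>M PiM {1..} (\<lambda>_. borel)"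

definition arm_data ::
    "(nat \<Rightarrow> 'w \<Rightarrow> arm_type) \<Rightarrow> (nat \<Rightarrow> nat \<Rightarrow> 'w \<Rightarrow> real) \<Rightarrow> nat \<Rightarrow> 'w \<Rightarrow> arm_type \<times> (nat \<Rightarrow> real)"
  where "arm_data \<kappa> X i \<omega> = (\<kappa> i \<omega>, \<lambda>j\<in>{1..}. X i j \<omega>)"

locale endogenous_bandit = prob_space M for M :: "'w measure" +
  fixes \<mu> :: "arm_type \<Rightarrow> real"
    and g :: "nat \<Rightarrow> real"
    and c :: real
    and \<kappa> :: "nat \<Rightarrow> 'w \<Rightarrow> arm_type"
    and X :: "nat \<Rightarrow> nat \<Rightarrow> 'w \<Rightarrow> real"
  assumes gap: "\<mu> Inferior < \<mu> Optimal"
    and c_bounds: "0 < c" "c < 1"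
    and g_range: "\<And>i. 0 < g i \<and> g i \<le> c"
    and g_antimono: "antimono g"
    and g_0: "g 0 = c"
    and type_measurable: "\<And>i. random_variable (count_space UNIV) (\<kappa> i)"
    and type_prob: "\<And>i. prob {\<omega> \<in> space M. \<kappa> i \<omega> = Optimal} = g i"
    and reward_measurable: "\<And>i j. j \<ge> 1 \<Longrightarrow> random_variable borel (X i j)"
    and reward_range: "\<And>i j \<omega>. j \<ge> 1 \<Longrightarrow> \<omega> \<in> space M \<Longrightarrow> X i j \<omega> \<in> {0..1}"
    and reward_mean: "\<And>i j k. j \<ge> 1 \<Longrightarrow>
      integral\<^sup>L (uniform_measure M {\<omega> \<in> space M. \<kappa> i \<omega> = k}) (X i j) = \<mu> k"
    and reward_indep: "\<And>i k.
      prob_space.indep_vars (uniform_measure M {\<omega> \<in> space M. \<kappa> i \<omega> = k}) (\<lambda>_. borel) (X i) {1..}"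
    and arms_indep: "indep_vars (\<lambda>_. arm_space) (arm_data \<kappa> X) UNIV"

text \<open>For a sequence \<open>p\<close> of played arms (\<open>p t\<close> at time \<open>t \<ge> 1\<close>) and a table \<open>x\<close> of rewards.\<close>

definition pulls :: "(nat \<Rightarrow> nat) \<Rightarrow> nat \<Rightarrow> nat \<Rightarrow> nat" where
  "pulls p i t = card {s \<in> {1..t}. p s = i}"

definition regret :: "real \<Rightarrow> (nat \<Rightarrow> nat \<Rightarrow> real) \<Rightarrow> (nat \<Rightarrow> nat) \<Rightarrow> nat \<Rightarrow> real" where
  "regret \<mu>1 x p n = (\<Sum>t = 1..n. \<mu>1 - x (p t) (pulls p (p t) t))"


section \<open>Nested UCB\<close>

text \<open>
  An entry of the history is the arm played, its reward, and the Gaussian sample of the epoch.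
  Entries for times that have not been reached are \<open>(0, 0, 0)\<close>.
\<close>

type_synonym history = "nat \<Rightarrow> nat \<times> real \<times> real"

abbreviation history_space :: "history measure" where
  "history_space \<equiv> PiM UNIV (\<lambda>_. count_space UNIV \<Otimes>\<^sub>M borel \<Otimes>\<^sub>M borel)"

text \<open>
  The state after a play: \<open>queries\<close> counts all reservoir queries so far, \<open>epoch\<close> is the number of
  completed epochs, \<open>local_time\<close> is the time within the epoch (0 only before the very first play),
  \<open>arm1\<close>, \<open>arm2\<close> are the labels of the two arms of the epoch, \<open>pulls1\<close>, \<open>pulls2\<close> their numbers
  of pulls within the epoch, and \<open>samples\<close> is the counter called \<open>m\<close> in the algorithm.
\<close>

record ucb_state =
  queries :: nat
  epoch :: nat
  local_time :: nat
  arm1 :: nat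
  arm2 :: nat
  pulls1 :: nat
  pulls2 :: nat
  samples :: nat
  played :: nat
  past :: history

definition init_state :: ucb_state where
  "init_state = \<lparr>queries = 0, epoch = 0, local_time = 0, arm1 = 0, arm2 = 0, pulls1 = 0, pulls2 = 0,
     samples = 0, played = 0, past = (\<lambda>_. (0, 0, 0))\<rparr>"

definition query_first :: "nat \<Rightarrow> ucb_state \<Rightarrow> ucb_state" where
  "query_first e s = s\<lparr>epoch := e, local_time := 1, arm1 := queries s, pulls1 := 1, pulls2 := 0,
     samples := 0, played := queries s, queries := queries s + 1\<rparr>"

definition query_second :: "ucb_state \<Rightarrow> ucb_state" where
  "query_second s = s\<lparr>local_time := 2, arm2 := queries s, pulls2 := 1, samples := 1,
     played := queries s, queries := queries s + 1\<rparr>"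

definition discards :: "(nat \<Rightarrow> nat \<Rightarrow> real) \<Rightarrow> (nat \<Rightarrow> real) \<Rightarrow> ucb_state \<Rightarrow> bool" where
  "discards x z s \<longleftrightarrow>
     \<bar>z (epoch s) + (\<Sum>j = 1..samples s. x (arm1 s) j - x (arm2 s) j)\<bar>
       < 4 * sqrt (real (samples s) * ln (real (samples s)))"

text \<open>\<open>\<tau>\<close> is the local time of the previous play.\<close>

definition ucb_index :: "(nat \<Rightarrow> real) \<Rightarrow> nat \<Rightarrow> nat \<Rightarrow> real" where
  "ucb_index y N \<tau> = (\<Sum>j = 1..N. y j) / real N + sqrt (2 * ln (real \<tau>) / real N)"

text \<open>\<open>b\<close> decides which arm is played if both indices are maximal.\<close>

definition plays_first :: "(nat \<Rightarrow> nat \<Rightarrow> real) \<Rightarrow> bool \<Rightarrow> ucb_state \<Rightarrow> bool" where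
  "plays_first x b s \<longleftrightarrow>
     (let I1 = ucb_index (x (arm1 s)) (pulls1 s) (local_time s);
          I2 = ucb_index (x (arm2 s)) (pulls2 s) (local_time s)
      in I2 < I1 \<or> I1 = I2 \<and> b)"

definition replay :: "bool \<Rightarrow> ucb_state \<Rightarrow> ucb_state" where
  "replay first s =
     (let N1 = (if first then pulls1 s + 1 else pulls1 s);
          N2 = (if first then pulls2 s else pulls2 s + 1)
      in s\<lparr>local_time := local_time s + 1, pulls1 := N1, pulls2 := N2,
           samples := (if samples s < min N1 N2 then samples s + 1 else samples s),
           played := (if first then arm1 s else arm2 s)\<rparr>)"

definition next_play :: "(nat \<Rightarrow> nat \<Rightarrow> real) \<Rightarrow> (nat \<Rightarrow> real) \<Rightarrow> bool \<Rightarrow> ucb_state \<Rightarrow> ucb_state" where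
  "next_play x z b s =
     (if local_time s = 0 then query_first (epoch s) s
      else if local_time s = 1 then query_second s
      else if discards x z s then query_first (epoch s + 1) s
      else replay (plays_first x b s) s)"

definition record_play ::
    "(nat \<Rightarrow> nat \<Rightarrow> real) \<Rightarrow> (nat \<Rightarrow> real) \<Rightarrow> nat \<Rightarrow> ucb_state \<Rightarrow> ucb_state" where
  "record_play x z t s =
     (let i = played s; N = (if local_time s \<noteq> 1 \<and> i = arm2 s then pulls2 s else pulls1 s)
      in s\<lparr>past := (past s)(t := (i, x i N, z (epoch s)))\<rparr>)"

text \<open>
  The state after the play at time \<open>t\<close>, for the reward table \<open>x\<close>, the Gaussian samples \<open>z e\<close> of the
  epochs \<open>e\<close>, and a tie-breaking rule \<open>tie t h\<close> that sees the history \<open>h\<close> before time \<open>t\<close>.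
\<close>

primrec nested_ucb ::
    "(nat \<Rightarrow> nat \<Rightarrow> real) \<Rightarrow> (nat \<Rightarrow> real) \<Rightarrow> (nat \<Rightarrow> history \<Rightarrow> bool) \<Rightarrow> nat \<Rightarrow> ucb_state" where
  "nested_ucb x z tie 0 = init_state"
| "nested_ucb x z tie (Suc t) =
     (let s = nested_ucb x z tie t
      in record_play x z (Suc t) (next_play x z (tie (Suc t) (past s)) s))"

definition nested_ucb_arm ::
    "(nat \<Rightarrow> nat \<Rightarrow> real) \<Rightarrow> (nat \<Rightarrow> real) \<Rightarrow> (nat \<Rightarrow> history \<Rightarrow> bool) \<Rightarrow> nat \<Rightarrow> nat" where
  "nested_ucb_arm x z tie t = played (nested_ucb x z tie t)"

text \<open>
  Ties between the two indices are broken by an arbitrary non-anticipating rule, which may be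
  randomized through a seed \<open>U\<close>. The last two assumptions, with the independence of the arms,
  say that the arms, the Gaussian samples and the seed are mutually independent.
\<close>

locale nested_ucb_bandit = endogenous_bandit M \<mu> g c \<kappa> X
  for M :: "'w measure" and \<mu> g c \<kappa> X +
  fixes Z :: "nat \<Rightarrow> 'w \<Rightarrow> real"
    and U :: "'w \<Rightarrow> real"
    and tie :: "real \<Rightarrow> nat \<Rightarrow> history \<Rightarrow> bool"
  assumes gaussian: "\<And>e. distributed M lborel (Z e) std_normal_density"
    and tie_measurable: "\<And>t. Measurable.pred (borel \<Otimes>\<^sub>M history_space) (\<lambda>(u, h). tie u t h)"
    and policy_indep: "indep_vars (\<lambda>_. borel) (case_nat U Z) UNIV"
    and arms_policy_indep: "indep_set
      (sets (vimage_algebra (space M) (\<lambda>\<omega> i. arm_data \<kappa> X i \<omega>) (PiM UNIV (\<lambda>_. arm_space))))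
      (sets (vimage_algebra (space M) (\<lambda>\<omega> e. case_nat U Z e \<omega>) (PiM UNIV (\<lambda>_. borel))))"

definition nested_ucb_regret ::
    "(arm_type \<Rightarrow> real) \<Rightarrow> (nat \<Rightarrow> nat \<Rightarrow> 'w \<Rightarrow> real) \<Rightarrow> (nat \<Rightarrow> 'w \<Rightarrow> real) \<Rightarrow> ('w \<Rightarrow> real) \<Rightarrow>
     (real \<Rightarrow> nat \<Rightarrow> history \<Rightarrow> bool) \<Rightarrow> nat \<Rightarrow> 'w \<Rightarrow> real" where
  "nested_ucb_regret \<mu> X Z U tie n \<omega> =
     (let x = (\<lambda>i j. X i j \<omega>)
      in regret (\<mu> Optimal) x (nested_ucb_arm x (\<lambda>e. Z e \<omega>) (tie (U \<omega>))) n)"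


section \<open>Constants of the regret bound\<close>

definition gauss_tail :: "real \<Rightarrow> real" where
  "gauss_tail v = 1 / sqrt (2 * pi) * (LBINT u:{v..}. exp (- (u\<^sup>2) / 2))"

definition T\<^sub>0 :: "real \<Rightarrow> int" where
  "T\<^sub>0 \<Delta> = \<lceil>64 / \<Delta>\<^sup>2 * (ln (64 / \<Delta>\<^sup>2))\<^sup>2\<rceil>"

definition f_thr :: "real \<Rightarrow> real" where
  "f_thr x = x + 4 * sqrt (x * ln x)"

definition \<beta>_gap :: "real \<Rightarrow> real" where
  "\<beta>_gap \<Delta> = 1 / 2 * gauss_tail (f_thr (of_int (T\<^sub>0 \<Delta>)))"

end

theory Submission
  imports Defs
begin

text \<open>
  Epoch \<open>k\<close> uses the arms \<open>2k\<close>, \<open>2k + 1\<close> and the sample \<open>Z k\<close>. By Wald's identity the expected regret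
  is the gap times the expected number of pulls of inferior arms, and these pulls are bounded epoch
  by epoch by quantities that depend on the data of that epoch alone, whatever the tie-breaking. If
  exactly one of the two arms is optimal, the analysis of UCB1 gives \<open>8 ln n / gap\<^sup>2\<close> pulls up to a
  bounded expectation. If both are inferior, then UCB pulls both arms linearly often, so the
  discarding test is performed on long samples, where it fires except with summable probability.

  An epoch with exactly one optimal arm survives forever with probability at least \<open>\<beta>\<close>: the sample
  \<open>Z k\<close> exceeds \<open>f(T\<^sub>0)\<close>, which covers the first \<open>T\<^sub>0\<close> tests, and then the drift takes over. Hence
  the expected number of such epochs is at most \<open>1 / \<beta>\<close>, and \<open>8 / (gap \<beta>)\<close> is less than the
  right-hand side because \<open>g\<close> is bounded by \<open>c\<close>. The other epochs cost \<open>O(1)\<close> each, and if the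
  series on the right converges, then the expected number of all epochs is finite.
\<close>

section \<open>Trajectories of Nested UCB\<close>

text \<open>The obstacle is adaptivity: the sample sizes inside an epoch depend on everything
  observed and on the tie rule. The estimates are therefore events for fixed sample sizes
  \<open>K\<close> and \<open>N\<close>, unioned over all values that the play might produce; this
  is what makes them independent of earlier epochs. Likewise \<open>reached k\<close> does not
  follow the actual course of play. It only asks that no earlier epoch lies in
  \<open>survives\<close>, a sufficient condition for never failing the test, and so it contains the
  event that epoch \<open>k\<close> begins. The series enters only through its convergence and
  through the lower bound \<open>1 / (\<beta> * c)\<close> for its value. The constants are coupled.
  An empirical mean is off by \<open>sqrt (3 / 2 * ln s / N)\<close> with probability at most
  \<open>2 / s ^ 3\<close>, which can be summed over two sample sizes; this width is below the UCB
  bonus \<open>sqrt (2 * ln s / N)\<close>; and two such deviations with one Gaussian sample still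
  fit under the factor 4 of the discarding test.\<close>

lemma pulls_0 [simp]: "pulls p i 0 = 0"
  by (simp add: pulls_def)

lemma pulls_Suc: "pulls p i (Suc t) = pulls p i t + (if p (Suc t) = i then 1 else 0)"
proof (cases "p (Suc t) = i")
  case True
  then have "{s \<in> {1..Suc t}. p s = i} = insert (Suc t) {s \<in> {1..t}. p s = i}"
    by auto
  then show ?thesis using True by (simp add: pulls_def)
next
  case False
  then have "{s \<in> {1..Suc t}. p s = i} = {s \<in> {1..t}. p s = i}"
    by (auto simp: le_Suc_eq)
  then show ?thesis using False by (simp add: pulls_def)
qed

lemma pulls_mono: "s \<le> t \<Longrightarrow> pulls p i s \<le> pulls p i t"
  by (rule lift_Suc_mono_le[of "pulls p i"]) (auto simp: pulls_Suc)

lemma pulls_le: "pulls p i t \<le> t"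
  by (induction t) (auto simp: pulls_Suc)

lemma pulls_cong: "(\<And>s. s \<le> t \<Longrightarrow> p s = q s) \<Longrightarrow> pulls p i t = pulls q i t"
  unfolding pulls_def by (rule arg_cong[of _ _ card]) auto

lemma pulls_pair_le: "i \<noteq> j \<Longrightarrow> pulls p i t + pulls p j t \<le> t"
  by (induction t) (auto simp: pulls_Suc)

lemma regret_eq_sum_arms:
  assumes "\<And>t. 1 \<le> t \<Longrightarrow> t \<le> n \<Longrightarrow> p t < I"
  shows "regret \<mu>1 x p n = (\<Sum>i<I. \<Sum>j = 1..pulls p i n. \<mu>1 - x i j)"
  using assms
proof (induction n)
  case 0
  then show ?case by (simp add: regret_def)
next
  case (Suc n)
  let ?i = "p (Suc n)"
  have "(\<Sum>i<I. \<Sum>j = 1..pulls p i (Suc n). \<mu>1 - x i j) =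
    (\<Sum>i<I. (\<Sum>j = 1..pulls p i n. \<mu>1 - x i j) +
      (if i = ?i then \<mu>1 - x i (pulls p i (Suc n)) else 0))"
    by (rule sum.cong) (auto simp: pulls_Suc)
  also have "\<dots> = regret \<mu>1 x p n + (\<mu>1 - x ?i (pulls p ?i (Suc n)))"
    using Suc by (simp add: sum.distrib)
  finally show ?case by (simp add: regret_def)
qed

section \<open>The invariant linking the state to global pull counts\<close>

lemma record_play_sel [simp]:
  "queries (record_play x z t s) = queries s"
  "epoch (record_play x z t s) = epoch s"
  "local_time (record_play x z t s) = local_time s"
  "arm1 (record_play x z t s) = arm1 s"
  "arm2 (record_play x z t s) = arm2 s"
  "pulls1 (record_play x z t s) = pulls1 s"
  "pulls2 (record_play x z t s) = pulls2 s"
  "samples (record_play x z t s) = samples s"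
  "played (record_play x z t s) = played s"
  by (simp_all add: record_play_def Let_def)

text \<open>Arms never return after their epoch, so the counters of the epoch are also global pull
  counts. The case \<open>local_time s = 1\<close> is separate because \<open>arm2\<close> then
  still has its value from the previous epoch, or its initial one. The counter
  \<open>samples\<close> is a minimum because that minimum grows by at most one per play.\<close>

definition valid_state :: "(nat \<Rightarrow> nat) \<Rightarrow> nat \<Rightarrow> ucb_state \<Rightarrow> bool" where
  "valid_state p t s \<longleftrightarrow>
     1 \<le> local_time s \<and> 2 * epoch s + local_time s \<le> t \<and>
     arm1 s = 2 * epoch s \<and> local_time s = pulls1 s + pulls2 s \<and> 1 \<le> pulls1 s \<and>
     (local_time s = 1 \<longrightarrow> queries s = 2 * epoch s + 1 \<and> played s = arm1 s) \<and>
     (local_time s \<noteq> 1 \<longrightarrow> arm2 s = 2 * epoch s + 1 \<and> queries s = 2 * epoch s + 2 \<and>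
        1 \<le> pulls2 s \<and> (played s = arm1 s \<or> played s = arm2 s)) \<and>
     samples s = min (pulls1 s) (pulls2 s) \<and>
     pulls p (2 * epoch s) t = pulls1 s \<and> pulls p (2 * epoch s + 1) t = pulls2 s \<and>
     (\<forall>i > 2 * epoch s + 1. pulls p i t = 0)"

lemma valid_stateD:
  assumes "valid_state p t s"
  shows "arm1 s = 2 * epoch s"
    and "2 * epoch s + local_time s \<le> t"
    and "1 \<le> local_time s"
    and "local_time s = 1 \<Longrightarrow> played s = arm1 s"
    and "local_time s \<noteq> 1 \<Longrightarrow> arm2 s = 2 * epoch s + 1"
    and "local_time s = pulls1 s + pulls2 s"
    and "pulls p (2 * epoch s) t = pulls1 s"
    and "pulls p (2 * epoch s + 1) t = pulls2 s"
    and "1 \<le> pulls1 s"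
    and "local_time s \<noteq> 1 \<Longrightarrow> 1 \<le> pulls2 s"
    and "samples s = min (pulls1 s) (pulls2 s)"
    and "local_time s \<noteq> 1 \<Longrightarrow> played s = arm1 s \<or> played s = arm2 s"
    and "2 * epoch s + 1 < i \<Longrightarrow> pulls p i t = 0"
    and "local_time s = 1 \<Longrightarrow> queries s = 2 * epoch s + 1"
    and "local_time s \<noteq> 1 \<Longrightarrow> queries s = 2 * epoch s + 2"
  using assms unfolding valid_state_def by blast+

lemma valid_state_step:
  assumes v: "valid_state p t s" and p: "played (next_play x z b s) = p (Suc t)"
  shows "valid_state p (Suc t) (next_play x z b s)"
proof -
  note D = valid_stateD[OF v]
  have lt0: "local_time s \<noteq> 0"
    using D(3) by linarith
  consider "local_time s = 1" | "local_time s \<noteq> 1" "discards x z s"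
    | "local_time s \<noteq> 1" "\<not> discards x z s" by blast
  then show ?thesis
  proof cases
    case 1
    then have n: "next_play x z b s = query_second s"
      by (simp add: next_play_def)
    have "pulls1 s = 1" "pulls2 s = 0"
      using D(6,9) 1 by linarith+
    moreover have "p (Suc t) = 2 * epoch s + 1"
      using p n D(14)[OF 1] by (simp add: query_second_def)
    ultimately show ?thesis
      using D(1,2,7,8,13) D(14)[OF 1] 1 unfolding n
      by (simp add: valid_state_def query_second_def pulls_Suc)
  next
    case 2
    then have n: "next_play x z b s = query_first (epoch s + 1) s"
      using lt0 by (simp add: next_play_def)
    have "p (Suc t) = 2 * epoch s + 2"
      using p n D(15)[OF 2(1)] by (simp add: query_first_def)
    moreover have "2 * epoch s + 3 \<le> Suc t"
      using D(2,3) 2(1) by linarith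
    ultimately show ?thesis
      using D(13) D(15)[OF 2(1)] unfolding n
      by (simp add: valid_state_def query_first_def pulls_Suc)
  next
    case 3
    then have n: "next_play x z b s = replay (plays_first x b s) s"
      using lt0 by (simp add: next_play_def)
    note E = D(1,6-9,11,13) D(5)[OF 3(1)] D(10)[OF 3(1)] D(15)[OF 3(1)]
    show ?thesis
    proof (cases "plays_first x b s")
      case True
      then have "p (Suc t) = 2 * epoch s"
        using p n D(1) by (simp add: replay_def)
      with True show ?thesis
        using D(2) lt0 E unfolding n
        by (simp add: valid_state_def replay_def Let_def pulls_Suc min_def)
    next
      case False
      then have "p (Suc t) = 2 * epoch s + 1"
        using p n D(5)[OF 3(1)] by (simp add: replay_def)
      with False show ?thesis
        using D(2) lt0 E unfolding n
        by (simp add: valid_state_def replay_def Let_def pulls_Suc min_def)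
    qed
  qed
qed

lemma nested_ucb_eq:
  "nested_ucb x z tie (Suc t) = record_play x z (Suc t)
     (next_play x z (tie (Suc t) (past (nested_ucb x z tie t))) (nested_ucb x z tie t))"
  by (simp add: Let_def)

lemma valid_state_record [simp]: "valid_state p t (record_play x z u s) = valid_state p t s"
  by (simp add: valid_state_def)

lemma nested_ucb_valid:
  "t \<ge> 1 \<Longrightarrow> valid_state (nested_ucb_arm x z tie) t (nested_ucb x z tie t)"
proof (induction t rule: nat_induct_at_least)
  case base
  show ?case
    by (simp add: valid_state_def nested_ucb_eq init_state_def next_play_def query_first_def
        pulls_Suc nested_ucb_arm_def)
next
  case (Suc t)
  show ?case
    unfolding nested_ucb_eq valid_state_record
    by (rule valid_state_step[OF Suc.IH]) (simp add: nested_ucb_arm_def Let_def)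
qed

lemma nested_ucb_arm_less:
  assumes "t \<ge> 1" "t \<le> n" shows "nested_ucb_arm x z tie t < 2 * (n + 1)"
proof -
  note v = nested_ucb_valid[OF assms(1), of x z tie]
  show ?thesis
    using valid_stateD(1-5,12)[OF v] assms(2) unfolding nested_ucb_arm_def
    by (cases "local_time (nested_ucb x z tie t) = 1") fastforce+
qed

text \<open>The discarding test of epoch \<open>k\<close> on \<open>m\<close> samples, and the comparison of the indices of two arms that
  have been pulled \<open>K\<close> and \<open>N\<close> times, hence at local time \<open>K + N\<close>; neither refers to the state.\<close>

definition stops :: "(nat \<Rightarrow> nat \<Rightarrow> real) \<Rightarrow> (nat \<Rightarrow> real) \<Rightarrow> nat \<Rightarrow> nat \<Rightarrow> bool" where
  "stops x z k m \<longleftrightarrow>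
     \<bar>z k + (\<Sum>j = 1..m. x (2 * k) j - x (2 * k + 1) j)\<bar> < 4 * sqrt (real m * ln (real m))"

definition preferred :: "(nat \<Rightarrow> nat \<Rightarrow> real) \<Rightarrow> nat \<Rightarrow> nat \<Rightarrow> nat \<Rightarrow> nat \<Rightarrow> bool" where
  "preferred x a K b N \<longleftrightarrow> ucb_index (x b) N (K + N) \<le> ucb_index (x a) K (K + N)"

text \<open>Queried arms carry fresh labels without earlier pulls. A play of an arm that already has
  a pull is therefore a replay: the test was just passed and the index comparison chose the
  arm.\<close>

lemma replayed_stepE:
  fixes x z tie t
  defines "s \<equiv> nested_ucb x z tie t" and "p \<equiv> nested_ucb_arm x z tie"
  assumes i: "p (Suc t) = i" "i = 2 * k \<or> i = 2 * k + 1" and pos: "1 \<le> pulls p i t"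
  obtains "valid_state p t s" "epoch s = k" "local_time s \<noteq> 1" "\<not> discards x z s"
    "plays_first x (tie (Suc t) (past s)) s \<longleftrightarrow> i = 2 * k"
proof -
  let ?s' = "next_play x z (tie (Suc t) (past s)) s"
  have p': "i = played ?s'"
    using i by (simp add: s_def p_def nested_ucb_arm_def Let_def)
  have "t \<ge> 1"
    using pos by (cases t) auto
  then have v: "valid_state p t s"
    unfolding s_def p_def by (rule nested_ucb_valid)
  have lt0: "local_time s \<noteq> 0"
    using valid_stateD(3)[OF v] by simp
  have lt: "local_time s \<noteq> 1"
  proof
    assume lt: "local_time s = 1"
    then have "?s' = query_second s"
      by (simp add: next_play_def)
    then have "i = queries s"
      using p' by (simp add: query_second_def)
    then have "pulls p i t = pulls2 s"
      using valid_stateD(8)[OF v] valid_stateD(14)[OF v lt] by simp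
    moreover have "pulls2 s = 0"
      using valid_stateD(6,9)[OF v] lt by linarith
    ultimately show False
      using pos by simp
  qed
  have nd: "\<not> discards x z s"
  proof
    assume "discards x z s"
    then have "?s' = query_first (epoch s + 1) s"
      using lt lt0 by (simp add: next_play_def)
    then have "i = queries s"
      using p' by (simp add: query_first_def)
    then show False
      using valid_stateD(15)[OF v lt] valid_stateD(13)[OF v, of i] pos by linarith
  qed
  let ?f = "plays_first x (tie (Suc t) (past s)) s"
  have "?s' = replay ?f s"
    using lt lt0 nd by (simp add: next_play_def)
  then have "i = (if ?f then arm1 s else arm2 s)"
    using p' by (simp add: replay_def Let_def)
  then have *: "i = (if ?f then 2 * epoch s else 2 * epoch s + 1)"
    using valid_stateD(1)[OF v] valid_stateD(5)[OF v lt] by simp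
  have "epoch s = k"
    using * i(2) by (auto split: if_splits)
  moreover have "?f \<longleftrightarrow> i = 2 * k"
    using * calculation by auto
  ultimately show thesis
    using that v lt nd by blast
qed

text \<open>When the smaller of the two pull counts rises from \<open>m\<close> to
  \<open>m + 1\<close>, the play is a replay made with \<open>samples = m\<close>, so the test on
  \<open>m\<close> samples had just been passed.\<close>

lemma not_stops_before_samples:
  assumes "1 \<le> m" "m < pulls (nested_ucb_arm x z tie) (2 * k) t"
    "m < pulls (nested_ucb_arm x z tie) (2 * k + 1) t"
  shows "\<not> stops x z k m"
  using assms(2,3)
proof (induction t)
  case (Suc t)
  let ?p = "nested_ucb_arm x z tie" and ?s = "nested_ucb x z tie t"
  show ?case
  proof (cases "m < pulls ?p (2 * k) t \<and> m < pulls ?p (2 * k + 1) t")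
    case False
    then obtain i where i: "?p (Suc t) = i" "i = 2 * k \<or> i = 2 * k + 1" "1 \<le> pulls ?p i t"
      using Suc.prems assms(1) by (auto simp: pulls_Suc split: if_splits)
    have "min (pulls ?p (2 * k) t) (pulls ?p (2 * k + 1) t) = m"
      using Suc.prems False by (auto simp: pulls_Suc split: if_splits)
    with i show ?thesis
    proof (elim replayed_stepE[of x z tie t i k])
      assume v: "valid_state ?p t ?s" and k: "epoch ?s = k" and lt: "local_time ?s \<noteq> 1"
        and nd: "\<not> discards x z ?s"
      assume "min (pulls ?p (2 * k) t) (pulls ?p (2 * k + 1) t) = m"
      then have "samples ?s = m"
        using valid_stateD(7,8,11)[OF v] k by simp
      then show ?thesis
        using nd valid_stateD(1)[OF v] valid_stateD(5)[OF v lt] k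
        by (simp add: discards_def stops_def)
    qed
  qed (use Suc.IH in auto)
qed (use assms in auto)

text \<open>The witness \<open>N\<close> is the number of pulls of \<open>b\<close> just before pull
  \<open>K + 1\<close> of \<open>a\<close>. Only the weak inequality of the indices is kept, which
  every tie rule respects.\<close>

lemma replays_preferred:
  fixes x z tie
  defines "p \<equiv> nested_ucb_arm x z tie"
  assumes ab: "a = 2 * k \<and> b = 2 * k + 1 \<or> a = 2 * k + 1 \<and> b = 2 * k"
  assumes K: "1 \<le> K" "K < pulls p a t"
  shows "\<exists>N. 1 \<le> N \<and> N \<le> pulls p b t \<and> preferred x a K b N"
  using K
proof (induction t)
  case (Suc t)
  let ?s = "nested_ucb x z tie t"
  show ?case
  proof (cases "K < pulls p a t")
    case True
    then show ?thesis
      using Suc.IH Suc.prems(1) pulls_mono[of t "Suc t" p b] by fastforce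
  next
    case False
    then have i: "p (Suc t) = a" "pulls p a t = K"
      using Suc.prems by (auto simp: pulls_Suc split: if_splits)
    have "a = 2 * k \<or> a = 2 * k + 1" "1 \<le> pulls p a t"
      using ab i Suc.prems by auto
    with i(1) obtain v: "valid_state p t ?s" and k: "epoch ?s = k" and lt: "local_time ?s \<noteq> 1"
        and f: "plays_first x (tie (Suc t) (past ?s)) ?s \<longleftrightarrow> a = 2 * k"
      unfolding p_def by (elim replayed_stepE[of x z tie t a k]) auto
    note e = valid_stateD(1)[OF v] valid_stateD(5)[OF v lt] valid_stateD(6-9)[OF v]
      valid_stateD(10)[OF v lt]
    have "preferred x a K b (pulls p b t)"
      using ab
    proof
      assume "a = 2 * k \<and> b = 2 * k + 1"
      then show ?thesis
        using e k f i(2) by (auto simp: plays_first_def Let_def preferred_def)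
    next
      assume "a = 2 * k + 1 \<and> b = 2 * k"
      then show ?thesis
        using e k f i(2) by (auto simp: plays_first_def Let_def preferred_def add.commute)
    qed
    moreover have "1 \<le> pulls p b t"
      using ab e k by auto
    ultimately show ?thesis
      using pulls_mono[of t "Suc t" p b] by auto
  qed
qed auto

lemma reached_stops:
  assumes t: "1 \<le> t" and j: "j < epoch (nested_ucb x z tie t)"
  shows "\<exists>m\<ge>1. stops x z j m"
  using t j
proof (induction t rule: nat_induct_at_least)
  case base
  then show ?case
    by (simp add: init_state_def next_play_def query_first_def Let_def)
next
  case (Suc t)
  let ?s = "nested_ucb x z tie t"
  note v = nested_ucb_valid[OF Suc.hyps, of x z tie]
  show ?case
  proof (cases "j < epoch ?s")
    case False
    then have "local_time ?s \<noteq> 1 \<and> discards x z ?s \<and> j = epoch ?s"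
      using Suc.prems valid_stateD(3)[OF v]
      by (auto simp: Let_def next_play_def query_first_def query_second_def replay_def
          split: if_splits)
    then have "stops x z j (samples ?s)" "1 \<le> samples ?s"
      using valid_stateD(1,5,9-11)[OF v] by (auto simp: discards_def stops_def)
    then show ?thesis by blast
  qed (use Suc.IH in auto)
qed

text \<open>Used in contraposed form: an epoch whose test can never fire blocks all later
  arms.\<close>

lemma pulled_earlier_stops:
  assumes i: "1 \<le> pulls (nested_ucb_arm x z tie) i t" and j: "j < i div 2"
  shows "\<exists>m\<ge>1. stops x z j m"
proof -
  have t: "1 \<le> t"
  proof (rule ccontr)
    assume "\<not> 1 \<le> t"
    then have "t = 0" by simp
    then show False using i by simp
  qed
  note v = nested_ucb_valid[OF t, of x z tie]
  from valid_stateD(13)[OF v, of i] have "i \<le> 2 * epoch (nested_ucb x z tie t) + 1"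
    using i by linarith
  with j have "j < epoch (nested_ucb x z tie t)"
    by linarith
  then show ?thesis
    using reached_stops[OF t] by simp
qed

section \<open>Non-anticipation and measurability\<close>

definition agree_before ::
    "nat \<Rightarrow> nat \<Rightarrow> (nat \<Rightarrow> nat \<Rightarrow> real) \<Rightarrow> (nat \<Rightarrow> nat \<Rightarrow> real) \<Rightarrow> bool" where
  "agree_before i j x x' \<longleftrightarrow> (\<forall>a l. 1 \<le> l \<longrightarrow> a \<noteq> i \<or> l < j \<longrightarrow> x a l = x' a l)"

lemma agree_beforeD:
  assumes "agree_before i j x x'" "pulls p i t < j" "1 \<le> l" "l \<le> pulls p a t"
  shows "x a l = x' a l"
  using assms unfolding agree_before_def by (cases "a = i") auto

lemma ucb_index_cong:
  assumes "\<And>l. 1 \<le> l \<Longrightarrow> l \<le> N \<Longrightarrow> y l = y' l"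
  shows "ucb_index y N \<tau> = ucb_index y' N \<tau>"
  unfolding ucb_index_def using assms by (simp cong: sum.cong_simp)

lemma next_play_cong:
  assumes v: "valid_state p t s" and a: "agree_before i j x x'" and i: "pulls p i t < j"
  shows "next_play x z b s = next_play x' z b s"
proof (cases "local_time s = 1")
  case True
  then show ?thesis by (simp add: next_play_def)
next
  case lt: False
  note D = valid_stateD(1,7,8,11)[OF v] valid_stateD(5)[OF v lt]
  have x1: "x (arm1 s) l = x' (arm1 s) l" if "1 \<le> l" "l \<le> pulls1 s" for l
    using agree_beforeD[OF a i] that D by simp
  have x2: "x (arm2 s) l = x' (arm2 s) l" if "1 \<le> l" "l \<le> pulls2 s" for l
    using agree_beforeD[OF a i] that D by simp
  have "(\<Sum>l = 1..samples s. x (arm1 s) l - x (arm2 s) l) =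
      (\<Sum>l = 1..samples s. x' (arm1 s) l - x' (arm2 s) l)"
    using D x1 x2 by (intro sum.cong) auto
  then have "discards x z s = discards x' z s"
    by (simp add: discards_def)
  moreover have "ucb_index (x (arm1 s)) (pulls1 s) n = ucb_index (x' (arm1 s)) (pulls1 s) n" for n
    by (rule ucb_index_cong) (rule x1)
  moreover have "ucb_index (x (arm2 s)) (pulls2 s) n = ucb_index (x' (arm2 s)) (pulls2 s) n" for n
    by (rule ucb_index_cong) (rule x2)
  ultimately show ?thesis
    by (simp add: next_play_def plays_first_def)
qed

lemma recorded_pull:
  assumes v: "valid_state p t s"
  defines "N \<equiv> if local_time s \<noteq> 1 \<and> played s = arm2 s then pulls2 s else pulls1 s"
  shows "1 \<le> N \<and> N \<le> pulls p (played s) t"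
proof (cases "local_time s = 1")
  case True
  then show ?thesis
    using valid_stateD(1,7,9)[OF v] valid_stateD(4)[OF v True] by (simp add: N_def)
next
  case False
  then show ?thesis
    using valid_stateD(1,7,8,9)[OF v] valid_stateD(5)[OF v False] valid_stateD(10)[OF v False]
      valid_stateD(12)[OF v False] by (auto simp add: N_def)
qed

text \<open>A run that has pulled arm \<open>i\<close> fewer than \<open>j\<close> times has
  consulted only rewards on which the tables agree. The full state is compared, history included,
  because the tie rule reads the history.\<close>

lemma nested_ucb_cong:
  assumes a: "agree_before i j x x'" and "pulls (nested_ucb_arm x z tie) i t < j"
  shows "nested_ucb x z tie t = nested_ucb x' z tie t"
  using assms(2)
proof (induction t)
  case (Suc t)
  let ?p = "nested_ucb_arm x z tie"
  let ?s = "nested_ucb x z tie t"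
  let ?s' = "next_play x z (tie (Suc t) (past ?s)) ?s"
  have lt: "pulls ?p i t < j"
    using Suc.prems pulls_mono[of t "Suc t" ?p i] by simp
  have IH: "nested_ucb x' z tie t = ?s"
    using Suc.IH[OF lt] by simp
  have n: "?s' = next_play x' z (tie (Suc t) (past ?s)) ?s"
  proof (cases t)
    case 0
    then show ?thesis by (simp add: next_play_def init_state_def)
  next
    case (Suc u)
    then have "valid_state ?p t ?s"
      by (intro nested_ucb_valid) simp
    from next_play_cong[OF this a lt] show ?thesis .
  qed
  have "valid_state ?p (Suc t) (nested_ucb x z tie (Suc t))"
    by (intro nested_ucb_valid) simp
  then have v: "valid_state ?p (Suc t) ?s'"
    unfolding nested_ucb_eq by simp
  let ?N = "if local_time ?s' \<noteq> 1 \<and> played ?s' = arm2 ?s' then pulls2 ?s' else pulls1 ?s'"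
  have "1 \<le> ?N \<and> ?N \<le> pulls ?p (played ?s') (Suc t)"
    using recorded_pull[OF v] .
  then have "x (played ?s') ?N = x' (played ?s') ?N"
    using agree_beforeD[OF a Suc.prems] by blast
  then have "record_play x z (Suc t) ?s' = record_play x' z (Suc t) ?s'"
    unfolding record_play_def Let_def by simp
  then show ?case
    unfolding nested_ucb_eq IH n by simp
qed simp

text \<open>Fewer than \<open>j\<close> pulls under one table force identical runs up to time
  \<open>n\<close>, hence fewer than \<open>j\<close> under the other. Once both counts reach
  \<open>j\<close> they may differ, so only the threshold is compared.\<close>

lemma pulls_ge_cong:
  assumes "agree_before i j x x'"
  shows "j \<le> pulls (nested_ucb_arm x z tie) i n \<longleftrightarrow> j \<le> pulls (nested_ucb_arm x' z tie) i n"
proof -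
  have *: "pulls (nested_ucb_arm y' z tie) i n < j"
    if a: "agree_before i j y y'" and n: "pulls (nested_ucb_arm y z tie) i n < j" for y y'
  proof -
    have "nested_ucb_arm y z tie t = nested_ucb_arm y' z tie t" if "t \<le> n" for t
    proof -
      have "pulls (nested_ucb_arm y z tie) i t < j"
        using pulls_mono[OF that] n by (rule le_less_trans)
      from nested_ucb_cong[OF a this] show ?thesis
        by (simp add: nested_ucb_arm_def)
    qed
    then show ?thesis
      using n pulls_cong[of n "nested_ucb_arm y z tie" "nested_ucb_arm y' z tie" i] by simp
  qed
  have "agree_before i j x' x"
    using assms by (simp add: agree_before_def)
  then show ?thesis
    using *[OF assms] *[of x' x] by (meson not_less)
qed

text \<open>The part of the state without the history is countable, so measurability in the table of rewards
  can be checked for each of its values separately.\<close>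

type_synonym core = "nat \<times> nat \<times> nat \<times> nat \<times> nat \<times> nat \<times> nat \<times> nat \<times> nat"

definition core :: "ucb_state \<Rightarrow> core" where
  "core s = (queries s, epoch s, local_time s, arm1 s, arm2 s, pulls1 s, pulls2 s, samples s,
    played s)"

definition of_core :: "core \<Rightarrow> ucb_state" where
  "of_core = (\<lambda>(q, e, l, a1, a2, p1, p2, m, i).
     \<lparr>queries = q, epoch = e, local_time = l, arm1 = a1, arm2 = a2, pulls1 = p1, pulls2 = p2,
      samples = m, played = i, past = (\<lambda>_. (0, 0, 0))\<rparr>)"

lemma of_core_core_sel [simp]:
  "queries (of_core (core s)) = queries s"
  "epoch (of_core (core s)) = epoch s"
  "local_time (of_core (core s)) = local_time s"
  "arm1 (of_core (core s)) = arm1 s"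
  "arm2 (of_core (core s)) = arm2 s"
  "pulls1 (of_core (core s)) = pulls1 s"
  "pulls2 (of_core (core s)) = pulls2 s"
  "samples (of_core (core s)) = samples s"
  "played (of_core (core s)) = played s"
  by (simp_all add: of_core_def core_def)

lemma core_record_play [simp]: "core (record_play x z t s) = core s"
  by (simp add: core_def)

lemma core_replay: "core (replay f (of_core (core s))) = core (replay f s)"
  unfolding core_def replay_def Let_def by (simp add: core_def[symmetric])

lemma core_next_play: "core (next_play x z b (of_core (core s))) = core (next_play x z b s)"
proof -
  have "core (query_first e (of_core (core s))) = core (query_first e s)" for e
    unfolding core_def query_first_def by (simp add: core_def[symmetric])
  moreover have "core (query_second (of_core (core s))) = core (query_second s)"
    unfolding core_def query_second_def by (simp add: core_def[symmetric])
  ultimately show ?thesis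
    unfolding next_play_def by (simp add: core_replay discards_def plays_first_def)
qed

context
  fixes N :: "'w measure" and x :: "nat \<Rightarrow> nat \<Rightarrow> 'w \<Rightarrow> real" and z :: "nat \<Rightarrow> 'w \<Rightarrow> real"
  assumes x [measurable]: "\<And>i j. x i j \<in> borel_measurable N"
    and z [measurable]: "\<And>e. z e \<in> borel_measurable N"
begin

lemma measurable_discards [measurable]:
  "Measurable.pred N (\<lambda>\<omega>. discards (\<lambda>i j. x i j \<omega>) (\<lambda>e. z e \<omega>) s)"
  unfolding discards_def by measurable

lemma measurable_plays_first [measurable]:
  assumes [measurable]: "Measurable.pred N b"
  shows "Measurable.pred N (\<lambda>\<omega>. plays_first (\<lambda>i j. x i j \<omega>) (b \<omega>) s)"
  unfolding plays_first_def ucb_index_def Let_def by measurable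

lemma measurable_core_next_play:
  assumes [measurable]: "Measurable.pred N b"
  shows "(\<lambda>\<omega>. core (next_play (\<lambda>i j. x i j \<omega>) (\<lambda>e. z e \<omega>) (b \<omega>) s)) \<in> N \<rightarrow>\<^sub>M count_space UNIV"
proof -
  have "(\<lambda>\<omega>. core (next_play (\<lambda>i j. x i j \<omega>) (\<lambda>e. z e \<omega>) (b \<omega>) s)) =
    (\<lambda>\<omega>. if local_time s = 0 then core (query_first (epoch s) s)
      else if local_time s = 1 then core (query_second s)
      else if discards (\<lambda>i j. x i j \<omega>) (\<lambda>e. z e \<omega>) s then core (query_first (epoch s + 1) s)
      else if plays_first (\<lambda>i j. x i j \<omega>) (b \<omega>) s then core (replay True s)
      else core (replay False s))"
    by (auto simp: next_play_def fun_eq_iff)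
  then show ?thesis by simp
qed

text \<open>The measure \<open>N\<close> is arbitrary because the result is needed for the
  sub-sigma-algebra \<open>before i j\<close>. Core and history are treated jointly: through the tie
  rule the next \<open>core\<close> depends on \<open>past\<close>, and the new history entry
  depends on \<open>core\<close>.\<close>

lemma measurable_nested_ucb:
  assumes u [measurable]: "u \<in> borel_measurable N"
    and tie: "\<And>t. Measurable.pred (borel \<Otimes>\<^sub>M history_space) (\<lambda>(u, h). tie u t h)"
  shows "(\<lambda>\<omega>. core (nested_ucb (\<lambda>i j. x i j \<omega>) (\<lambda>e. z e \<omega>) (tie (u \<omega>)) t)) \<in> N \<rightarrow>\<^sub>M count_space UNIV"
      (is "?C t")
    and "(\<lambda>\<omega>. past (nested_ucb (\<lambda>i j. x i j \<omega>) (\<lambda>e. z e \<omega>) (tie (u \<omega>)) t)) \<in> N \<rightarrow>\<^sub>M history_space"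
      (is "?P t")
proof (induction t)
  case 0
  show "?C 0" by simp
  show "?P 0" by (simp add: space_PiM space_pair_measure)
next
  case (Suc t)
  let ?s = "\<lambda>\<omega>. nested_ucb (\<lambda>i j. x i j \<omega>) (\<lambda>e. z e \<omega>) (tie (u \<omega>))"
  let ?b = "\<lambda>\<omega>. tie (u \<omega>) (Suc t) (past (?s \<omega> t))"
  note [measurable] = Suc
  have "(\<lambda>\<omega>. (u \<omega>, past (?s \<omega> t))) \<in> N \<rightarrow>\<^sub>M borel \<Otimes>\<^sub>M history_space"
    by (rule measurable_Pair[OF u Suc(2)])
  from measurable_compose[OF this tie[of "Suc t"]]
  have b: "Measurable.pred N ?b"
    by simp
  have eq: "core (?s \<omega> (Suc t)) =
      core (next_play (\<lambda>i j. x i j \<omega>) (\<lambda>e. z e \<omega>) (?b \<omega>) (of_core (core (?s \<omega> t))))" for \<omega>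
    unfolding nested_ucb_eq core_record_play core_next_play ..
  show C: "?C (Suc t)"
    unfolding eq
    by (rule measurable_compose_countable[OF measurable_core_next_play[OF b] Suc(1)])
  let ?N = "\<lambda>s. if local_time s \<noteq> 1 \<and> played s = arm2 s then pulls2 s else pulls1 s"
  \<comment> \<open>The reward is looked up at a random arm and pull number. Both are read off from
    \<open>core\<close>, so a countable case distinction makes the entry measurable.\<close>
  have entry: "past (?s \<omega> (Suc t)) = (past (?s \<omega> t))(Suc t := (\<lambda>c. (played (of_core c),
      x (played (of_core c)) (?N (of_core c)) \<omega>, z (epoch (of_core c)) \<omega>)) (core (?s \<omega> (Suc t))))"
        for \<omega>
  proof -
    have "past (next_play (\<lambda>i j. x i j \<omega>) (\<lambda>e. z e \<omega>) (?b \<omega>) (?s \<omega> t)) = past (?s \<omega> t)"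
      by (simp add: next_play_def query_first_def query_second_def replay_def Let_def)
    then show ?thesis
      unfolding nested_ucb_eq core_record_play by (simp add: record_play_def Let_def)
  qed
  have "(\<lambda>\<omega>. (\<lambda>c. (played (of_core c), x (played (of_core c)) (?N (of_core c)) \<omega>,
      z (epoch (of_core c)) \<omega>)) (core (?s \<omega> (Suc t)))) \<in>
      N \<rightarrow>\<^sub>M count_space UNIV \<Otimes>\<^sub>M borel \<Otimes>\<^sub>M borel"
    by (rule measurable_compose_countable[OF _ C]) measurable
  note new = this
  show "?P (Suc t)"
    unfolding entry
  proof (rule measurable_PiM_single')
    fix l :: nat
    have "(\<lambda>\<omega>. past (?s \<omega> t) l) \<in> N \<rightarrow>\<^sub>M count_space UNIV \<Otimes>\<^sub>M borel \<Otimes>\<^sub>M borel"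
      by (rule measurable_compose[OF Suc(2)]) simp
    with new show "(\<lambda>\<omega>. ((past (?s \<omega> t))(Suc t := (\<lambda>c. (played (of_core c),
      x (played (of_core c)) (?N (of_core c)) \<omega>, z (epoch (of_core c)) \<omega>)) (core (?s \<omega> (Suc t)))))
        l)
      \<in> N \<rightarrow>\<^sub>M count_space UNIV \<Otimes>\<^sub>M borel \<Otimes>\<^sub>M borel"
      by (cases "l = Suc t") auto
  qed (auto simp: space_pair_measure)
qed

lemma measurable_pulls_ge:
  assumes "u \<in> borel_measurable N"
    and "\<And>t. Measurable.pred (borel \<Otimes>\<^sub>M history_space) (\<lambda>(u, h). tie u t h)"
  shows "Measurable.pred N (\<lambda>\<omega>. j \<le>
    pulls (nested_ucb_arm (\<lambda>i j. x i j \<omega>) (\<lambda>e. z e \<omega>) (tie (u \<omega>))) i n)"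
proof -
  let ?p = "\<lambda>\<omega>. nested_ucb_arm (\<lambda>i j. x i j \<omega>) (\<lambda>e. z e \<omega>) (tie (u \<omega>))"
  have "(\<lambda>\<omega>. (\<lambda>c. played (of_core c)) (core (nested_ucb (\<lambda>i j. x i j \<omega>) (\<lambda>e. z e \<omega>) (tie (u \<omega>)) t)))
      \<in> N \<rightarrow>\<^sub>M count_space UNIV" for t
    by (rule measurable_compose[OF measurable_nested_ucb(1)[OF assms]]) simp
  then have [measurable]: "(\<lambda>\<omega>. ?p \<omega> t) \<in> N \<rightarrow>\<^sub>M count_space UNIV" for t
    unfolding nested_ucb_arm_def by simp
  have "(\<lambda>\<omega>. pulls (?p \<omega>) i n) \<in> N \<rightarrow>\<^sub>M count_space UNIV"
    by (induction n) (simp_all add: pulls_Suc)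
  then show ?thesis by simp
qed

end

section \<open>Independence\<close>

text \<open>A finite index set splits into two halves. Each half gives an event of \<A> or \<B> with
  product probability, and \<open>indep_set\<close> multiplies the two.\<close>

lemma (in prob_space) indep_sets_case_sum:
  assumes A: "indep_sets A UNIV" and B: "indep_sets B UNIV"
    and indep: "indep_set \<A> \<B>"
    and \<A>: "sigma_algebra (space M) \<A>" "\<And>i. A i \<subseteq> \<A>"
    and \<B>: "sigma_algebra (space M) \<B>" "\<And>n. B n \<subseteq> \<B>"
  shows "indep_sets (case_sum A B) (UNIV :: ('i + 'j) set)"
proof (rule indep_setsI)
  interpret \<A>: sigma_algebra "space M" \<A> by fact
  interpret \<B>: sigma_algebra "space M" \<B> by fact
  show "case_sum A B i \<subseteq> events" for i
    using A B by (auto simp: indep_sets_def split: sum.splits)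
  fix E and J :: "('i + 'j) set"
  assume J: "J \<noteq> {}" "J \<subseteq> UNIV" "finite J" and E: "\<forall>j\<in>J. E j \<in> case_sum A B j"
  define J1 J2 where "J1 = Inl -` J" and "J2 = Inr -` J"
  have fin: "finite J1" "finite J2"
    unfolding J1_def J2_def using J(3) by (auto intro: finite_vimageI)
  have J_eq: "J = Inl ` J1 \<union> Inr ` J2"
  proof (rule set_eqI)
    fix y :: "'i + 'j" show "y \<in> J \<longleftrightarrow> y \<in> Inl ` J1 \<union> Inr ` J2"
      by (cases y) (auto simp: J1_def J2_def)
  qed
  have E1: "E (Inl i) \<in> A i" if "i \<in> J1" for i using E that by (auto simp: J1_def)
  have E2: "E (Inr n) \<in> B n" if "n \<in> J2" for n using E that by (auto simp: J2_def)
  have sub1: "e \<subseteq> space M" if "e \<in> A i" for e i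
    using A that by (auto simp: indep_sets_def dest: sets.sets_into_space)
  have sub2: "e \<subseteq> space M" if "e \<in> B n" for e n
    using B that by (auto simp: indep_sets_def dest: sets.sets_into_space)
  \<comment> \<open>Intersecting with \<open>space M\<close> covers an empty half, where the
    intersection over no indices would be \<open>UNIV\<close>.\<close>
  let ?A = "space M \<inter> (\<Inter>i\<in>J1. E (Inl i))" and ?B = "space M \<inter> (\<Inter>n\<in>J2. E (Inr n))"
  have A': "?A \<in> \<A>" "prob ?A = (\<Prod>i\<in>J1. prob (E (Inl i)))"
  proof -
    show "?A \<in> \<A>"
      using fin(1) E1 \<A>(2) by (cases "J1 = {}") (auto intro!: \<A>.Int \<A>.finite_INT)
    show "prob ?A = (\<Prod>i\<in>J1. prob (E (Inl i)))"
    proof (cases "J1 = {}")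
      case True
      then show ?thesis by (simp add: prob_space)
    next
      case False
      then have "?A = (\<Inter>i\<in>J1. E (Inl i))"
        using E1 sub1 by blast
      then show ?thesis
        using indep_setsD[OF A _ False fin(1), of "\<lambda>i. E (Inl i)"] E1 by simp
    qed
  qed
  have B': "?B \<in> \<B>" "prob ?B = (\<Prod>n\<in>J2. prob (E (Inr n)))"
  proof -
    show "?B \<in> \<B>"
      using fin(2) E2 \<B>(2) by (cases "J2 = {}") (auto intro!: \<B>.Int \<B>.finite_INT)
    show "prob ?B = (\<Prod>n\<in>J2. prob (E (Inr n)))"
    proof (cases "J2 = {}")
      case True
      then show ?thesis by (simp add: prob_space)
    next
      case False
      then have "?B = (\<Inter>n\<in>J2. E (Inr n))"
        using E2 sub2 by blast
      then show ?thesis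
        using indep_setsD[OF B _ False fin(2), of "\<lambda>n. E (Inr n)"] E2 by simp
    qed
  qed
  have "E j \<subseteq> space M" if "j \<in> J" for j
    using E that sub1 sub2 by (cases j) force+
  then have "(\<Inter>j\<in>J. E j) \<subseteq> space M"
    using J(1) by blast
  then have "(\<Inter>j\<in>J. E j) = ?A \<inter> ?B"
    unfolding J_eq by blast
  then have "prob (\<Inter>j\<in>J. E j) = prob ?A * prob ?B"
    using indep_setD[OF indep A'(1) B'(1)] by simp
  also have "\<dots> = (\<Prod>j\<in>J. prob (E j))"
    unfolding A' B' J_eq using fin
    by (subst prod.union_disjoint) (auto simp: prod.reindex)
  finally show "prob (\<Inter>j\<in>J. E j) = (\<Prod>j\<in>J. prob (E j))" .
qed

context nested_ucb_bandit
begin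

text \<open>The independent sources of randomness: arm \<open>i\<close> is \<open>Inl i\<close>, the seed is \<open>Inr 0\<close>, and the Gaussian
  sample of epoch \<open>e\<close> is \<open>Inr (Suc e)\<close>.\<close>

definition src :: "nat + nat \<Rightarrow> 'w set set" where
  "src = case_sum (\<lambda>i. {arm_data \<kappa> X i -` A \<inter> space M | A. A \<in> sets arm_space})
     (\<lambda>n. {case_nat U Z n -` A \<inter> space M | A. A \<in> sets borel})"

text \<open>Encoded as a measure, so that measurability with respect to the sources in
  \<open>I\<close> is an ordinary statement about \<open>\<rightarrow>\<^sub>M\<close>.\<close>

definition info :: "(nat + nat) set \<Rightarrow> 'w measure" where
  "info I = sigma (space M) (\<Union>i\<in>I. src i)"

lemma arm_data_measurable [measurable]: "arm_data \<kappa> X i \<in> M \<rightarrow>\<^sub>M arm_space"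
  using arms_indep unfolding indep_vars_def2 by blast

lemma indep_src: "indep_sets src UNIV"
  unfolding src_def
proof (rule indep_sets_case_sum[OF _ _ arms_policy_indep])
  show "indep_sets (\<lambda>i. {arm_data \<kappa> X i -` A \<inter> space M | A. A \<in> sets arm_space}) UNIV"
    using arms_indep by (simp add: indep_vars_def2)
  show "indep_sets (\<lambda>n. {case_nat U Z n -` A \<inter> space M | A. A \<in> sets borel}) UNIV"
    using policy_indep by (simp add: indep_vars_def2)
  show "sigma_algebra (space M) (sets (vimage_algebra (space M) (\<lambda>\<omega> i. arm_data \<kappa> X i \<omega>) (PiM UNIV
    (\<lambda>_. arm_space))))"
    "sigma_algebra (space M) (sets (vimage_algebra (space M) (\<lambda>\<omega> e. case_nat U Z e \<omega>) (PiM UNIV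
      (\<lambda>_. borel))))"
    by (metis sets.sigma_algebra_axioms space_vimage_algebra)+
next
  fix i
  show "{arm_data \<kappa> X i -` A \<inter> space M | A. A \<in> sets arm_space} \<subseteq>
      sets (vimage_algebra (space M) (\<lambda>\<omega> i. arm_data \<kappa> X i \<omega>) (PiM UNIV (\<lambda>_. arm_space)))"
  proof safe
    fix A :: "(arm_type \<times> (nat \<Rightarrow> real)) set" assume "A \<in> sets arm_space"
    then have "(\<lambda>a. a i) -` A \<inter> space (PiM UNIV (\<lambda>_. arm_space)) \<in> sets (PiM UNIV (\<lambda>_. arm_space))"
      by (intro measurable_sets[OF measurable_component_singleton]) auto
    note in_vimage_algebra[OF this, of "\<lambda>\<omega> i. arm_data \<kappa> X i \<omega>" "space M"]
    moreover have "(\<lambda>\<omega> i. arm_data \<kappa> X i \<omega>) -` ((\<lambda>a. a i) -` A \<inter> space (PiM UNIV (\<lambda>_. arm_space)))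
      \<inter> space M
        = arm_data \<kappa> X i -` A \<inter> space M"
      using measurable_space[OF arm_data_measurable] by (auto simp: space_PiM)
    ultimately show "arm_data \<kappa> X i -` A \<inter> space M \<in>
        sets (vimage_algebra (space M) (\<lambda>\<omega> i. arm_data \<kappa> X i \<omega>) (PiM UNIV (\<lambda>_. arm_space)))"
      by simp
  qed
next
  fix n
  show "{case_nat U Z n -` A \<inter> space M | A. A \<in> sets borel} \<subseteq>
      sets (vimage_algebra (space M) (\<lambda>\<omega> e. case_nat U Z e \<omega>) (PiM UNIV (\<lambda>_. borel)))"
  proof safe
    fix A :: "real set" assume "A \<in> sets borel"
    then have "(\<lambda>a. a n) -` A \<inter> space (PiM UNIV (\<lambda>_. borel)) \<in> sets (PiM UNIV (\<lambda>_. borel))"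
      by (intro measurable_sets[OF measurable_component_singleton]) auto
    note in_vimage_algebra[OF this, of "\<lambda>\<omega> e. case_nat U Z e \<omega>" "space M"]
    moreover have "(\<lambda>\<omega> e. case_nat U Z e \<omega>) -` ((\<lambda>a. a n) -` A \<inter> space (PiM UNIV (\<lambda>_. borel)))
      \<inter> space M
        = case_nat U Z n -` A \<inter> space M"
      by (auto simp: space_PiM)
    ultimately show "case_nat U Z n -` A \<inter> space M \<in>
        sets (vimage_algebra (space M) (\<lambda>\<omega> e. case_nat U Z e \<omega>) (PiM UNIV (\<lambda>_. borel)))"
      by simp
  qed
qed

lemma src_events: "src i \<subseteq> events"
  using indep_src unfolding indep_sets_def by blast

lemma src_subset: "(\<Union>i\<in>I. src i) \<subseteq> Pow (space M)"
  using src_events sets.sets_into_space by blast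

lemma space_info [simp]: "space (info I) = space M"
  unfolding info_def by (rule space_measure_of) (rule src_subset)

lemma sets_info: "sets (info I) = sigma_sets (space M) (\<Union>i\<in>I. src i)"
  unfolding info_def by (rule sets_measure_of) (rule src_subset)

lemma info_mono: "I \<subseteq> J \<Longrightarrow> sets (info I) \<subseteq> sets (info J)"
  unfolding sets_info by (rule sigma_sets_mono') blast

lemma info_events: "sets (info I) \<subseteq> events"
  unfolding sets_info by (rule sets.sigma_sets_subset) (use src_events in blast)

lemma Int_stable_preimages: "Int_stable {f -` A \<inter> S | A. A \<in> sets N}"
proof (rule Int_stableI)
  fix a b assume "a \<in> {f -` A \<inter> S | A. A \<in> sets N}" "b \<in> {f -` A \<inter> S | A. A \<in> sets N}"
  then obtain A B where "A \<in> sets N" "B \<in> sets N" "a = f -` A \<inter> S" "b = f -` B \<inter> S"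
    by blast
  then have "a \<inter> b = f -` (A \<inter> B) \<inter> S" "A \<inter> B \<in> sets N"
    by auto
  then show "a \<inter> b \<in> {f -` A \<inter> S | A. A \<in> sets N}"
    by blast
qed

lemma src_Int_stable: "Int_stable (src i)"
  unfolding src_def by (cases i) (simp_all only: sum.case Int_stable_preimages)

lemma info_indep:
  assumes "I \<inter> J = {}" "A \<in> sets (info I)" "B \<in> sets (info J)"
  shows "prob (A \<inter> B) = prob A * prob B"
proof -
  have "indep_sets (\<lambda>b. sigma_sets (space M) (\<Union>i\<in>case_bool I J b. src i)) UNIV"
  proof (rule indep_sets_collect_sigma)
    show "indep_sets src (\<Union>b\<in>UNIV. case_bool I J b)"
      by (rule indep_sets_mono_index[OF _ indep_src]) auto
    show "disjoint_family (case_bool I J)"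
      using assms(1) by (auto simp: disjoint_family_on_def split: bool.splits)
  qed (rule src_Int_stable)
  from indep_setsD[OF this, of UNIV "case_bool A B"] show ?thesis
    using assms(2,3) by (simp add: UNIV_bool sets_info mult.commute Int_commute split: bool.split)
qed

lemma arm_data_info:
  assumes "Inl i \<in> I" shows "arm_data \<kappa> X i \<in> info I \<rightarrow>\<^sub>M arm_space"
proof (rule measurableI)
  show "arm_data \<kappa> X i \<omega> \<in> space arm_space" if "\<omega> \<in> space (info I)" for \<omega>
    using measurable_space[OF arm_data_measurable] that by simp
  fix A :: "(arm_type \<times> (nat \<Rightarrow> real)) set" assume "A \<in> sets arm_space"
  then have "arm_data \<kappa> X i -` A \<inter> space M \<in> src (Inl i)"
    by (auto simp: src_def)
  then show "arm_data \<kappa> X i -` A \<inter> space (info I) \<in> sets (info I)"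
    unfolding sets_info space_info using assms by (intro sigma_sets.Basic) auto
qed

lemma type_info:
  assumes "Inl i \<in> I" shows "\<kappa> i \<in> info I \<rightarrow>\<^sub>M count_space UNIV"
proof -
  have "(\<lambda>\<omega>. fst (arm_data \<kappa> X i \<omega>)) \<in> info I \<rightarrow>\<^sub>M count_space UNIV"
    by (rule measurable_compose[OF arm_data_info[OF assms]]) (simp add: arm_space_def)
  then show ?thesis by (simp add: arm_data_def)
qed

lemma reward_info:
  assumes "Inl i \<in> I" "1 \<le> j" shows "X i j \<in> borel_measurable (info I)"
proof -
  have "(\<lambda>\<omega>. snd (arm_data \<kappa> X i \<omega>) j) \<in> borel_measurable (info I)"
    using assms(2)
    by (intro measurable_compose[OF arm_data_info[OF assms(1)]] measurable_compose[OF
      measurable_snd])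
       (auto simp: arm_space_def intro!: measurable_component_singleton)
  then show ?thesis using assms(2) by (simp add: arm_data_def)
qed

lemma policy_info:
  assumes "Inr n \<in> I" shows "case_nat U Z n \<in> borel_measurable (info I)"
proof (rule measurableI)
  fix A :: "real set" assume "A \<in> sets borel"
  then have "case_nat U Z n -` A \<inter> space M \<in> src (Inr n)"
    by (auto simp: src_def)
  then show "case_nat U Z n -` A \<inter> space (info I) \<in> sets (info I)"
    unfolding sets_info space_info using assms by (intro sigma_sets.Basic) auto
qed simp

lemma gaussian_info: "Inr (Suc e) \<in> I \<Longrightarrow> Z e \<in> borel_measurable (info I)"
  using policy_info[of "Suc e" I] by simp

lemma seed_info: "Inr 0 \<in> I \<Longrightarrow> U \<in> borel_measurable (info I)"
  using policy_info[of 0 I] by simp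


section \<open>Conditioning on the type of an arm\<close>

definition typed :: "nat \<Rightarrow> arm_type \<Rightarrow> 'w set" where
  "typed i k = {\<omega> \<in> space M. \<kappa> i \<omega> = k}"

definition given :: "nat \<Rightarrow> arm_type \<Rightarrow> 'w measure" where
  "given i k = uniform_measure M (typed i k)"

lemma typed_info:
  assumes "Inl i \<in> I" shows "typed i k \<in> sets (info I)"
proof -
  have "\<kappa> i -` {k} \<inter> space (info I) \<in> sets (info I)"
    by (rule measurable_sets[OF type_info[OF assms]]) simp
  moreover have "\<kappa> i -` {k} \<inter> space (info I) = typed i k"
    by (auto simp: typed_def)
  ultimately show ?thesis by (simp only:)
qed

lemma typed_events [measurable]: "typed i k \<in> events"
  by (rule subsetD[OF info_events typed_info[OF UNIV_I]])

lemma prob_typed: "prob (typed i Optimal) = g i" "prob (typed i Inferior) = 1 - g i"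
proof -
  show *: "prob (typed i Optimal) = g i"
    using type_prob by (simp add: typed_def)
  have "k = Inferior \<longleftrightarrow> k \<noteq> Optimal" for k
    by (cases k) auto
  then have "typed i Inferior = space M - typed i Optimal"
    by (auto simp: typed_def)
  then show "prob (typed i Inferior) = 1 - g i"
    using prob_compl[OF typed_events, of i Optimal] * by simp
qed

lemma prob_typed_pos: "0 < prob (typed i k)"
  using prob_typed[of i] g_range[of i] c_bounds by (cases k) auto

lemma sets_given [measurable_cong, simp]: "sets (given i k) = events"
  by (simp add: given_def)

lemma space_given [simp]: "space (given i k) = space M"
  by (simp add: given_def)

lemma emeasure_typed: "emeasure M (typed i k) \<noteq> 0" "emeasure M (typed i k) \<noteq> \<infinity>"
  using prob_typed_pos[of i k] by (simp_all add: emeasure_eq_measure)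

lemma prob_space_given: "prob_space (given i k)"
  unfolding given_def by (rule prob_space_uniform_measure) (fact emeasure_typed)+

lemma measure_given:
  "A \<in> events \<Longrightarrow> measure (given i k) A = prob (typed i k \<inter> A) / prob (typed i k)"
  unfolding given_def by (rule measure_uniform_measure[OF emeasure_typed])

lemma integral_given:
  assumes [measurable]: "f \<in> borel_measurable M"
  shows "(\<integral>\<omega>. f \<omega> \<partial>given i k) = (\<integral>\<omega>. indicator (typed i k) \<omega> * f \<omega> \<partial>M) / prob (typed i k)"
proof -
  have "given i k = density M (\<lambda>\<omega>. ennreal (indicator (typed i k) \<omega> / prob (typed i k)))"
    unfolding given_def uniform_measure_def emeasure_eq_measure
    using prob_typed_pos[of i k]
    by (intro arg_cong[of _ _ "density M"] ext)
       (auto simp: divide_ennreal split: split_indicator simp flip: ennreal_1)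
  then have "(\<integral>\<omega>. f \<omega> \<partial>given i k) =
      (\<integral>\<omega>. indicator (typed i k) \<omega> / prob (typed i k) * f \<omega> \<partial>M)"
    by (simp add: integral_real_density)
  then show ?thesis by simp
qed

lemma reward_mean_given: "1 \<le> j \<Longrightarrow> (\<integral>\<omega>. X i j \<omega> \<partial>given i k) = \<mu> k"
  using reward_mean unfolding given_def typed_def by simp

lemma reward_indep_given: "prob_space.indep_vars (given i k) (\<lambda>_. borel) (X i) {1..}"
  using reward_indep unfolding given_def typed_def by simp

section \<open>Information available before a pull\<close>

abbreviation past_rewards :: "nat \<Rightarrow> nat \<Rightarrow> 'w measure" where
  "past_rewards i j \<equiv> vimage_algebra (space M)
     (\<lambda>\<omega>. restrict (\<lambda>l. X i l \<omega>) {1..<j}) (PiM {1..<j} (\<lambda>_. borel :: real measure))"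

text \<open>The information that decides whether arm \<open>i\<close> is pulled a \<open>j\<close>-th time.\<close>

definition before :: "nat \<Rightarrow> nat \<Rightarrow> 'w measure" where
  "before i j = sigma (space M)
     {B \<inter> R | B R. B \<in> sets (past_rewards i j)
        \<and> R \<in> sets (info (- {Inl i}))}"

lemma
  shows space_before [simp]: "space (before i j) = space M"
    and sets_before: "sets (before i j) = sigma_sets (space M)
     {B \<inter> R | B R. B \<in> sets (past_rewards i j)
        \<and> R \<in> sets (info (- {Inl i}))}"
proof -
  have "{B \<inter> R | B R. B \<in> sets (past_rewards i j)
        \<and> R \<in> sets (info (- {Inl i}))} \<subseteq> Pow (space M)"
    using sets.sets_into_space[of _ "info (- {Inl i})"] by auto
  then show "space (before i j) = space M" "sets (before i j) = sigma_sets (space M)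
     {B \<inter> R | B R. B \<in> sets (past_rewards i j)
        \<and> R \<in> sets (info (- {Inl i}))}"
    unfolding before_def by (auto simp: sets_measure_of)
qed

lemma past_rewards_sets:
  assumes B: "B \<in> sets (past_rewards i j)"
  obtains A where "A \<in> sets (PiM {1..<j} (\<lambda>_. borel))"
    "B = (\<lambda>\<omega>. restrict (\<lambda>l. X i l \<omega>) {1..<j}) -` A \<inter> space M"
  using B by (subst (asm) sets_vimage_algebra2) (auto simp: space_PiM)

lemma past_rewards_measurable:
  assumes "Inl i \<in> I"
  shows "(\<lambda>\<omega>. restrict (\<lambda>l. X i l \<omega>) {1..<j}) \<in> info I \<rightarrow>\<^sub>M PiM {1..<j} (\<lambda>_. borel)"
  by (rule measurable_restrict) (auto intro: reward_info assms)

lemma info_before: "sets (info (- {Inl i})) \<subseteq> sets (before i j)"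
proof
  fix R assume R: "R \<in> sets (info (- {Inl i}))"
  have "R = space M \<inter> R" "space M \<in> sets (past_rewards i j)"
    using sets.sets_into_space[OF R] sets.top[of "past_rewards i j"] by auto
  with R show "R \<in> sets (before i j)"
    unfolding sets_before by (intro sigma_sets.Basic) blast
qed

lemma past_reward_before:
  assumes "1 \<le> l" "l < j"
  shows "X i l \<in> borel_measurable (before i j)"
proof (rule measurableI)
  fix A :: "real set" assume A: "A \<in> sets borel"
  let ?P = "PiM {1..<j} (\<lambda>_. borel :: real measure)"
  have "(\<lambda>a. a l) -` A \<inter> space ?P \<in> sets ?P"
    using A assms by (intro measurable_sets[OF measurable_component_singleton]) auto
  note in_vimage_algebra[OF this, of "\<lambda>\<omega>. restrict (\<lambda>l. X i l \<omega>) {1..<j}" "space M"]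
  moreover have "(\<lambda>\<omega>. restrict (\<lambda>l. X i l \<omega>) {1..<j}) -` ((\<lambda>a. a l) -` A \<inter> space ?P) \<inter> space M
      = X i l -` A \<inter> space M \<inter> space M"
    using assms by (auto simp: space_PiM)
  moreover have "space M \<in> sets (info (- {Inl i}))"
    using sets.top[of "info (- {Inl i})"] by simp
  ultimately show "X i l -` A \<inter> space (before i j) \<in> sets (before i j)"
    unfolding sets_before space_before by (intro sigma_sets.Basic) auto
qed simp

lemma before_events: "sets (before i j) \<subseteq> events"
  unfolding sets_before
proof (rule sets.sigma_sets_subset, safe)
  fix B R
  assume "B \<in> sets (past_rewards i j)"
    and R: "R \<in> sets (info (- {Inl i}))"
  then obtain A where A: "A \<in> sets (PiM {1..<j} (\<lambda>_. borel))"
    "B = (\<lambda>\<omega>. restrict (\<lambda>l. X i l \<omega>) {1..<j}) -` A \<inter> space M"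
    by (elim past_rewards_sets)
  have "B \<in> sets (info {Inl i})"
    using measurable_sets[OF past_rewards_measurable A(1), of i "{Inl i}"] A(2) by simp
  then show "B \<inter> R \<in> events"
    using R info_events by blast
qed

text \<open>Given its type, arm \<open>i\<close> has independent rewards, and the other sources are
  independent of arm \<open>i\<close> altogether. The intersections of an event of earlier rewards
  with an event of the other sources form an Int-stable generator of \<open>before i j\<close>, so
  the product rule is checked only there.\<close>

lemma reward_indep_before:
  assumes j: "1 \<le> j"
  shows "prob_space.indep_set (given i k)
    (sigma_sets (space M) {X i j -` C \<inter> space M | C. C \<in> sets borel}) (sets (before i j))"
proof -
  interpret given: prob_space "given i k" by (rule prob_space_given)
  let ?C = "{X i j -` C \<inter> space M | C. C \<in> sets borel}"
  let ?G = "{B \<inter> R | B R. B \<in> sets (past_rewards i j) \<and> R \<in> sets (info (- {Inl i}))}"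
  have "given.indep_set (sigma_sets (space (given i k)) ?C) (sigma_sets (space (given i k)) ?G)"
  proof (rule given.indep_set_sigma_sets)
    show "Int_stable ?C"
      by (rule Int_stable_preimages)
    show "Int_stable ?G"
    proof (rule Int_stableI)
      fix a b assume "a \<in> ?G" "b \<in> ?G"
      then obtain B R B' R' where "a = B \<inter> R" "b = B' \<inter> R'" "B \<in> sets (past_rewards i j)"
        "B' \<in> sets (past_rewards i j)"
        "R \<in> sets (info (- {Inl i}))" "R' \<in> sets (info (- {Inl i}))" by blast
      moreover from this have "a \<inter> b = (B \<inter> B') \<inter> (R \<inter> R')" by blast
      ultimately show "a \<inter> b \<in> ?G" by blast
    qed
    show "given.indep_set ?C ?G"
    proof (rule given.indep_setI)
      show "?C \<subseteq> given.events"
        using measurable_sets[OF reward_measurable[OF j]] by auto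
      show "?G \<subseteq> given.events"
        using before_events[of i j] unfolding sets_before by (auto intro: sigma_sets.Basic)
      fix c b assume "c \<in> ?C" "b \<in> ?G"
      then obtain C B R where C: "C \<in> sets borel" "c = X i j -` C \<inter> space M"
        and B: "B \<in> sets (past_rewards i j)" and R: "R \<in> sets (info (- {Inl i}))" and b: "b =
          B \<inter> R" by blast
      from B obtain A where A: "A \<in> sets (PiM {1..<j} (\<lambda>_. borel))"
        "B = (\<lambda>\<omega>. restrict (\<lambda>l. X i l \<omega>) {1..<j}) -` A \<inter> space M" by (elim past_rewards_sets)
      have Bi: "B \<in> sets (info {Inl i})"
        using measurable_sets[OF past_rewards_measurable A(1), of i "{Inl i}"] A(2) by simp
      have ci: "c \<in> sets (info {Inl i})"
        using measurable_sets[OF reward_info C(1), of i "{Inl i}" j] C(2) j by simp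
      \<comment> \<open>Conditioning on the type of arm \<open>i\<close> leaves \<open>R\<close>
        unaffected, since \<open>typed i k\<close> and \<open>E\<close> both belong to the
        information of arm \<open>i\<close>.\<close>
      have split: "measure (given i k) (E \<inter> R) = measure (given i k) E * prob R"
        if E: "E \<in> sets (info {Inl i})" for E
      proof -
        have "typed i k \<inter> E \<in> sets (info {Inl i})"
          using E typed_info[of i "{Inl i}" k] by auto
        from info_indep[OF _ this R] have "prob (typed i k \<inter> E \<inter> R) = prob (typed i k \<inter> E) * prob R"
          by simp
        moreover have "E \<in> events" "E \<inter> R \<in> events"
          using E R info_events by blast+
        ultimately show ?thesis
          by (simp add: measure_given Int_assoc)
      qed
      have "given.indep_var (PiM {j} (\<lambda>_. borel)) (\<lambda>\<omega>. restrict (\<lambda>l. X i l \<omega>) {j})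
          (PiM {1..<j} (\<lambda>_. borel)) (\<lambda>\<omega>. restrict (\<lambda>l. X i l \<omega>) {1..<j})"
        using j by (intro given.indep_var_restrict[OF reward_indep_given]) auto
      moreover have "(\<lambda>a. a j) -` C \<inter> space (PiM {j} (\<lambda>_. borel))
        \<in> sets (PiM {j} (\<lambda>_. borel :: real measure))"
        using C(1) by (intro measurable_sets[OF measurable_component_singleton]) auto
      ultimately have "measure (given i k) ((\<lambda>\<omega>. (restrict (\<lambda>l. X i l \<omega>) {j}, restrict (\<lambda>l. X i l
        \<omega>) {1..<j})) -`
            (((\<lambda>a. a j) -` C \<inter> space (PiM {j} (\<lambda>_. borel))) \<times> A) \<inter> space M) =
          measure (given i k) ((\<lambda>\<omega>. restrict (\<lambda>l. X i l \<omega>) {j}) -`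
            ((\<lambda>a. a j) -` C \<inter> space (PiM {j} (\<lambda>_. borel))) \<inter> space M) * measure (given i k) B"
        using given.indep_varD[OF _ _ A(1)] unfolding A(2) by simp
      moreover have "(\<lambda>\<omega>. restrict (\<lambda>l. X i l \<omega>) {j}) -`
            ((\<lambda>a. a j) -` C \<inter> space (PiM {j} (\<lambda>_. borel))) \<inter> space M = c"
        unfolding C(2) by (auto simp: space_PiM)
      moreover have "(\<lambda>\<omega>. (restrict (\<lambda>l. X i l \<omega>) {j}, restrict (\<lambda>l. X i l \<omega>) {1..<j})) -`
            (((\<lambda>a. a j) -` C \<inter> space (PiM {j} (\<lambda>_. borel))) \<times> A) \<inter> space M = c \<inter> B"
        unfolding C(2) A(2) by (auto simp: space_PiM)
      ultimately have cB: "measure (given i k) (c \<inter> B) =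
        measure (given i k) c * measure (given i k) B"
        by simp
      have "measure (given i k) (c \<inter> b) = measure (given i k) (c \<inter> B) * prob R"
        unfolding b using split[of "c \<inter> B"] ci Bi by (simp add: Int_assoc)
      also have "\<dots> = measure (given i k) c * measure (given i k) b"
        unfolding b cB using split[OF Bi] by simp
      finally show "measure (given i k) (c \<inter> b) = measure (given i k) c * measure (given i k) b" .
    qed
  qed
  then show ?thesis unfolding sets_before by simp
qed

text \<open>Wald's argument for a single pull: \<open>F\<close> is decided before the reward is
  seen, so given the type the two are independent and the mean factors out.\<close>

lemma wald:
  assumes j: "1 \<le> j" and F: "F \<in> sets (before i j)"
  shows "(\<integral>\<omega>. indicator (typed i k \<inter> F) \<omega> * X i j \<omega> \<partial>M) = \<mu> k * prob (typed i k \<inter> F)"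
proof -
  interpret given: prob_space "given i k" by (rule prob_space_given)
  have Fe: "F \<in> events" using F before_events by blast
  have [measurable]: "X i j \<in> borel_measurable M" by (rule reward_measurable[OF j])
  have "given.indep_var borel (X i j) borel (indicator F :: 'w \<Rightarrow> real)"
    unfolding given.indep_var_eq
  proof (intro conjI)
    show "given.random_variable borel (X i j)" by measurable
    show "given.random_variable borel (indicator F :: 'w \<Rightarrow> real)" using Fe by measurable
    have "sigma_sets (space M) {indicator F -` A \<inter> space M | A. A
      \<in> sets (borel :: real measure)} \<subseteq> sets (before i j)"
    proof -
      have "(indicator F :: 'w \<Rightarrow> real) \<in> borel_measurable (before i j)" using F by simp
      from measurable_sets[OF this]
      have "{indicator F -` A \<inter> space M | A. A \<in> sets (borel :: real measure)} \<subseteq> sets (before i j)"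
        by auto
      from sets.sigma_sets_subset[OF this] show ?thesis by simp
    qed
    then show "given.indep_set (sigma_sets (space (given i k)) {X i j -` A
      \<inter> space (given i k) |A. A \<in> sets borel})
     (sigma_sets (space (given i k)) {indicator F -` A \<inter> space (given i k) |A. A
       \<in> sets (borel :: real measure)})"
      using reward_indep_before[OF j, of i k] unfolding given.indep_sets2_eq space_given by blast
  qed
  moreover have "integrable (given i k) (X i j)"
    using reward_range[OF j, of _ i]
    by (intro given.integrable_const_bound[where B = 1]) (auto intro!: AE_I2)
  moreover have "integrable (given i k) (indicator F :: 'w \<Rightarrow> real)"
    using Fe by (intro given.integrable_const_bound[where B = 1]) (auto intro!: AE_I2)
  ultimately have "(\<integral>\<omega>. X i j \<omega> * indicator F \<omega> \<partial>given i k) =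
      (\<integral>\<omega>. X i j \<omega> \<partial>given i k) * (\<integral>\<omega>. indicator F \<omega> \<partial>given i k)"
    by (rule given.indep_var_lebesgue_integral)
  also have "(\<integral>\<omega>. indicator F \<omega> \<partial>given i k) = prob (typed i k \<inter> F) / prob (typed i k)"
    using Fe sets.sets_into_space[OF Fe] by (simp add: measure_given Int_absorb1)
  also have "(\<integral>\<omega>. X i j \<omega> \<partial>given i k) = \<mu> k"
    by (rule reward_mean_given[OF j])
  also have "(\<integral>\<omega>. X i j \<omega> * indicator F \<omega> \<partial>given i k) =
      (\<integral>\<omega>. indicator (typed i k \<inter> F) \<omega> * X i j \<omega> \<partial>M) / prob (typed i k)"
    using Fe by (subst integral_given) (auto simp: indicator_inter_arith mult_ac)
  finally show ?thesis
    using prob_typed_pos[of i k] by (simp add: field_simps)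
qed

end

section \<open>Expected regret and pulls of inferior arms\<close>

lemma integral_double_sum:
  fixes f :: "'i \<Rightarrow> 'j \<Rightarrow> 'a \<Rightarrow> real"
  assumes "\<And>i j. i \<in> I \<Longrightarrow> j \<in> J \<Longrightarrow> integrable M (f i j)"
  shows "(\<integral>\<omega>. (\<Sum>i\<in>I. \<Sum>j\<in>J. f i j \<omega>) \<partial>M) = (\<Sum>i\<in>I. \<Sum>j\<in>J. \<integral>\<omega>. f i j \<omega> \<partial>M)"
proof -
  have "(\<integral>\<omega>. (\<Sum>i\<in>I. \<Sum>j\<in>J. f i j \<omega>) \<partial>M) = (\<Sum>i\<in>I. \<integral>\<omega>. (\<Sum>j\<in>J. f i j \<omega>) \<partial>M)"
    by (intro Bochner_Integration.integral_sum Bochner_Integration.integrable_sum assms)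
  also have "\<dots> = (\<Sum>i\<in>I. \<Sum>j\<in>J. \<integral>\<omega>. f i j \<omega> \<partial>M)"
    by (intro sum.cong refl Bochner_Integration.integral_sum assms)
  finally show ?thesis .
qed

context nested_ucb_bandit
begin

lemma integrable_indicator [simp]: "E \<in> events \<Longrightarrow> integrable M (\<lambda>\<omega>. indicator E \<omega> :: real)"
  by (rule integrable_real_indicator) (simp_all add: less_top[symmetric])

definition arm_pulls :: "nat \<Rightarrow> nat \<Rightarrow> 'w \<Rightarrow> nat" where
  "arm_pulls n i \<omega> = pulls (nested_ucb_arm (\<lambda>i j. X i j \<omega>) (\<lambda>e. Z e \<omega>) (tie (U \<omega>))) i n"

definition pulled :: "nat \<Rightarrow> nat \<Rightarrow> nat \<Rightarrow> 'w set" where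
  "pulled n i j = {\<omega> \<in> space M. j \<le> arm_pulls n i \<omega>}"

lemma info_before_measurable:
  fixes f :: "'w \<Rightarrow> real"
  assumes f: "f \<in> borel_measurable (info (- {Inl i}))"
  shows "f \<in> borel_measurable (before i j)"
proof (rule measurableI)
  fix A :: "real set" assume "A \<in> sets borel"
  from measurable_sets[OF f this] show "f -` A \<inter> space (before i j) \<in> sets (before i j)"
    using info_before by auto
qed simp

lemma pulled_before:
  assumes "1 \<le> j" shows "pulled n i j \<in> sets (before i j)"
proof -
  \<comment> \<open>Erasing the rewards from the \<open>j\<close>-th pull on does not affect whether that pull takes place.\<close>
  define X' where "X' a l \<omega> = (if l = 0 \<or> a = i \<and> j \<le> l then 0 else X a l \<omega>)" for a l \<omega>
  have X': "X' a l \<in> borel_measurable (before i j)" for a l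
  proof (cases "l = 0 \<or> a = i \<and> j \<le> l")
    case True
    then have "X' a l = (\<lambda>_. 0)" by (auto simp: X'_def)
    then show ?thesis by simp
  next
    case False
    then have "X' a l = X a l" by (auto simp: X'_def)
    moreover have "X a l \<in> borel_measurable (before i j)"
    proof (cases "a = i")
      case True
      then show ?thesis
        using False by (auto intro: past_reward_before)
    next
      case a: False
      show ?thesis
        using a False by (intro info_before_measurable reward_info) auto
    qed
    ultimately show ?thesis by simp
  qed
  have Z': "Z e \<in> borel_measurable (before i j)" for e
    by (intro info_before_measurable gaussian_info) simp
  have U': "U \<in> borel_measurable (before i j)"
    by (intro info_before_measurable seed_info) simp
  have "agree_before i j (\<lambda>a l. X a l \<omega>) (\<lambda>a l. X' a l \<omega>)" for \<omega>
    by (auto simp: agree_before_def X'_def)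
  from pulls_ge_cong[OF this]
  have "pulled n i j = {\<omega> \<in> space (before i j).
      j \<le> pulls (nested_ucb_arm (\<lambda>a l. X' a l \<omega>) (\<lambda>e. Z e \<omega>) (tie (U \<omega>))) i n}"
    unfolding pulled_def arm_pulls_def by simp
  also have "\<dots> \<in> sets (before i j)"
    using measurable_pulls_ge[of X' "before i j" Z U tie j i n, OF X' Z' U' tie_measurable]
    by (simp add: pred_def)
  finally show ?thesis .
qed

lemma pulled_events: "1 \<le> j \<Longrightarrow> pulled n i j \<in> events"
  using pulled_before before_events by blast

lemma arm_pulls_le: "arm_pulls n i \<omega> \<le> n"
  unfolding arm_pulls_def by (rule pulls_le)

lemma sum_pulled:
  assumes "\<omega> \<in> space M"
  shows "(\<Sum>j = 1..arm_pulls n i \<omega>. f j) = (\<Sum>j = 1..n. indicator (pulled n i j) \<omega> * (f j :: real))"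
proof -
  have "(\<Sum>j = 1..arm_pulls n i \<omega>. f j) = (\<Sum>j\<in>{1..n} \<inter> {j. j \<le> arm_pulls n i \<omega>}. f j)"
    using arm_pulls_le[of n i \<omega>] by (intro sum.cong) auto
  also have "\<dots> = (\<Sum>j = 1..n. if j \<le> arm_pulls n i \<omega> then f j else 0)"
    by (simp add: sum.inter_restrict)
  also have "\<dots> = (\<Sum>j = 1..n. indicator (pulled n i j) \<omega> * f j)"
    using assms by (intro sum.cong) (auto simp: pulled_def)
  finally show ?thesis .
qed

lemma typed_cases:
  assumes "\<omega> \<in> space M"
  shows "indicator (typed i Optimal) \<omega> + indicator (typed i Inferior) \<omega> = (1 :: real)"
  using assms by (cases "\<kappa> i \<omega>") (auto simp: typed_def)

text \<open>Split by type, a pull of an arm of type \<open>k\<close> costs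
  \<open>\<mu> Optimal - \<mu> k\<close> in expectation, so pulls of optimal arms contribute
  nothing.\<close>

lemma expected_pull_loss:
  assumes j: "1 \<le> j"
  shows "integrable M (\<lambda>\<omega>. indicator (pulled n i j) \<omega> * (\<mu> Optimal - X i j \<omega>))"
    and "(\<integral>\<omega>. indicator (pulled n i j) \<omega> * (\<mu> Optimal - X i j \<omega>) \<partial>M) =
      (\<mu> Optimal - \<mu> Inferior) * prob (typed i Inferior \<inter> pulled n i j)"
proof -
  let ?F = "pulled n i j"
  have F [measurable]: "?F \<in> events" by (rule pulled_events[OF j])
  have [measurable]: "X i j \<in> borel_measurable M" by (rule reward_measurable[OF j])
  have "\<bar>X i j \<omega>\<bar> \<le> 1" if "\<omega> \<in> space M" for \<omega>
    using reward_range[OF j that, of i] by auto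
  then have int: "integrable M (\<lambda>\<omega>. indicator E \<omega> * X i j \<omega>)" if [measurable]: "E \<in> events" for E
    by (intro integrable_const_bound[where B = 1] AE_I2)
       (auto simp: abs_mult split: split_indicator)
  have eq: "indicator ?F \<omega> * (\<mu> Optimal - X i j \<omega>) =
      (\<Sum>k\<in>{Optimal, Inferior}. \<mu> Optimal * indicator (typed i k \<inter> ?F) \<omega> - indicator (typed i k
        \<inter> ?F) \<omega> * X i j \<omega>)"
    if "\<omega> \<in> space M" for \<omega>
    using typed_cases[OF that, of i] by (auto simp: indicator_def typed_def split: if_splits)
  have int2: "integrable M (\<lambda>\<omega>. \<Sum>k\<in>{Optimal, Inferior}. \<mu> Optimal * indicator (typed i k \<inter> ?F) \<omega>
      - indicator (typed i k \<inter> ?F) \<omega> * X i j \<omega>)"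
    by (intro Bochner_Integration.integrable_sum Bochner_Integration.integrable_diff int
        integrable_mult_right integrable_indicator) auto
  then show "integrable M (\<lambda>\<omega>. indicator ?F \<omega> * (\<mu> Optimal - X i j \<omega>))"
    by (subst Bochner_Integration.integrable_cong[OF refl eq]) auto
  have "(\<integral>\<omega>. indicator ?F \<omega> * (\<mu> Optimal - X i j \<omega>) \<partial>M) =
     (\<integral>\<omega>. (\<Sum>k\<in>{Optimal, Inferior}. \<mu> Optimal * indicator (typed i k \<inter> ?F) \<omega>
       - indicator (typed i k \<inter> ?F) \<omega> * X i j \<omega>) \<partial>M)"
    by (intro Bochner_Integration.integral_cong eq) auto
  also have "\<dots> = (\<Sum>k\<in>{Optimal, Inferior}. \<mu> Optimal * prob (typed i k
    \<inter> ?F) - \<mu> k * prob (typed i k \<inter> ?F))"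
  proof (subst Bochner_Integration.integral_sum)
    fix k :: arm_type
    show "integrable M (\<lambda>\<omega>. \<mu> Optimal * indicator (typed i k \<inter> ?F) \<omega> - indicator (typed i k
      \<inter> ?F) \<omega> * X i j \<omega>)"
      by (intro Bochner_Integration.integrable_diff int integrable_mult_right
        integrable_indicator) auto
  next
    have "(\<integral>\<omega>. \<mu> Optimal * indicator (typed i k \<inter> ?F) \<omega> - indicator (typed i k
      \<inter> ?F) \<omega> * X i j \<omega> \<partial>M) =
        \<mu> Optimal * prob (typed i k \<inter> ?F) - \<mu> k * prob (typed i k \<inter> ?F)" for k
    proof (subst Bochner_Integration.integral_diff)
      have "typed i k \<inter> ?F \<inter> space M = typed i k \<inter> ?F"
        by (auto simp: typed_def)
      then show "(\<integral>\<omega>. \<mu> Optimal * indicator (typed i k \<inter> ?F) \<omega> \<partial>M) -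
          (\<integral>\<omega>. indicator (typed i k \<inter> ?F) \<omega> * X i j \<omega> \<partial>M) =
        \<mu> Optimal * prob (typed i k \<inter> ?F) - \<mu> k * prob (typed i k \<inter> ?F)"
        using wald[OF j pulled_before[OF j]] by simp
    qed (auto intro!: int)
    then show "(\<Sum>k\<in>{Optimal, Inferior}. \<integral>\<omega>. \<mu> Optimal * indicator (typed i k \<inter> ?F) \<omega>
        - indicator (typed i k \<inter> ?F) \<omega> * X i j \<omega> \<partial>M) =
      (\<Sum>k\<in>{Optimal, Inferior}. \<mu> Optimal * prob (typed i k \<inter> ?F) - \<mu> k * prob (typed i k \<inter> ?F))"
      by simp
  qed
  also have "\<dots> = (\<mu> Optimal - \<mu> Inferior) * prob (typed i Inferior \<inter> ?F)"
    by (simp add: algebra_simps)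
  finally show "(\<integral>\<omega>. indicator ?F \<omega> * (\<mu> Optimal - X i j \<omega>) \<partial>M) =
      (\<mu> Optimal - \<mu> Inferior) * prob (typed i Inferior \<inter> ?F)" .
qed

definition inferior_pulls :: "nat \<Rightarrow> nat \<Rightarrow> 'w \<Rightarrow> real" where
  "inferior_pulls n k \<omega> =
    (\<Sum>i\<in>{2 * k, 2 * k + 1}. indicator (typed i Inferior) \<omega> * real (arm_pulls n i \<omega>))"

lemma inferior_pulls_eq:
  "\<omega> \<in> space M \<Longrightarrow> inferior_pulls n k \<omega> =
    (\<Sum>i\<in>{2 * k, 2 * k + 1}. \<Sum>j = 1..n. indicator (typed i Inferior \<inter> pulled n i j) \<omega>)"
  using sum_pulled[of \<omega> "\<lambda>_. 1" n] unfolding inferior_pulls_def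
  by (simp add: sum_distrib_left indicator_inter_arith)

lemma integrable_inferior_pulls: "integrable M (inferior_pulls n k)"
proof -
  have "integrable M (\<lambda>\<omega>. \<Sum>i\<in>{2 * k, 2 * k + 1}. \<Sum>j =
    1..n. indicator (typed i Inferior \<inter> pulled n i j) \<omega> :: real)"
    using pulled_events by (intro Bochner_Integration.integrable_sum integrable_indicator) auto
  then show ?thesis
    by (subst Bochner_Integration.integrable_cong[OF refl inferior_pulls_eq]) auto
qed

lemma sum_pairs: "(\<Sum>i<2 * m. f i) = (\<Sum>k<m. f (2 * k) + f (2 * k + 1 :: nat))"
  by (induction m) (auto simp: algebra_simps)

text \<open>Labels played up to time \<open>n\<close> are below \<open>2 * (n + 1)\<close>, so the
  epochs \<open>k \<le> n\<close> exhaust the arms.\<close>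

lemma expected_regret:
  "(\<integral>\<omega>. nested_ucb_regret \<mu> X Z U tie n \<omega> \<partial>M) =
     (\<mu> Optimal - \<mu> Inferior) * (\<Sum>k\<le>n. \<integral>\<omega>. inferior_pulls n k \<omega> \<partial>M)"
proof -
  have "(\<integral>\<omega>. nested_ucb_regret \<mu> X Z U tie n \<omega> \<partial>M) =
    (\<integral>\<omega>. (\<Sum>i<2 * (n + 1). \<Sum>j = 1..n. indicator (pulled n i j) \<omega> * (\<mu> Optimal - X i j \<omega>)) \<partial>M)"
  proof (rule Bochner_Integration.integral_cong[OF refl])
    fix \<omega> assume \<omega>: "\<omega> \<in> space M"
    have "nested_ucb_regret \<mu> X Z U tie n \<omega> =
        (\<Sum>i<2 * (n + 1). \<Sum>j = 1..arm_pulls n i \<omega>. \<mu> Optimal - X i j \<omega>)"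
      unfolding nested_ucb_regret_def Let_def arm_pulls_def
      by (rule regret_eq_sum_arms) (rule nested_ucb_arm_less)
    then show "nested_ucb_regret \<mu> X Z U tie n \<omega> =
        (\<Sum>i<2 * (n + 1). \<Sum>j = 1..n. indicator (pulled n i j) \<omega> * (\<mu> Optimal - X i j \<omega>))"
      by (simp only: sum_pulled[OF \<omega>])
  qed
  also have "\<dots> = (\<Sum>i<2 * (n + 1). \<Sum>j =
    1..n. (\<mu> Optimal - \<mu> Inferior) * prob (typed i Inferior \<inter> pulled n i j))"
    by (subst integral_double_sum; (intro sum.cong refl)?; intro expected_pull_loss;
      simp only: atLeastAtMost_iff)
  also have "\<dots> = (\<mu> Optimal - \<mu> Inferior) * (\<Sum>i<2 * (n + 1). \<Sum>j =
    1..n. prob (typed i Inferior \<inter> pulled n i j))"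
    by (simp only: sum_distrib_left)
  also have "(\<Sum>i<2 * (n + 1). \<Sum>j = 1..n. prob (typed i Inferior \<inter> pulled n i j)) =
      (\<Sum>k<n + 1. \<integral>\<omega>. inferior_pulls n k \<omega> \<partial>M)"
    unfolding sum_pairs
  proof (rule sum.cong[OF refl])
    fix k
    have sp: "typed i Inferior \<inter> pulled n i j \<inter> space M = typed i Inferior \<inter> pulled n i j" for i j
      by (auto simp: typed_def)
    have ev: "typed i Inferior \<inter> pulled n i j \<in> events" if "j \<in> {1..n}" for i j
      using that pulled_events by auto
    have "(\<integral>\<omega>. inferior_pulls n k \<omega> \<partial>M) =
      (\<integral>\<omega>. (\<Sum>i\<in>{2 * k, 2 * k + 1}. \<Sum>j = 1..n. indicator (typed i Inferior \<inter> pulled n i j) \<omega>) \<partial>M)"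
      by (intro Bochner_Integration.integral_cong inferior_pulls_eq) auto
    also have "\<dots> = (\<Sum>i\<in>{2 * k, 2 * k + 1}. \<Sum>j = 1..n. prob (typed i Inferior \<inter> pulled n i j))"
      using ev by (subst integral_double_sum) (auto simp: sp)
    finally show "(\<Sum>j = 1..n. prob (typed (2 * k) Inferior \<inter> pulled n (2 * k) j)) +
        (\<Sum>j = 1..n. prob (typed (2 * k + 1) Inferior \<inter> pulled n (2 * k + 1) j)) =
      (\<integral>\<omega>. inferior_pulls n k \<omega> \<partial>M)" by simp
  qed
  finally show ?thesis
    by (simp only: lessThan_Suc_atMost Suc_eq_plus1[symmetric])
qed


section \<open>Concentration\<close>

text \<open>Centred at the mean of the random type, so that one event serves both types and later
  union bounds need no conditioning.\<close>

definition deviation :: "nat \<Rightarrow> nat \<Rightarrow> 'w \<Rightarrow> real" where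
  "deviation i N \<omega> = (\<Sum>j = 1..N. X i j \<omega>) - real N * \<mu> (\<kappa> i \<omega>)"

text \<open>With this scale Hoeffding's bound is \<open>2 * exp (- 3 * y)\<close>, that is
  \<open>2 / s ^ 3\<close> for \<open>y = ln s\<close>. Cubic decay can be summed over a second
  sample size and still leaves a convergent series. The factor 3/2 is below the 2 of the UCB bonus,
  which gives room for comparing two arms of equal type.\<close>

definition deviates :: "nat \<Rightarrow> nat \<Rightarrow> real \<Rightarrow> 'w set" where
  "deviates i N y = {\<omega> \<in> space M. sqrt (3 / 2 * y * real N) \<le> \<bar>deviation i N \<omega>\<bar>}"

lemma deviates_info:
  assumes "Inl i \<in> I" shows "deviates i N y \<in> sets (info I)"
proof -
  have m1: "(\<lambda>\<omega>. \<Sum>j = 1..N. X i j \<omega>) \<in> borel_measurable (info I)"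
    by (intro borel_measurable_sum reward_info assms) auto
  have m2: "(\<lambda>\<omega>. \<mu> (\<kappa> i \<omega>)) \<in> borel_measurable (info I)"
    by (rule measurable_compose[OF type_info[OF assms]]) simp
  have [measurable]: "(\<lambda>\<omega>. deviation i N \<omega>) \<in> borel_measurable (info I)"
    unfolding deviation_def
      by (intro borel_measurable_diff borel_measurable_times m1 m2 borel_measurable_const)
  have "{\<omega> \<in> space (info I). sqrt (3 / 2 * y * real N) \<le> \<bar>deviation i N \<omega>\<bar>} \<in> sets (info I)"
    by measurable
  then show ?thesis by (simp add: deviates_def)
qed

lemma deviates_events [measurable]: "deviates i N y \<in> events"
  by (rule subsetD[OF info_events deviates_info[OF UNIV_I]])

text \<open>The factor \<open>prob (typed i k)\<close> is retained because optimal arms may become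
  arbitrarily rare; \<open>prob_typed_calm\<close> needs a failure probability relative to the
  type.\<close>

lemma prob_typed_deviates:
  assumes N: "1 \<le> N" and y: "0 \<le> y"
  shows "prob (typed i k \<inter> deviates i N y) \<le> 2 * exp (- 3 * y) * prob (typed i k)"
proof -
  interpret given: prob_space "given i k" by (rule prob_space_given)
  interpret H: Hoeffding_ineq "given i k" "{1..N}" "X i" "\<lambda>_. 0" "\<lambda>_. 1"
    "\<Sum>j\<in>{1..N}. given.expectation (X i j)"
  proof unfold_locales
    show "given.indep_vars (\<lambda>_. borel) (X i) {1..N}"
      by (rule given.indep_vars_subset[OF reward_indep_given]) auto
    show "AE \<omega> in given i k. X i j \<omega> \<in> {0..1}" if "j \<in> {1..N}" for j
      using reward_range[of j _ i] that by (intro AE_I2) auto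
  qed (simp_all add: atLeastAtMost_def)
  let ?\<epsilon> = "sqrt (3 / 2 * y * real N)"
  have mean: "(\<Sum>j\<in>{1..N}. given.expectation (X i j)) = real N * \<mu> k"
    using reward_mean_given by simp
  have "typed i k \<inter> deviates i N y = typed i k \<inter> {\<omega> \<in> space M. ?\<epsilon> \<le>
    \<bar>(\<Sum>j\<in>{1..N}. X i j \<omega>) - real N * \<mu> k\<bar>}"
    by (auto simp: typed_def deviates_def deviation_def)
  moreover have "{\<omega> \<in> space M. ?\<epsilon> \<le> \<bar>(\<Sum>j\<in>{1..N}. X i j \<omega>) - real N * \<mu> k\<bar>} \<in> events"
  proof -
    have [measurable]: "(\<lambda>\<omega>. \<Sum>j\<in>{1..N}. X i j \<omega>) \<in> borel_measurable M"
      using reward_measurable by (intro borel_measurable_sum) auto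
    show ?thesis by measurable
  qed
  ultimately have "prob (typed i k \<inter> deviates i N y) =
      given.prob {\<omega> \<in> space M. ?\<epsilon> \<le> \<bar>(\<Sum>j\<in>{1..N}. X i j \<omega>) - real N * \<mu> k\<bar>} * prob (typed i k)"
    using prob_typed_pos[of i k] by (simp add: measure_given)
  also have "given.prob {\<omega> \<in> space M. ?\<epsilon> \<le> \<bar>(\<Sum>j\<in>{1..N}. X i j \<omega>) - real N * \<mu> k\<bar>}
      \<le> 2 * exp (- 2 * ?\<epsilon>\<^sup>2 / (\<Sum>j\<in>{1..N}. (1 - 0)\<^sup>2))"
    using H.Hoeffding_ineq_abs_ge[of ?\<epsilon>] N y unfolding mean by simp
  also have "- 2 * ?\<epsilon>\<^sup>2 / (\<Sum>j\<in>{1..N}. (1 - 0)\<^sup>2) = - 3 * y"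
    using N y by simp
  finally show ?thesis
    using prob_typed_pos[of i k] by simp
qed

lemma prob_deviates:
  assumes "1 \<le> N" "0 \<le> y"
  shows "prob (deviates i N y) \<le> 2 * exp (- 3 * y)"
proof -
  have "deviates i N y = (typed i Optimal \<inter> deviates i N y) \<union> (typed i Inferior \<inter> deviates i N y)"
  proof -
    have "k = Optimal \<or> k = Inferior" for k by (cases k) auto
    then show ?thesis by (auto simp: deviates_def typed_def)
  qed
  then have "prob (deviates i N y) \<le>
    prob (typed i Optimal \<inter> deviates i N y) + prob (typed i Inferior \<inter> deviates i N y)"
    using measure_Un_le[of "typed i Optimal \<inter> deviates i N y" M "typed i Inferior
      \<inter> deviates i N y"] by simp
  also have "\<dots> \<le> 2 * exp (- 3 * y) * prob (typed i Optimal) +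
    2 * exp (- 3 * y) * prob (typed i Inferior)"
    by (intro add_mono prob_typed_deviates assms)
  also have "\<dots> = 2 * exp (- 3 * y)"
    by (simp add: prob_typed algebra_simps)
  finally show ?thesis .
qed

lemma prob_deviates_ln:
  assumes "1 \<le> N" "1 \<le> s"
  shows "prob (deviates i N (ln (real s))) \<le> 2 / real s ^ 3"
proof -
  have "exp (- 3 * ln (real s)) = 1 / real s ^ 3"
    using assms(2) exp_of_nat_mult[of 3 "ln (real s)"] by (simp add: exp_minus field_simps)
  then show ?thesis
    using prob_deviates[OF assms(1), of "ln (real s)" i] assms(2) by simp
qed

section \<open>Tails of the Gaussian sample\<close>

lemma gaussian_measurable [measurable]: "Z e \<in> borel_measurable M"
  using gaussian distributed_measurable by fastforce

lemma gaussian_integral: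
  "h \<in> borel_measurable lborel \<Longrightarrow> (\<integral>x. std_normal_density x * h x \<partial>lborel) = (\<integral>\<omega>. h (Z e \<omega>) \<partial>M)"
  by (rule distributed_integral[OF gaussian]) auto

lemma gaussian_ge: "prob {\<omega> \<in> space M. v \<le> Z e \<omega>} = gauss_tail v"
proof -
  have "prob {\<omega> \<in> space M. v \<le> Z e \<omega>} = (\<integral>\<omega>. indicator {\<omega> \<in> space M. v \<le> Z e \<omega>} \<omega> \<partial>M)"
    by (simp add: Int_absorb2)
  also have "\<dots> = (\<integral>\<omega>. indicator {v..} (Z e \<omega>) \<partial>M)"
    by (intro Bochner_Integration.integral_cong) (auto simp: indicator_def)
  also have "\<dots> = (\<integral>x. std_normal_density x * indicator {v..} x \<partial>lborel)"
    by (rule gaussian_integral[symmetric]) auto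
  also have "\<dots> = gauss_tail v"
    unfolding gauss_tail_def set_lebesgue_integral_def std_normal_density_def
    by (subst integral_mult_right_zero[symmetric]) (simp add: mult_ac)
  finally show ?thesis .
qed

lemma gaussian_le: "prob {\<omega> \<in> space M. Z e \<omega> \<le> - v} = gauss_tail v"
proof -
  have "distributed M lborel (\<lambda>\<omega>. 0 + (-1) * Z e \<omega>) (normal_density (0 + (-1) * 0) (\<bar>-1\<bar> * 1))"
    by (rule normal_density_affine[OF gaussian]) auto
  then have D: "distributed M lborel (\<lambda>\<omega>. - Z e \<omega>) std_normal_density"
    by simp
  have "prob {\<omega> \<in> space M. Z e \<omega> \<le> - v} = (\<integral>\<omega>. indicator {\<omega> \<in> space M. Z e \<omega> \<le> - v} \<omega> \<partial>M)"
    by (simp add: Int_absorb2)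
  also have "\<dots> = (\<integral>\<omega>. indicator {v..} (- Z e \<omega>) \<partial>M)"
    by (intro Bochner_Integration.integral_cong) (auto simp: indicator_def)
  also have "\<dots> = (\<integral>x. std_normal_density x * indicator {v..} x \<partial>lborel)"
    by (rule distributed_integral[OF D, symmetric]) auto
  also have "\<dots> = (\<integral>\<omega>. indicator {v..} (Z e \<omega>) \<partial>M)"
    by (rule gaussian_integral) auto
  also have "\<dots> = (\<integral>\<omega>. indicator {\<omega> \<in> space M. v \<le> Z e \<omega>} \<omega> \<partial>M)"
    by (intro Bochner_Integration.integral_cong) (auto simp: indicator_def)
  also have "\<dots> = gauss_tail v"
    by (simp add: Int_absorb2 gaussian_ge)
  finally show ?thesis .
qed

lemma gauss_tail_pos:
  assumes v: "0 \<le> v" shows "0 < gauss_tail v"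
proof -
  \<comment> \<open>The density decreases on \<open>{v..v + 1}\<close>, so its value at the right
    end is a lower bound for the tail.\<close>
  let ?c = "std_normal_density (v + 1)"
  have "?c = (\<integral>x. ?c * indicator {v..v + 1} x \<partial>lborel)"
    by simp
  also have "\<dots> \<le> (\<integral>x. std_normal_density x * indicator {v..} x \<partial>lborel)"
  proof (rule integral_mono)
    show "integrable lborel (\<lambda>x. std_normal_density x * indicator {v..} x)"
      using integrable_mult_indicator[of "{v..}" lborel std_normal_density]
      by (simp add: mult.commute)
    show "?c * indicator {v..v + 1} x \<le> std_normal_density x * indicator {v..} x" for x
      using v by (auto simp: std_normal_density_def indicator_def
        intro!: divide_right_mono power_mono)
  qed simp
  also have "\<dots> = gauss_tail v"
    using gaussian_integral[of "indicator {v..}"] gaussian_ge[of v]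
    unfolding gauss_tail_def set_lebesgue_integral_def std_normal_density_def
    by (subst integral_mult_right_zero[symmetric]) (simp add: mult_ac)
  finally show ?thesis
    using normal_density_pos[of 1 0 "v + 1"] by linarith
qed

text \<open>Markov's inequality for the fourth moment, which equals 3. At
  \<open>a = sqrt (h * ln h)\<close> this decays like the square of \<open>1 / (h * ln h)\<close>
  and is summable over \<open>h\<close>; the second moment would give only
  \<open>1 / (h * ln h)\<close>, which is not.\<close>

lemma gaussian_abs_ge:
  assumes a: "0 < a"
  shows "prob {\<omega> \<in> space M. a \<le> \<bar>Z e \<omega>\<bar>} \<le> 3 / a ^ 4"
proof -
  have m4: "(\<integral>x. std_normal_density x * x ^ 4 \<partial>lborel) = 3"
    using integral_std_normal_moment_even[of 2] by (simp add: fact_numeral)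
  have int: "integrable M (\<lambda>\<omega>. Z e \<omega> ^ 4)"
    using distributed_integrable[OF gaussian, of "\<lambda>x. x ^ 4" e] integrable_std_normal_moment[of 4]
      by simp
  have "prob {\<omega> \<in> space M. a \<le> \<bar>Z e \<omega>\<bar>} = prob {\<omega> \<in> space M. a ^ 4 \<le> Z e \<omega> ^ 4}"
  proof -
    have "a \<le> \<bar>x\<bar> \<longleftrightarrow> a ^ 4 \<le> x ^ 4" for x :: real
      using a power_mono_iff[of a "\<bar>x\<bar>" 4] by simp
    then show ?thesis by simp
  qed
  also have "\<dots> \<le> (\<integral>\<omega>. Z e \<omega> ^ 4 \<partial>M) / a ^ 4"
    using a by (intro integral_Markov_inequality_measure[where A = "space M"] int) auto
  also have "(\<integral>\<omega>. Z e \<omega> ^ 4 \<partial>M) = 3"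
    using gaussian_integral[of "\<lambda>x. x ^ 4" e] m4 by simp
  finally show ?thesis .
qed


section \<open>Consequences of small deviations\<close>

definition gap :: real where "gap = \<mu> Optimal - \<mu> Inferior"

lemma not_deviates:
  assumes "\<omega> \<in> space M" "\<omega> \<notin> deviates i N y" "1 \<le> N"
  shows "\<bar>deviation i N \<omega>\<bar> < sqrt (3 / 2 * y * real N)"
    and "deviation i N \<omega> / real N < sqrt (3 / 2 * (y / real N))"
    and "- (deviation i N \<omega> / real N) < sqrt (3 / 2 * (y / real N))"
proof -
  show *: "\<bar>deviation i N \<omega>\<bar> < sqrt (3 / 2 * y * real N)"
    using assms by (auto simp: deviates_def)
  have "sqrt (3 / 2 * y * real N) / sqrt ((real N)\<^sup>2) = sqrt (3 / 2 * y * real N / (real N)\<^sup>2)"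
    by (rule real_sqrt_divide[symmetric])
  also have "3 / 2 * y * real N / (real N)\<^sup>2 = 3 / 2 * (y / real N)"
    using assms(3) by (simp add: power2_eq_square)
  finally have eq: "sqrt (3 / 2 * y * real N) / real N = sqrt (3 / 2 * (y / real N))"
    by simp
  have "\<bar>deviation i N \<omega>\<bar> / real N < sqrt (3 / 2 * y * real N) / real N"
    using * assms(3) by (intro divide_strict_right_mono) auto
  then have "\<bar>deviation i N \<omega> / real N\<bar> < sqrt (3 / 2 * (y / real N))"
    unfolding eq by simp
  then show "deviation i N \<omega> / real N < sqrt (3 / 2 * (y / real N))"
    "- (deviation i N \<omega> / real N) < sqrt (3 / 2 * (y / real N))"
    by linarith+
qed

lemma preferredD:
  assumes "preferred (\<lambda>i j. X i j \<omega>) a K b N" "1 \<le> K" "1 \<le> N"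
  shows "\<mu> (\<kappa> b \<omega>) + deviation b N \<omega> / real N + sqrt (2 * (ln (real (K + N)) / real N))
    \<le> \<mu> (\<kappa> a \<omega>) + deviation a K \<omega> / real K + sqrt (2 * (ln (real (K + N)) / real K))"
proof -
  have "(\<Sum>j = 1..N. X i j \<omega>) / real N = \<mu> (\<kappa> i \<omega>) + deviation i N \<omega> / real N" if "1 \<le> N" for i N
    using that by (simp add: deviation_def field_simps)
  from this[OF assms(2)] this[OF assms(3)] show ?thesis
    using assms(1) by (simp add: preferred_def ucb_index_def)
qed

text \<open>The UCB1 argument: without these deviations the index comparison gives
  \<open>gap < 2 * sqrt (2 * ln (K + N) / K)\<close>, which is impossible from
  \<open>8 * ln n / gap^2\<close> pulls on. For arm \<open>a\<close> the level \<open>ln K\<close>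
  suffices, so its event does not involve \<open>N\<close> and needs no union over it.\<close>

lemma inferior_preferred_deviates:
  assumes \<omega>: "\<omega> \<in> space M" and pref: "preferred (\<lambda>i j. X i j \<omega>) a K b N"
    and K: "1 \<le> K" and N: "1 \<le> N"
    and types: "\<omega> \<in> typed a Inferior" "\<omega> \<in> typed b Optimal"
    and n: "K + N \<le> n" and large: "8 * ln (real n) / gap\<^sup>2 \<le> real K"
  shows "\<omega> \<in> deviates a K (ln (real K)) \<union> deviates b N (ln (real (K + N)))"
proof (rule ccontr)
  assume *: "\<omega> \<notin> deviates a K (ln (real K)) \<union> deviates b N (ln (real (K + N)))"
  let ?L = "ln (real (K + N))"
  have gap: "0 < gap" using gap by (simp add: gap_def)
  have L: "0 \<le> ?L" using K by simp
  have "deviation a K \<omega> / real K < sqrt (3 / 2 * (ln (real K) / real K))"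
    using * by (intro not_deviates(2)[OF \<omega> _ K]) simp
  also have "\<dots> \<le> sqrt (2 * (?L / real K))"
  proof (rule real_sqrt_le_mono)
    have "ln (real K) / real K \<le> ?L / real K" "0 \<le> ?L / real K"
      using K L by (auto intro!: divide_right_mono)
    then show "3 / 2 * (ln (real K) / real K) \<le> 2 * (?L / real K)" by linarith
  qed
  finally have a: "deviation a K \<omega> / real K < sqrt (2 * (?L / real K))" .
  have "- (deviation b N \<omega> / real N) < sqrt (3 / 2 * (?L / real N))"
    using * by (intro not_deviates(3)[OF \<omega> _ N]) simp
  also have "\<dots> \<le> sqrt (2 * (?L / real N))"
    using L by (intro real_sqrt_le_mono mult_right_mono) auto
  finally have "gap < 2 * sqrt (2 * (?L / real K))"
    using preferredD[OF pref K N] a types by (simp add: gap_def typed_def)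
  then have "gap\<^sup>2 < (2 * sqrt (2 * (?L / real K)))\<^sup>2"
    using gap by (intro power_strict_mono) auto
  also have "\<dots> = 8 * ?L / real K"
    using L by (simp add: power_mult_distrib)
  also have "\<dots> \<le> 8 * ln (real n) / real K"
    using n K by (intro divide_right_mono mult_left_mono) auto
  finally have "gap\<^sup>2 * real K < 8 * ln (real n)"
    using K by (simp add: field_simps)
  moreover have "8 * ln (real n) \<le> real K * gap\<^sup>2"
    using large gap by (simp add: field_simps)
  ultimately show False by (simp add: mult.commute)
qed

text \<open>Two arms of equal type: the bonus of an arm with \<open>256\<close> times fewer pulls is \<open>16\<close> times as
  large, so playing the other arm requires a deviation.\<close>

lemma equal_preferred_deviates:
  assumes \<omega>: "\<omega> \<in> space M" and pref: "preferred (\<lambda>i j. X i j \<omega>) a K b N"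
    and N: "1 \<le> N" "256 * N \<le> K" and types: "\<kappa> a \<omega> = \<kappa> b \<omega>"
  shows "\<omega> \<in> deviates a K (ln (real K)) \<union> deviates b N (ln (real K))"
proof (rule ccontr)
  assume *: "\<omega> \<notin> deviates a K (ln (real K)) \<union> deviates b N (ln (real K))"
  have K: "1 \<le> K" using N by simp
  let ?L = "ln (real (K + N))"
  define u w where "u = sqrt (?L / real N)" and "w = sqrt (?L / real K)"
  have L: "0 \<le> ?L" "ln (real K) \<le> ?L" using K by auto
  have wu: "w \<le> u / 16"
  proof -
    have "?L / real K \<le> ?L / (256 * real N)"
      using N K L by (intro divide_left_mono) (auto simp flip: of_nat_mult)
    then have "w \<le> sqrt (?L / real N / 256)"
      unfolding w_def by (simp add: mult.commute)
    also have "\<dots> = u / 16"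
      unfolding u_def by (subst real_sqrt_divide) simp
    finally show ?thesis .
  qed
  have dev: "sqrt (3 / 2 * (ln (real K) / real m)) \<le> sqrt (3 / 2) * sqrt (?L / real m)" for m
    unfolding real_sqrt_mult[symmetric] using L
    by (intro real_sqrt_le_mono mult_left_mono divide_right_mono) auto
  have "deviation a K \<omega> / real K < sqrt (3 / 2) * w"
    using not_deviates(2)[OF \<omega> _ K, of a "ln (real K)"] * dev[of K] unfolding w_def
      by (meson UnI1 less_le_trans)
  moreover have "- (deviation b N \<omega> / real N) < sqrt (3 / 2) * u"
    using not_deviates(3)[OF \<omega> _ N(1), of b "ln (real K)"] * dev[of N] unfolding u_def
      by (meson UnI2 less_le_trans)
  moreover have "deviation b N \<omega> / real N + sqrt 2 * u \<le> deviation a K \<omega> / real K + sqrt 2 * w"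
    using preferredD[OF pref K N(1)] types unfolding u_def w_def
      by (simp only: real_sqrt_mult[symmetric])
  ultimately have strict: "sqrt 2 * (u - w) < sqrt (3 / 2) * (u + w)"
    unfolding ring_distribs by linarith
  have u: "0 \<le> u" unfolding u_def using L by simp
  have "sqrt (3 / 2) * (u + w) \<le> sqrt (3 / 2) * (17 / 16 * u)"
    using wu by (intro mult_left_mono) auto
  also have "\<dots> = (sqrt (3 / 2) * 17) * (u / 16)"
    by simp
  also have "\<dots> \<le> (sqrt 2 * 15) * (u / 16)"
  proof (rule mult_right_mono)
    \<comment> \<open>This is where the ratio 16 is used: the squares are 433.5 and 450. A ratio of
      8 would be too small.\<close>
    show "sqrt (3 / 2) * 17 \<le> sqrt 2 * (15 :: real)"
    proof (rule power2_le_imp_le)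
      show "(sqrt (3 / 2) * 17)\<^sup>2 \<le> (sqrt 2 * (15 :: real))\<^sup>2"
        by (simp add: power_mult_distrib)
    qed simp
  qed (use u in simp)
  also have "\<dots> = sqrt 2 * (15 / 16 * u)"
    by simp
  also have "\<dots> \<le> sqrt 2 * (u - w)"
    using wu by (intro mult_left_mono) auto
  finally show False using strict by simp
qed

lemma walk_eq_deviations:
  "(\<Sum>j = 1..m. X (2 * k) j \<omega> - X (2 * k + 1) j \<omega>) =
    deviation (2 * k) m \<omega> - deviation (2 * k + 1) m \<omega>
     + real m * (\<mu> (\<kappa> (2 * k) \<omega>) - \<mu> (\<kappa> (2 * k + 1) \<omega>))"
  by (simp add: deviation_def sum_subtractf algebra_simps)

lemma not_deviates_ln:
  assumes "\<omega> \<in> space M" "\<omega> \<notin> deviates i m (ln (real m))" "1 \<le> m"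
  shows "\<bar>deviation i m \<omega>\<bar> \<le> 3 / 2 * sqrt (real m * ln (real m))"
proof -
  have "sqrt (3 / 2 * ln (real m) * real m) \<le> sqrt ((3 / 2)\<^sup>2 * (real m * ln (real m)))"
    using assms(3) by (intro real_sqrt_le_mono) (auto simp: power2_eq_square)
  also have "\<dots> = 3 / 2 * sqrt (real m * ln (real m))"
    by (simp only: real_sqrt_mult) simp
  finally show ?thesis
    using not_deviates(1)[OF assms] by linarith
qed

text \<open>Without drift the factor 4 of the test is spent as 3/2 + 3/2 + 1: two deviations and the
  Gaussian sample.\<close>

lemma not_stops_equal_types:
  assumes \<omega>: "\<omega> \<in> space M" and m: "1 \<le> m" and types: "\<kappa> (2 * k) \<omega> = \<kappa> (2 * k + 1) \<omega>"
    and ns: "\<not> stops (\<lambda>i j. X i j \<omega>) (\<lambda>e. Z e \<omega>) k m"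
  shows "\<omega> \<in> deviates (2 * k) m (ln (real m)) \<union> deviates (2 * k + 1) m (ln (real m)) \<or>
    sqrt (real m * ln (real m)) \<le> \<bar>Z k \<omega>\<bar>"
proof (rule ccontr)
  assume *: "\<not> ?thesis"
  let ?r = "sqrt (real m * ln (real m))"
  have "\<bar>deviation (2 * k) m \<omega>\<bar> \<le> 3 / 2 * ?r" "\<bar>deviation (2 * k + 1) m \<omega>\<bar> \<le> 3 / 2 * ?r"
    "\<bar>Z k \<omega>\<bar> < ?r"
    using not_deviates_ln[OF \<omega> _ m] * by auto
  then have "\<bar>Z k \<omega> + (deviation (2 * k) m \<omega> - deviation (2 * k + 1) m \<omega>)\<bar> < 4 * ?r"
    by linarith
  then show False
    using ns types unfolding stops_def walk_eq_deviations by simp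
qed

section \<open>Epochs that are never discarded\<close>

definition T :: nat where "T = nat (T\<^sub>0 gap)"

text \<open>The sign of the Gaussian sample is matched to the position of the optimal arm, so that
  head start and drift point the same way. Deviations are excluded only beyond \<open>T\<close>
  samples, as the head start covers the earlier tests. The event is sufficient for never being
  discarded, and it involves only the data of epoch \<open>k\<close>.\<close>

definition survives :: "nat \<Rightarrow> 'w set" where
  "survives k =
     (typed (2 * k) Optimal \<inter> typed (2 * k + 1) Inferior \<inter> {\<omega> \<in> space M. f_thr (real T) \<le> Z k \<omega>} \<union>
      typed (2 * k) Inferior \<inter> typed (2 * k + 1) Optimal \<inter> {\<omega> \<in> space M. Z k \<omega> \<le> - f_thr (real T)})
     - (\<Union>m\<in>{T<..}. deviates (2 * k) m (ln (real m)) \<union> deviates (2 * k + 1) m (ln (real m)))"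


lemma mu_range: "0 \<le> \<mu> k" "\<mu> k \<le> 1"
proof -
  interpret given: prob_space "given 0 k" by (rule prob_space_given)
  have r: "X 0 1 \<omega> \<in> {0..1}" if "\<omega> \<in> space M" for \<omega>
    using reward_range[of 1 \<omega> 0] that by simp
  have "X 0 1 \<in> borel_measurable M"
    by (rule reward_measurable) simp
  then have int: "integrable (given 0 k) (X 0 1)"
    using r by (intro given.integrable_const_bound[where B = 1] AE_I2) auto
  have m: "(\<integral>\<omega>. X 0 1 \<omega> \<partial>given 0 k) = \<mu> k"
    by (rule reward_mean_given) simp
  show "0 \<le> \<mu> k"
    unfolding m[symmetric] using r by (intro given.integral_ge_const int AE_I2) auto
  show "\<mu> k \<le> 1"
    unfolding m[symmetric] using r by (intro given.integral_le_const int AE_I2) auto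
qed

lemma gap_pos: "0 < gap" and gap_le: "gap \<le> 1"
  using gap mu_range[of Optimal] mu_range[of Inferior] by (auto simp: gap_def)

text \<open>Rewards in the unit interval give \<open>gap \<le> 1\<close>, hence
  \<open>y \<ge> 64\<close> and \<open>ln y \<ge> 6 * ln 2\<close>.\<close>

lemma T_ge:
  defines "y \<equiv> 64 / gap\<^sup>2"
  shows "y * (ln y)\<^sup>2 \<le> real T" "64 \<le> y" "4 \<le> ln y"
proof -
  show y: "64 \<le> y"
    unfolding y_def using gap_pos gap_le power_le_one[of gap 2] by (simp add: field_simps)
  show "y * (ln y)\<^sup>2 \<le> real T"
    unfolding T_def T\<^sub>0_def y_def by linarith
  have "4 = 6 * (2 / 3 :: real)" by simp
  also have "\<dots> \<le> 6 * ln 2" using ln2_ge_two_thirds by (intro mult_left_mono) auto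
  also have "\<dots> = ln (2 ^ 6)" by (subst ln_realpow) auto
  also have "\<dots> \<le> ln y" using y by simp
  finally show "4 \<le> ln y" .
qed

lemma T_large: "64 \<le> T"
proof -
  have "64 * 1 \<le> 64 / gap\<^sup>2 * (ln (64 / gap\<^sup>2))\<^sup>2"
    using T_ge(2,3) by (intro mult_mono one_le_power) auto
  then show ?thesis using T_ge(1) by linarith
qed

text \<open>The factor 8 is twice that of the test: half of the drift beats the threshold, the other
  half absorbs two deviations with factor 3/2 each. Squared, the claim reads
  \<open>y * ln m \<le> m\<close> for \<open>y = 64 / gap^2\<close>, and the choice of
  \<open>T\<close> as at least \<open>y * (ln y)^2\<close> serves this inequality.\<close>

lemma drift_dominates:
  assumes m: "T \<le> m"
  shows "8 * sqrt (real m * ln (real m)) \<le> gap * real m"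
proof -
  define y where "y = 64 / gap\<^sup>2"
  define w where "w = ln y"
  \<comment> \<open>The relative size \<open>r \<ge> 1\<close> splits \<open>ln m\<close> into
    \<open>ln r + w + 2 * ln w\<close>, where \<open>ln r\<close> and \<open>ln w\<close> are at
    most \<open>r - 1\<close> and \<open>w - 1\<close>.\<close>
  define r where "r = real m / (y * w\<^sup>2)"
  note T = T_ge[folded y_def, folded w_def]
  have pos: "0 < y * w\<^sup>2" using T by simp
  have r: "1 \<le> r" unfolding r_def using T(1) m pos by simp
  have m_eq: "real m = r * (y * w\<^sup>2)" unfolding r_def using T by auto
  have "ln (real m) = ln r + ln y + 2 * ln w"
    unfolding m_eq using r T by (simp add: ln_mult ln_realpow)
  also have "\<dots> \<le> (r - 1) + w + 2 * (w - 1)"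
    unfolding w_def[symmetric] using r T by (intro add_mono mult_left_mono ln_le_minus_one) auto
  also have "\<dots> \<le> r * w\<^sup>2"
  proof -
    have "3 * w - 2 \<le> w\<^sup>2"
      using mult_nonneg_nonneg[of "w - 1" "w - 2"] T(3)
        by (simp add: power2_eq_square algebra_simps)
    moreover have "(r - 1) * 1 \<le> (r - 1) * w\<^sup>2"
      using r T by (intro mult_left_mono one_le_power) auto
    ultimately show ?thesis by (simp add: algebra_simps)
  qed
  finally have "y * ln (real m) \<le> real m"
    unfolding m_eq using T(2) by (simp add: mult.left_commute mult_left_mono)
  then have l: "64 * ln (real m) \<le> gap\<^sup>2 * real m"
    unfolding y_def using gap_pos by (simp add: field_simps)
  show ?thesis
  proof (rule power2_le_imp_le)
    have "(8 * sqrt (real m * ln (real m)))\<^sup>2 = real m * (64 * ln (real m))"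
      using m T_large by (simp add: power_mult_distrib)
    also have "\<dots> \<le> real m * (gap\<^sup>2 * real m)"
      using l by (intro mult_left_mono) auto
    finally show "(8 * sqrt (real m * ln (real m)))\<^sup>2 \<le> (gap * real m)\<^sup>2"
      by (simp add: power_mult_distrib power2_eq_square mult_ac)
  qed (use gap_pos in simp)
qed

text \<open>This is the origin of \<open>f_thr\<close>: up to \<open>T\<close> samples the walk
  loses at most \<open>T\<close> and the threshold is at most \<open>4 * sqrt (T * ln T)\<close>, so
  a head start equal to their sum is enough. Beyond \<open>T\<close> the drift does the
  work.\<close>

lemma survives_drift:
  assumes \<omega>: "\<omega> \<in> space M" and m: "1 \<le> m" and i: "i \<noteq> j"
    and types: "\<omega> \<in> typed i Optimal" "\<omega> \<in> typed j Inferior"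
    and nd: "\<And>l. T < l \<Longrightarrow> \<omega> \<notin> deviates i l (ln (real l)) \<union> deviates j l (ln (real l))"
  shows "4 * sqrt (real m * ln (real m)) \<le> f_thr (real T) + (\<Sum>l = 1..m. X i l \<omega> - X j l \<omega>)"
proof (cases "m \<le> T")
  case True
  have "- 1 \<le> X i l \<omega> - X j l \<omega>" if "l \<in> {1..m}" for l
    using reward_range[of l \<omega> i] reward_range[of l \<omega> j] that \<omega> by auto
  then have "(\<Sum>l = 1..m. - 1) \<le> (\<Sum>l = 1..m. X i l \<omega> - X j l \<omega>)"
    by (rule sum_mono)
  moreover have "sqrt (real m * ln (real m)) \<le> sqrt (real T * ln (real T))"
    using True m by (intro real_sqrt_le_mono mult_mono) auto
  moreover have "(\<Sum>l = 1..m. - 1 :: real) = - real m"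
    by simp
  moreover have "real m \<le> real T"
    using True by simp
  ultimately show ?thesis
    unfolding f_thr_def by linarith
next
  case False
  let ?r = "sqrt (real m * ln (real m))"
  have "\<bar>deviation i m \<omega>\<bar> \<le> 3 / 2 * ?r" "\<bar>deviation j m \<omega>\<bar> \<le> 3 / 2 * ?r"
    using not_deviates_ln[OF \<omega> _ m] nd[of m] False by auto
  moreover have "8 * ?r \<le> real m * \<mu> Optimal - real m * \<mu> Inferior"
    using drift_dominates[of m] False by (simp add: gap_def algebra_simps)
  moreover have "(\<Sum>l = 1..m. X i l \<omega> - X j l \<omega>) =
    deviation i m \<omega> - deviation j m \<omega> + (real m * \<mu> Optimal - real m * \<mu> Inferior)"
    using types by (simp add: deviation_def typed_def sum_subtractf)
  moreover have "0 \<le> f_thr (real T)"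
    using T_large by (simp add: f_thr_def)
  moreover have "0 \<le> ?r" using m by simp
  ultimately show ?thesis by linarith
qed

lemma survives_not_stops:
  assumes \<omega>: "\<omega> \<in> survives k" and m: "1 \<le> m"
  shows "\<not> stops (\<lambda>i j. X i j \<omega>) (\<lambda>e. Z e \<omega>) k m"
proof -
  have sp: "\<omega> \<in> space M" using \<omega> by (auto simp: survives_def typed_def)
  have nd: "\<omega> \<notin> deviates (2 * k) l (ln (real l)) \<union> deviates (2 * k + 1) l (ln (real l))"
    if "T < l" for l
    using \<omega> that by (auto simp: survives_def)
  let ?S = "\<Sum>l = 1..m. X (2 * k) l \<omega> - X (2 * k + 1) l \<omega>"
  consider "\<omega> \<in> typed (2 * k) Optimal" "\<omega> \<in> typed (2 * k + 1) Inferior" "f_thr (real T) \<le> Z k \<omega>"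
    | "\<omega> \<in> typed (2 * k + 1) Optimal" "\<omega> \<in> typed (2 * k) Inferior" "Z k \<omega> \<le> - f_thr (real T)"
    using \<omega> by (auto simp: survives_def)
  then have "4 * sqrt (real m * ln (real m)) \<le> \<bar>Z k \<omega> + ?S\<bar>"
  proof cases
    case 1
    have "4 * sqrt (real m * ln (real m)) \<le> f_thr (real T) + ?S"
      using nd by (intro survives_drift[OF sp m _ 1(1,2)]) auto
    then show ?thesis using 1(3) by linarith
  next
    case 2
    have "4 * sqrt (real m * ln (real m)) \<le>
      f_thr (real T) + (\<Sum>l = 1..m. X (2 * k + 1) l \<omega> - X (2 * k) l \<omega>)"
      using nd by (intro survives_drift[OF sp m _ 2(1,2)]) auto
    moreover have "(\<Sum>l = 1..m. X (2 * k + 1) l \<omega> - X (2 * k) l \<omega>) = - ?S"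
      by (simp add: sum_subtractf)
    ultimately show ?thesis using 2(3) by linarith
  qed
  then show ?thesis by (simp add: stops_def)
qed

end

section \<open>Pulls of inferior arms within an epoch\<close>

text \<open>Turns a random pull count into a sum of indicators over deterministic pull numbers,
  whose expectation is a sum of probabilities.\<close>

lemma le_count_indicator:
  assumes "\<And>K. a \<le> K \<Longrightarrow> K < P \<Longrightarrow> \<omega> \<in> B K" "1 \<le> a" "P \<le> n"
  shows "real P \<le> real a + (\<Sum>K = 1..n. indicator (B K) \<omega>)"
proof -
  have "real (P - a) = (\<Sum>K\<in>{a..<P}. indicator (B K) \<omega>)"
    using assms(1) by simp
  also have "\<dots> \<le> (\<Sum>K = 1..n. indicator (B K) \<omega>)"
    using assms(2,3) by (intro sum_mono2) auto
  finally show ?thesis by linarith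
qed

context nested_ucb_bandit
begin

text \<open>Contains the event that epoch \<open>k\<close> begins, yet is determined by the arms and
  Gaussian samples of earlier epochs. It is therefore independent of the data of epoch
  \<open>k\<close> and does not see the tie rule.\<close>

definition reached :: "nat \<Rightarrow> 'w set" where
  "reached k = {\<omega> \<in> space M. \<forall>j<k. \<omega> \<notin> survives j}"

definition mixed :: "nat \<Rightarrow> 'w set" where
  "mixed k = typed (2 * k) Optimal \<inter> typed (2 * k + 1) Inferior \<union>
     typed (2 * k) Inferior \<inter> typed (2 * k + 1) Optimal"

text \<open>Both arms and all \<open>N\<close> occur because neither the position of the inferior
  arm nor the pull count of the other one is fixed in advance.\<close>

definition bad_mixed :: "nat \<Rightarrow> nat \<Rightarrow> nat \<Rightarrow> 'w set" where
  "bad_mixed k n K = (\<Union>i\<in>{2 * k, 2 * k + 1}. deviates i K (ln (real K)) \<union>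
     (\<Union>N\<in>{1..n}. deviates i N (ln (real (K + N)))))"

text \<open>Two failures at scale \<open>h\<close>: the test on \<open>h\<close> samples does not
  fire (deviations at \<open>h\<close>, Gaussian sample), or an arm with \<open>256 * h\<close>
  pulls is preferred to one with at most \<open>h\<close>.\<close>

definition bad_equal :: "nat \<Rightarrow> nat \<Rightarrow> 'w set" where
  "bad_equal k h = (\<Union>i\<in>{2 * k, 2 * k + 1}. deviates i (256 * h) (ln (real (256 * h))) \<union>
     deviates i h (ln (real h)) \<union> (\<Union>N\<in>{1..h}. deviates i N (ln (real (256 * h))))) \<union>
     {\<omega> \<in> space M. sqrt (real h * ln (real h)) \<le> \<bar>Z k \<omega>\<bar>}"

definition excess :: "nat \<Rightarrow> nat \<Rightarrow> 'w \<Rightarrow> real" where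
  "excess n k \<omega> = 516 + 512 * (\<Sum>h = 1..n. indicator (bad_equal k h) \<omega>) + (\<Sum>K =
    1..n. indicator (bad_mixed k n K) \<omega>)"

definition ucb_bound :: "nat \<Rightarrow> real" where
  "ucb_bound n = 8 * ln (real n) / gap\<^sup>2 + 2"

lemma excess_nonneg: "0 \<le> excess n k \<omega>"
  unfolding excess_def by (intro add_nonneg_nonneg mult_nonneg_nonneg sum_nonneg) auto

lemma ucb_bound_nonneg: "0 \<le> ucb_bound n"
  by (cases n) (simp_all add: ucb_bound_def)

lemma arm_pulls_reached:
  assumes "\<omega> \<in> space M" "1 \<le> arm_pulls n i \<omega>" "k = i div 2"
  shows "\<omega> \<in> reached k"
proof -
  have "\<omega> \<notin> survives j" if "j < k" for j
    using pulled_earlier_stops[OF assms(2)[unfolded arm_pulls_def], of j] survives_not_stops[of \<omega>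
      j] that assms(3)
    by blast
  then show ?thesis using assms(1) by (simp add: reached_def)
qed

lemma arm_pulls_preferred:
  assumes "i = 2 * k \<and> j = 2 * k + 1 \<or> i = 2 * k + 1 \<and> j = 2 * k" "1 \<le> K" "K < arm_pulls n i \<omega>"
  obtains N where "1 \<le> N" "N \<le> arm_pulls n j \<omega>" "preferred (\<lambda>i j. X i j \<omega>) i K j N"
  using replays_preferred[OF assms(1,2)] assms(3) unfolding arm_pulls_def by blast

lemma arm_pulls_pair_le: "i \<noteq> j \<Longrightarrow> arm_pulls n i \<omega> + arm_pulls n j \<omega> \<le> n"
  unfolding arm_pulls_def by (rule pulls_pair_le)

lemma mixed_pulls_le:
  assumes \<omega>: "\<omega> \<in> space M" and ij: "i = 2 * k \<and> j = 2 * k + 1 \<or> i = 2 * k + 1 \<and> j = 2 * k"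
    and types: "\<omega> \<in> typed i Inferior" "\<omega> \<in> typed j Optimal"
  shows "real (arm_pulls n i \<omega>) \<le> ucb_bound n + (\<Sum>K = 1..n. indicator (bad_mixed k n K) \<omega>)"
proof -
  \<comment> \<open>From \<open>a\<close> on the UCB1 argument applies; adding one ensures
    \<open>1 \<le> a\<close> even when the logarithm vanishes.\<close>
  define a where "a = nat \<lceil>8 * ln (real n) / gap\<^sup>2\<rceil> + 1"
  have "\<omega> \<in> bad_mixed k n K" if K: "a \<le> K" "K < arm_pulls n i \<omega>" for K
  proof -
    have K1: "1 \<le> K" using K(1) by (simp add: a_def)
    from arm_pulls_preferred[OF ij K1 K(2)] obtain N where
      N: "1 \<le> N" "N \<le> arm_pulls n j \<omega>" "preferred (\<lambda>i j. X i j \<omega>) i K j N" .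
    have n: "K + N \<le> n"
      using arm_pulls_pair_le[of i j n \<omega>] ij K(2) N(2) by linarith
    have "8 * ln (real n) / gap\<^sup>2 \<le> real K"
      using K(1) unfolding a_def by linarith
    from inferior_preferred_deviates[OF \<omega> N(3) K1 N(1) types n this]
    have "\<omega> \<in> deviates i K (ln (real K)) \<union> deviates j N (ln (real (K + N)))" .
    moreover have "N \<in> {1..n}" using N(1) n by simp
    ultimately show ?thesis
      using ij unfolding bad_mixed_def by blast
  qed
  from le_count_indicator[of a "arm_pulls n i \<omega>", OF this _ arm_pulls_le]
  have "real (arm_pulls n i \<omega>) \<le> real a + (\<Sum>K = 1..n. indicator (bad_mixed k n K) \<omega>)"
    by (simp add: a_def)
  moreover have "real a \<le> ucb_bound n"
  proof -
    have "0 \<le> 8 * ln (real n) / gap\<^sup>2" by (cases n) auto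
    then show ?thesis unfolding a_def ucb_bound_def by linarith
  qed
  ultimately show ?thesis by linarith
qed

text \<open>If both arms exceed \<open>h\<close> pulls, the test on \<open>h\<close> samples was
  passed. Otherwise one arm has at most \<open>h\<close> of the pulls, so the other has more than
  \<open>256 * h\<close> and was replayed after its pull number \<open>256 * h\<close>.\<close>

lemma equal_pulls_bad:
  assumes \<omega>: "\<omega> \<in> space M" and types: "\<kappa> (2 * k) \<omega> = \<kappa> (2 * k + 1) \<omega>"
    and h: "1 \<le> h" "512 * h + 4 \<le> arm_pulls n (2 * k) \<omega> + arm_pulls n (2 * k + 1) \<omega>"
  shows "\<omega> \<in> bad_equal k h"
proof (cases "h < arm_pulls n (2 * k) \<omega> \<and> h < arm_pulls n (2 * k + 1) \<omega>")
  case True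
  then have "\<not> stops (\<lambda>i j. X i j \<omega>) (\<lambda>e. Z e \<omega>) k h"
    using h(1) unfolding arm_pulls_def by (intro not_stops_before_samples) auto
  from not_stops_equal_types[OF \<omega> h(1) types this] show ?thesis
    using \<omega> unfolding bad_equal_def by blast
next
  case False
  then obtain i j where ij: "i = 2 * k \<and> j = 2 * k + 1 \<or> i = 2 * k + 1 \<and> j = 2 * k"
    and j: "arm_pulls n j \<omega> \<le> h" and i: "256 * h < arm_pulls n i \<omega>"
  proof (cases "arm_pulls n (2 * k) \<omega> \<le> h")
    case True
    then show thesis using h(2) by (intro that[of "2 * k + 1" "2 * k"]) auto
  next
    case c: False
    then show thesis using h(2) False by (intro that[of "2 * k" "2 * k + 1"]) auto
  qed
  have "1 \<le> 256 * h" using h(1) by simp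
  from arm_pulls_preferred[OF ij this i] obtain N where
    N: "1 \<le> N" "N \<le> arm_pulls n j \<omega>" "preferred (\<lambda>i j. X i j \<omega>) i (256 * h) j N" .
  have "N \<in> {1..h}" "256 * N \<le> 256 * h" using N(1,2) j by auto
  moreover have "\<kappa> i \<omega> = \<kappa> j \<omega>" using ij types by auto
  ultimately have "\<omega>
    \<in> deviates i (256 * h) (ln (real (256 * h))) \<union> deviates j N (ln (real (256 * h)))"
    using equal_preferred_deviates[OF \<omega> N(3,1)] by blast
  then show ?thesis
    using ij \<open>N \<in> {1..h}\<close> unfolding bad_equal_def by blast
qed

lemma equal_pulls_le:
  assumes \<omega>: "\<omega> \<in> space M" and types: "\<kappa> (2 * k) \<omega> = \<kappa> (2 * k + 1) \<omega>"
  shows "real (arm_pulls n (2 * k) \<omega> + arm_pulls n (2 * k + 1) \<omega>)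
    \<le> 516 + 512 * (\<Sum>h = 1..n. indicator (bad_equal k h) \<omega>)"
proof -
  define P where "P = arm_pulls n (2 * k) \<omega> + arm_pulls n (2 * k + 1) \<omega>"
  \<comment> \<open>Once \<open>P\<close> is at least 516, this is the largest \<open>h\<close> to
    which \<open>equal_pulls_bad\<close> applies. The remainder below 512 and the offset 4 account
    for 516.\<close>
  define m where "m = (P - 4) div 512"
  have Pn: "P \<le> n" unfolding P_def by (rule arm_pulls_pair_le) simp
  have sum: "0 \<le> (\<Sum>h = 1..n. indicator (bad_equal k h) \<omega> :: real)"
    by (intro sum_nonneg) auto
  show ?thesis
  proof (cases "P < 516")
    case True
    then show ?thesis using sum unfolding P_def[symmetric] by linarith
  next
    case False
    have "\<omega> \<in> bad_equal k h" if "1 \<le> h" "h < m + 1" for h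
    proof (rule equal_pulls_bad[OF \<omega> types that(1)])
      show "512 * h + 4 \<le> arm_pulls n (2 * k) \<omega> + arm_pulls n (2 * k + 1) \<omega>"
        using that(2) False unfolding P_def[symmetric] m_def by linarith
    qed
    moreover have "m + 1 \<le> n"
      using False Pn unfolding m_def by linarith
    ultimately have "real (m + 1) \<le> real 1 + (\<Sum>h = 1..n. indicator (bad_equal k h) \<omega>)"
      by (intro le_count_indicator) auto
    moreover have "P \<le> 512 * m + 516"
      using False unfolding m_def by linarith
    then have "real P \<le> 512 * real m + 516" by linarith
    ultimately show ?thesis unfolding P_def[symmetric] by simp
  qed
qed

text \<open>The right-hand side is an indicator of earlier epochs times a function of epoch
  \<open>k\<close> alone, so its expectation factors.\<close>

lemma inferior_pulls_le:
  assumes \<omega>: "\<omega> \<in> space M"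
  shows "inferior_pulls n k \<omega> \<le>
    indicator (reached k) \<omega> * (indicator (mixed k) \<omega> * ucb_bound n + excess n k \<omega>)"
proof (cases "\<omega> \<in> reached k")
  case False
  have "arm_pulls n i \<omega> = 0" if "i \<in> {2 * k, 2 * k + 1}" for i
  proof (rule ccontr)
    assume "arm_pulls n i \<omega> \<noteq> 0"
    moreover have "k = i div 2" using that by auto
    ultimately have "\<omega> \<in> reached k"
      using \<omega> by (intro arm_pulls_reached[of \<omega> n i k]) auto
    with False show False ..
  qed
  then show ?thesis using False by (simp add: inferior_pulls_def)
next
  case True
  have s: "0 \<le> (\<Sum>h = 1..n. indicator (bad_equal k h) \<omega> :: real)"
    "0 \<le> (\<Sum>K = 1..n. indicator (bad_mixed k n K) \<omega> :: real)"
    by (auto intro: sum_nonneg)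
  have tO: "\<omega> \<in> typed i Optimal" "\<omega> \<notin> typed i Inferior" if "\<kappa> i \<omega> = Optimal" for i
    using that \<omega> by (auto simp: typed_def)
  have tI: "\<omega> \<in> typed i Inferior" "\<omega> \<notin> typed i Optimal" if "\<kappa> i \<omega> = Inferior" for i
    using that \<omega> by (auto simp: typed_def)
  have split: "inferior_pulls n k \<omega> =
    indicator (typed (2 * k) Inferior) \<omega> * real (arm_pulls n (2 * k) \<omega>) +
      indicator (typed (2 * k + 1) Inferior) \<omega> * real (arm_pulls n (2 * k + 1) \<omega>)"
    by (simp add: inferior_pulls_def del: sum_indicator_mult)
  have "inferior_pulls n k \<omega> \<le> indicator (mixed k) \<omega> * ucb_bound n + excess n k \<omega>"
  proof (cases "\<kappa> (2 * k) \<omega>"; cases "\<kappa> (2 * k + 1) \<omega>")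
    assume "\<kappa> (2 * k) \<omega> = Optimal" "\<kappa> (2 * k + 1) \<omega> = Optimal"
    then have "inferior_pulls n k \<omega> = 0"
      using tO unfolding split by simp
    then show ?thesis
      using excess_nonneg[of n k \<omega>] ucb_bound_nonneg[of n] by simp
  next
    assume k: "\<kappa> (2 * k) \<omega> = Optimal" "\<kappa> (2 * k + 1) \<omega> = Inferior"
    then have "inferior_pulls n k \<omega> = real (arm_pulls n (2 * k + 1) \<omega>)"
      using tO tI unfolding split by simp
    moreover have "indicator (mixed k) \<omega> = (1 :: real)"
      using tO[OF k(1)] tI[OF k(2)] by (simp add: mixed_def)
    ultimately show ?thesis
      using mixed_pulls_le[OF \<omega> _ tI(1)[OF k(2)] tO(1)[OF k(1)], of k n] s
        unfolding excess_def by simp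
  next
    assume k: "\<kappa> (2 * k) \<omega> = Inferior" "\<kappa> (2 * k + 1) \<omega> = Optimal"
    then have "inferior_pulls n k \<omega> = real (arm_pulls n (2 * k) \<omega>)"
      using tO tI unfolding split by simp
    moreover have "indicator (mixed k) \<omega> = (1 :: real)"
      using tO[OF k(2)] tI[OF k(1)] by (simp add: mixed_def)
    ultimately show ?thesis
      using mixed_pulls_le[OF \<omega> _ tI(1)[OF k(1)] tO(1)[OF k(2)], of k n] s
        unfolding excess_def by simp
  next
    assume k: "\<kappa> (2 * k) \<omega> = Inferior" "\<kappa> (2 * k + 1) \<omega> = Inferior"
    then have "inferior_pulls n k \<omega> = real (arm_pulls n (2 * k) \<omega> + arm_pulls n (2 * k + 1) \<omega>)"
      using tI unfolding split by simp
    moreover have "0 \<le> indicator (mixed k) \<omega> * ucb_bound n"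
      using ucb_bound_nonneg[of n] by simp
    moreover have "\<kappa> (2 * k) \<omega> = \<kappa> (2 * k + 1) \<omega>"
      using k by simp
    note equal_pulls_le[OF \<omega> this, of n]
    ultimately show ?thesis
      using s unfolding excess_def by linarith
  qed
  then show ?thesis using True by simp
qed

end

section \<open>Expectations over an epoch\<close>

lemma sum_inverse_squares_le: "(\<Sum>h = 1..n. 1 / (real h)\<^sup>2) \<le> 2"
proof -
  have "n \<ge> 1 \<Longrightarrow> (\<Sum>h = 1..n. 1 / (real h)\<^sup>2) \<le> 2 - 1 / real n"
  proof (induction n rule: nat_induct_at_least)
    case (Suc n)
    have "1 / (real (Suc n))\<^sup>2 \<le> 1 / (real n * real (Suc n))"
      using Suc.hyps unfolding power2_eq_square
        by (intro divide_left_mono mult_right_mono mult_pos_pos) auto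
    also have "\<dots> = 1 / real n - 1 / real (Suc n)"
      using Suc.hyps by (simp add: field_simps)
    finally have "1 / (real (Suc n))\<^sup>2 \<le> 1 / real n - 1 / real (Suc n)" .
    then show ?case using Suc.IH by simp
  qed simp
  moreover have "0 \<le> 1 / real n" by simp
  ultimately show ?thesis by (cases "n \<ge> 1") (auto intro: order_trans)
qed

text \<open>The divisor \<open>K\<close> is the gain over plain telescoping: summed over
  \<open>s > K\<close>, the bound is \<open>1 / K^2\<close>.\<close>

lemma inverse_cube_le_diff:
  assumes "1 \<le> K" "K < s"
  shows "1 / real s ^ 3 \<le> (1 / real (s - 1) - 1 / real s) / real K"
proof -
  have "1 / real s ^ 3 = 1 / (real s * (real s * real s))"
    by (simp add: power3_eq_cube)
  also have "\<dots> \<le> 1 / (real K * (real (s - 1) * real s))"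
    using assms by (intro divide_left_mono mult_mono mult_pos_pos) auto
  also have "\<dots> = (1 / real (s - 1) - 1 / real s) / real K"
    using assms by (simp add: field_simps of_nat_diff)
  finally show ?thesis .
qed

lemma sum_inverse_cubes_le:
  assumes "1 \<le> K"
  shows "(\<Sum>N = 1..n. 1 / real (K + N) ^ 3) \<le> 1 / (real K)\<^sup>2"
proof -
  have "(\<Sum>N = 1..n. 1 / real (K + N) ^ 3) \<le> (1 / real K - 1 / real (K + n)) / real K"
  proof (induction n)
    case (Suc n)
    have "1 / real (K + Suc n) ^ 3 \<le> (1 / real (K + n) - 1 / real (K + Suc n)) / real K"
      using inverse_cube_le_diff[OF assms, of "K + Suc n"] by simp
    moreover have "(\<Sum>N = 1..Suc n. 1 / real (K + N) ^ 3) =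
        (\<Sum>N = 1..n. 1 / real (K + N) ^ 3) + 1 / real (K + Suc n) ^ 3"
      by (simp add: add_ac)
    ultimately show ?case
      using Suc.IH unfolding diff_divide_distrib by linarith
  qed simp
  also have "\<dots> \<le> 1 / real K / real K"
    using assms by (intro divide_right_mono) auto
  finally show ?thesis by (simp add: power2_eq_square)
qed

context nested_ucb_bandit
begin

text \<open>The seed \<open>Inr 0\<close> belongs to no epoch, since the epoch events do not involve
  tie-breaking.\<close>

definition epoch_sources :: "nat \<Rightarrow> (nat + nat) set" where
  "epoch_sources k = {Inl (2 * k), Inl (2 * k + 1), Inr (Suc k)}"

lemma epoch_sources_disjoint: "(\<Union>j<k. epoch_sources j) \<inter> epoch_sources k = {}"
  by (auto simp: epoch_sources_def)

lemma gaussian_sets_info: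
  assumes "Inr (Suc k) \<in> I"
  shows "{\<omega> \<in> space M. v \<le> Z k \<omega>} \<in> sets (info I)" "{\<omega> \<in> space M. Z k \<omega> \<le> v} \<in> sets (info I)"
    "{\<omega> \<in> space M. v \<le> \<bar>Z k \<omega>\<bar>} \<in> sets (info I)"
proof -
  have [measurable]: "Z k \<in> borel_measurable (info I)" by (rule gaussian_info[OF assms])
  have "{\<omega> \<in> space (info I). v \<le> Z k \<omega>} \<in> sets (info I)"
    "{\<omega> \<in> space (info I). Z k \<omega> \<le> v} \<in> sets (info I)"
    "{\<omega> \<in> space (info I). v \<le> \<bar>Z k \<omega>\<bar>} \<in> sets (info I)"
    by measurable
  then show "{\<omega> \<in> space M. v \<le> Z k \<omega>} \<in> sets (info I)" "{\<omega> \<in> space M. Z k \<omega> \<le> v} \<in> sets (info I)"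
    "{\<omega> \<in> space M. v \<le> \<bar>Z k \<omega>\<bar>} \<in> sets (info I)" by simp_all
qed

lemma epoch_sets_info:
  shows survives_info: "survives k \<in> sets (info (epoch_sources k))"
    and mixed_info: "mixed k \<in> sets (info (epoch_sources k))"
    and bad_mixed_info: "bad_mixed k n K \<in> sets (info (epoch_sources k))"
    and bad_equal_info: "bad_equal k h \<in> sets (info (epoch_sources k))"
proof -
  let ?I = "epoch_sources k"
  have i: "Inl (2 * k) \<in> ?I" "Inl (2 * k + 1) \<in> ?I" "Inr (Suc k) \<in> ?I"
    by (auto simp: epoch_sources_def)
  note s = typed_info[OF i(1)] typed_info[OF i(2)] deviates_info[OF i(1)] deviates_info[OF i(2)]
    gaussian_sets_info[OF i(3)]
  have "(\<Union>m\<in>{T<..}. deviates (2 * k) m (ln (real m)) \<union> deviates (2 * k + 1) m (ln (real m)))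
    \<in> sets (info ?I)"
    by (rule sets.countable_UN') (auto intro!: sets.Un s simp del: One_nat_def)
  then show "survives k \<in> sets (info ?I)"
    unfolding survives_def by (intro sets.Diff sets.Un sets.Int s)
  show "mixed k \<in> sets (info ?I)"
    unfolding mixed_def by (intro sets.Un sets.Int s)
  have "(\<Union>N\<in>{1..m}. deviates i N (y N)) \<in> sets (info ?I)" if "i \<in> {2 * k, 2 * k + 1}" for i m y
    using that by (intro sets.finite_UN) (auto intro: s simp del: One_nat_def)
  then show "bad_mixed k n K \<in> sets (info ?I)" "bad_equal k h \<in> sets (info ?I)"
    unfolding bad_mixed_def bad_equal_def
    by (auto intro!: sets.Un sets.finite_UN s simp del: UN_insert One_nat_def)
qed

lemma reached_Suc: "reached (Suc k) = reached k - survives k"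
  by (auto simp: reached_def less_Suc_eq)

lemma reached_info: "reached k \<in> sets (info (\<Union>j<k. epoch_sources j))"
proof (induction k)
  case 0
  have "reached 0 = space (info (\<Union>j<0. epoch_sources j))"
    by (simp add: reached_def)
  then show ?case by (simp only: sets.top)
next
  case (Suc k)
  have "reached k \<in> sets (info (\<Union>j<Suc k. epoch_sources j))"
    "survives k \<in> sets (info (\<Union>j<Suc k. epoch_sources j))"
    using Suc survives_info[of k] info_mono[of "\<Union>j<k. epoch_sources j" "\<Union>j<Suc k. epoch_sources j"]
      info_mono[of "epoch_sources k" "\<Union>j<Suc k. epoch_sources j"] by (auto simp: lessThan_Suc)
  then show ?case unfolding reached_Suc by (rule sets.Diff)
qed

lemma prob_reached_Int:
  "E \<in> sets (info (epoch_sources k)) \<Longrightarrow> prob (reached k \<inter> E) = prob (reached k) * prob E"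
  by (rule info_indep[OF epoch_sources_disjoint reached_info])

lemma reached_events: "reached k \<in> events"
  using reached_info info_events by blast

lemma prob_reached_Suc: "prob (reached (Suc k)) = prob (reached k) * (1 - prob (survives k))"
proof -
  have "reached (Suc k) = reached k - reached k \<inter> survives k"
    unfolding reached_Suc by blast
  moreover have "survives k \<in> events"
    using survives_info info_events by blast
  ultimately have "prob (reached (Suc k)) = prob (reached k) - prob (reached k \<inter> survives k)"
    using reached_events by (simp only:) (rule finite_measure_Diff, auto)
  then show ?thesis
    using prob_reached_Int[OF survives_info] by (simp add: algebra_simps)
qed

lemma prob_bad_mixed:
  assumes K: "1 \<le> K"
  shows "prob (bad_mixed k n K) \<le> 8 * (1 / (real K)\<^sup>2)"
proof -
  have arm: "prob (deviates i K (ln (real K)) \<union> (\<Union>N\<in>{1..n}. deviates i N (ln (real (K + N))))) \<le>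
    4 * (1 / (real K)\<^sup>2)" for i
  proof -
    have "prob (deviates i K (ln (real K)) \<union> (\<Union>N\<in>{1..n}. deviates i N (ln (real (K + N))))) \<le>
       prob (deviates i K (ln (real K))) + prob (\<Union>N\<in>{1..n}. deviates i N (ln (real (K + N))))"
      by (intro measure_Un_le sets.finite_UN) auto
    also have "prob (\<Union>N\<in>{1..n}. deviates i N (ln (real (K + N)))) \<le>
       (\<Sum>N = 1..n. prob (deviates i N (ln (real (K + N)))))"
      by (intro finite_measure_subadditive_finite) auto
    also have "\<dots> \<le> (\<Sum>N = 1..n. 2 * (1 / real (K + N) ^ 3))"
    proof (rule sum_mono)
      fix N assume "N \<in> {1..n}"
      then show "prob (deviates i N (ln (real (K + N)))) \<le> 2 * (1 / real (K + N) ^ 3)"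
        using prob_deviates_ln[of N "K + N" i] by simp
    qed
    also have "\<dots> = 2 * (\<Sum>N = 1..n. 1 / real (K + N) ^ 3)"
      by (simp only: sum_distrib_left)
    also have "\<dots> \<le> 2 * (1 / (real K)\<^sup>2)"
      using sum_inverse_cubes_le[OF K] by (intro mult_left_mono) auto
    also have "prob (deviates i K (ln (real K))) \<le> 2 / real K ^ 3"
      by (rule prob_deviates_ln[OF K K])
    also have "\<dots> \<le> 2 / (real K)\<^sup>2"
      using K by (intro divide_left_mono power_increasing) auto
    finally show ?thesis by simp
  qed
  have "prob (bad_mixed k n K) \<le> (\<Sum>i\<in>{2 * k, 2 * k + 1}.
      prob (deviates i K (ln (real K)) \<union> (\<Union>N\<in>{1..n}. deviates i N (ln (real (K + N))))))"
    unfolding bad_mixed_def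
      by (rule finite_measure_subadditive_finite) (auto intro!: sets.Un sets.finite_UN)
  also have "\<dots> \<le> (\<Sum>i\<in>{2 * k, 2 * k + 1}. 4 * (1 / (real K)\<^sup>2))"
    by (intro sum_mono arm)
  finally show ?thesis by simp
qed

lemma gaussian_large:
  assumes h: "1 \<le> h"
  shows "prob {\<omega> \<in> space M. sqrt (real h * ln (real h)) \<le> \<bar>Z k \<omega>\<bar>} \<le> 4 * (1 / (real h)\<^sup>2)"
proof (cases "h \<le> 2")
  \<comment> \<open>For \<open>h \<le> 2\<close> the logarithm is below one, but the claimed bound
    is then at least one.\<close>
  case True
  then have "(real h)\<^sup>2 \<le> 2\<^sup>2" by (intro power_mono) auto
  then have "1 \<le> 4 * (1 / (real h)\<^sup>2)" using h by simp
  then show ?thesis using prob_le_1 order_trans by blast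
next
  case False
  then have h3: "exp 1 \<le> real h"
    using exp_le by (simp add: order_trans[of _ 3])
  then have l: "1 \<le> ln (real h)"
    using False ln_mono[of "exp 1" "real h"] by simp
  let ?a = "sqrt (real h * ln (real h))"
  have a: "?a ^ 4 = (real h * ln (real h))\<^sup>2"
    using l h by (simp add: power4_eq_xxxx power2_eq_square)
  have "0 < ?a" using l h by (intro real_sqrt_gt_zero mult_pos_pos) linarith+
  from gaussian_abs_ge[OF this]
  have "prob {\<omega> \<in> space M. ?a \<le> \<bar>Z k \<omega>\<bar>} \<le> 3 / (real h * ln (real h))\<^sup>2"
    unfolding a .
  also have "\<dots> \<le> 3 / (real h)\<^sup>2"
    using l h by (intro frac_le power_mono) auto
  also have "\<dots> \<le> 4 * (1 / (real h)\<^sup>2)" by (simp add: divide_right_mono)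
  finally show ?thesis .
qed

lemma prob_bad_equal:
  assumes h: "1 \<le> h"
  shows "prob (bad_equal k h) \<le> 16 * (1 / (real h)\<^sup>2)"
proof -
  have q: "2 / real (256 * h) ^ 3 \<le> 2 / real h ^ 3"
    using h by (intro divide_left_mono power_mono) auto
  have c: "2 / real h ^ 3 \<le> 2 * (1 / (real h)\<^sup>2)"
    using h by (simp add: divide_left_mono power_increasing)
  have dev: "prob (deviates i N (ln (real (256 * h)))) \<le> 2 / real h ^ 3" if "1 \<le> N" for i N
    using prob_deviates_ln[of N "256 * h" i] q that h by (auto simp del: of_nat_mult)
  have arm: "prob (deviates i (256 * h) (ln (real (256 * h))) \<union> deviates i h (ln (real h)) \<union>
      (\<Union>N\<in>{1..h}. deviates i N (ln (real (256 * h))))) \<le> 6 * (1 / (real h)\<^sup>2)" for i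
  proof -
    have "prob (deviates i (256 * h) (ln (real (256 * h))) \<union> deviates i h (ln (real h)) \<union>
      (\<Union>N\<in>{1..h}. deviates i N (ln (real (256 * h))))) \<le>
      prob (deviates i (256 * h) (ln (real (256 * h))) \<union> deviates i h (ln (real h))) +
      prob (\<Union>N\<in>{1..h}. deviates i N (ln (real (256 * h))))"
      by (intro measure_Un_le sets.finite_UN sets.Un) auto
    also have "prob (deviates i (256 * h) (ln (real (256 * h))) \<union> deviates i h (ln (real h))) \<le>
        prob (deviates i (256 * h) (ln (real (256 * h)))) + prob (deviates i h (ln (real h)))"
      by (intro measure_Un_le) auto
    also have "prob (deviates i (256 * h) (ln (real (256 * h)))) \<le> 2 * (1 / (real h)\<^sup>2)"
      using dev[of "256 * h" i] c h by linarith
    also have "prob (deviates i h (ln (real h))) \<le> 2 * (1 / (real h)\<^sup>2)"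
      using prob_deviates_ln[OF h h, of i] c by linarith
    also have "prob (\<Union>N\<in>{1..h}. deviates i N (ln (real (256 * h)))) \<le>
        (\<Sum>N = 1..h. prob (deviates i N (ln (real (256 * h)))))"
      by (intro finite_measure_subadditive_finite) auto
    \<comment> \<open>The union over \<open>N\<close> costs a factor \<open>h\<close>, which the
      cubic decay absorbs.\<close>
    also have "\<dots> \<le> (\<Sum>N = 1..h. 2 / real h ^ 3)"
      by (intro sum_mono dev) auto
    also have "\<dots> = 2 * (1 / (real h)\<^sup>2)"
      using h by (simp add: power2_eq_square power3_eq_cube)
    finally show ?thesis by simp
  qed
  let ?A = "\<lambda>i. deviates i (256 * h) (ln (real (256 * h))) \<union> deviates i h (ln (real h)) \<union>
      (\<Union>N\<in>{1..h}. deviates i N (ln (real (256 * h))))"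
  have A: "?A i \<in> events" for i by (intro sets.Un sets.finite_UN) auto
  have "prob (bad_equal k h) \<le> prob (\<Union>i\<in>{2 * k, 2 * k + 1}. ?A i) +
      prob {\<omega> \<in> space M. sqrt (real h * ln (real h)) \<le> \<bar>Z k \<omega>\<bar>}"
    unfolding bad_equal_def by (intro measure_Un_le sets.finite_UN A) auto
  also have "prob (\<Union>i\<in>{2 * k, 2 * k + 1}. ?A i) \<le> (\<Sum>i\<in>{2 * k, 2 * k + 1}. prob (?A i))"
    using A by (intro finite_measure_subadditive_finite) auto
  also have "\<dots> \<le> (\<Sum>i\<in>{2 * k, 2 * k + 1}. 6 * (1 / (real h)\<^sup>2))"
    by (intro sum_mono arm)
  also have "prob {\<omega> \<in> space M. sqrt (real h * ln (real h)) \<le> \<bar>Z k \<omega>\<bar>} \<le> 4 * (1 / (real h)\<^sup>2)"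
    by (rule gaussian_large[OF h])
  finally show ?thesis by simp
qed

text \<open>Independence pulls out \<open>prob (reached k)\<close>. The constant is
  \<open>516 + 512 * 32 + 16\<close>, where 32 and 16 bound the sums of \<open>16 / h^2\<close> and
  \<open>8 / K^2\<close> for every \<open>n\<close>.\<close>

lemma expected_inferior_pulls:
  "(\<integral>\<omega>. inferior_pulls n k \<omega> \<partial>M) \<le> prob (reached k) * (prob (mixed k) * ucb_bound n + 16916)"
proof -
  let ?R = "reached k"
  have R: "?R \<in> events" by (rule reached_events)
  have ev: "E \<in> events" if "E \<in> sets (info (epoch_sources k))" for E
    using that info_events by blast
  let ?f = "\<lambda>\<omega>. indicator (?R \<inter> mixed k) \<omega> * ucb_bound n + (516 * indicator ?R \<omega>
     + 512 * (\<Sum>h = 1..n. indicator (?R \<inter> bad_equal k h) \<omega>) + (\<Sum>K =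
       1..n. indicator (?R \<inter> bad_mixed k n K) \<omega>)) :: real"
  have m: "?R \<inter> mixed k \<in> events" "\<And>h. ?R \<inter> bad_equal k h \<in> events"
    "\<And>K. ?R \<inter> bad_mixed k n K \<in> events"
    by (intro sets.Int R ev mixed_info bad_equal_info bad_mixed_info)+
  have int: "integrable M ?f"
    by (intro Bochner_Integration.integrable_add integrable_mult_left integrable_mult_right
        Bochner_Integration.integrable_sum integrable_indicator m R)
  have "(\<integral>\<omega>. inferior_pulls n k \<omega> \<partial>M) \<le> (\<integral>\<omega>. ?f \<omega> \<partial>M)"
  proof (rule integral_mono[OF integrable_inferior_pulls int])
    fix \<omega> assume "\<omega> \<in> space M"
    from inferior_pulls_le[OF this, of n k] show "inferior_pulls n k \<omega> \<le> ?f \<omega>"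
      by (simp add: excess_def indicator_inter_arith sum_distrib_left algebra_simps
          del: sum_indicator_mult sum_mult_indicator)
  qed
  also have "(\<integral>\<omega>. ?f \<omega> \<partial>M) = prob (?R \<inter> mixed k) * ucb_bound n + (516 * prob ?R
     + 512 * (\<Sum>h = 1..n. prob (?R \<inter> bad_equal k h)) + (\<Sum>K = 1..n. prob (?R \<inter> bad_mixed k n K)))"
  proof -
    have "(\<integral>\<omega>. (\<Sum>h = 1..n. indicator (E h) \<omega> :: real) \<partial>M) = (\<Sum>h = 1..n. prob (E h))"
      if "\<And>h. E h \<in> events" for E
    proof -
      have "E h \<inter> space M = E h" for h
        using sets.sets_into_space[OF that] by blast
      then show ?thesis
        using that by (subst Bochner_Integration.integral_sum) auto
    qed
    note sums = this[of "\<lambda>h. ?R \<inter> bad_equal k h"] this[of "\<lambda>h. ?R \<inter> bad_mixed k n h"]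
    have sp: "E \<inter> space M = E" if "E \<in> events" for E
      using sets.sets_into_space[OF that] by blast
    show ?thesis
      using m R
      by (simp add: sums sp integrable_add integrable_mult_left integrable_mult_right
        Bochner_Integration.integrable_sum integrable_indicator
          del: sum_indicator_mult sum_mult_indicator)
  qed
  also have "\<dots> = prob ?R * (prob (mixed k) * ucb_bound n + (516
     + 512 * (\<Sum>h = 1..n. prob (bad_equal k h)) + (\<Sum>K = 1..n. prob (bad_mixed k n K))))"
    by (simp add: prob_reached_Int mixed_info bad_equal_info bad_mixed_info sum_distrib_left
      algebra_simps)
  also have "\<dots> \<le> prob ?R * (prob (mixed k) * ucb_bound n + (516 + 512 * (16 * 2) + 8 * 2))"
  proof (intro mult_left_mono add_mono order_refl measure_nonneg)
    have "(\<Sum>h = 1..n. prob (bad_equal k h)) \<le> (\<Sum>h = 1..n. 16 * (1 / (real h)\<^sup>2))"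
      by (intro sum_mono prob_bad_equal) auto
    also have "\<dots> = 16 * (\<Sum>h = 1..n. 1 / (real h)\<^sup>2)"
      by (simp only: sum_distrib_left)
    also have "\<dots> \<le> 16 * 2"
      using sum_inverse_squares_le[of n] by (intro mult_left_mono) auto
    finally show "(\<Sum>h = 1..n. prob (bad_equal k h)) \<le> 16 * 2" .
    have "(\<Sum>h = 1..n. prob (bad_mixed k n h)) \<le> (\<Sum>h = 1..n. 8 * (1 / (real h)\<^sup>2))"
      by (intro sum_mono prob_bad_mixed) auto
    also have "\<dots> = 8 * (\<Sum>h = 1..n. 1 / (real h)\<^sup>2)"
      by (simp only: sum_distrib_left)
    also have "\<dots> \<le> 8 * 2"
      using sum_inverse_squares_le[of n] by (intro mult_left_mono) auto
    finally show "(\<Sum>h = 1..n. prob (bad_mixed k n h)) \<le> 8 * 2" .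
  qed simp
  finally show ?thesis by simp
qed


section \<open>Surviving epochs and the regret bound\<close>

text \<open>The share of a single arm in \<open>survives\<close>; separating the arms exhibits
  independent factors.\<close>

definition calm :: "nat \<Rightarrow> 'w set" where
  "calm i = space M - (\<Union>m\<in>{T<..}. deviates i m (ln (real m)))"

lemma calm_info:
  assumes "Inl i \<in> I" shows "calm i \<in> sets (info I)"
proof -
  have "(\<Union>m\<in>{T<..}. deviates i m (ln (real m))) \<in> sets (info I)"
    by (rule sets.countable_UN') (auto intro: deviates_info[OF assms])
  from sets.Diff[OF sets.top this] show ?thesis
    by (simp only: calm_def space_info)
qed

text \<open>A union bound over the sample sizes beyond \<open>T\<close>: the terms
  \<open>2 / m ^ 3\<close> telescope to at most \<open>1 / T\<close>, which is below 1/4.\<close>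

lemma prob_typed_calm: "3 / 4 * prob (typed i k) \<le> prob (typed i k \<inter> calm i)"
proof -
  let ?t = "typed i k"
  define A where "A n = ?t \<inter> deviates i (Suc (T + n)) (ln (real (Suc (T + n))))" for n
  define d where "d n = 1 / real (T + n)" for n
  have A: "A n \<in> events" for n unfolding A_def by (intro sets.Int typed_events deviates_events)
  have pA: "prob (A n) \<le> prob ?t * (d n - d (Suc n))" for n
  proof -
    have "2 * exp (- 3 * ln (real (Suc (T + n)))) = 2 * (1 / real (Suc (T + n)) ^ 3)"
      using exp_of_nat_mult[of 3 "ln (real (Suc (T + n)))"] by (simp add: exp_minus field_simps)
    \<comment> \<open>Taking \<open>K = 2\<close> in the telescoping bound cancels the factor 2 of
      Hoeffding's inequality.\<close>
    also have "\<dots> \<le> 2 * ((d n - d (Suc n)) / 2)"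
      using inverse_cube_le_diff[of 2 "Suc (T + n)"] T_large
      by (intro mult_left_mono) (auto simp: d_def)
    finally have e: "2 * exp (- 3 * ln (real (Suc (T + n)))) \<le> d n - d (Suc n)"
      by simp
    have "prob (A n) \<le> 2 * exp (- 3 * ln (real (Suc (T + n)))) * prob ?t"
      unfolding A_def by (rule prob_typed_deviates) auto
    also have "\<dots> \<le> (d n - d (Suc n)) * prob ?t"
      by (intro mult_right_mono e) simp
    finally show ?thesis by (simp only: mult.commute)
  qed
  have "d \<longlonglongrightarrow> 0"
    unfolding d_def using LIMSEQ_ignore_initial_segment[OF lim_1_over_n, of T]
      by (simp add: add.commute)
  from sums_mult[OF telescope_sums'[OF this], of "prob ?t"]
  have s: "(\<lambda>n. prob ?t * (d n - d (Suc n))) sums (prob ?t * d 0)" by simp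
  have sA: "summable (\<lambda>n. prob (A n))"
    by (rule summable_comparison_test'[OF sums_summable[OF s], of 0]) (use pA in auto)
  have "prob (\<Union>n. A n) \<le> (\<Sum>n. prob (A n))"
    using A sA by (intro finite_measure_subadditive_countably) auto
  also have "\<dots> \<le> prob ?t * d 0"
    unfolding sums_unique[OF s] by (rule suminf_le[OF pA sA sums_summable[OF s]])
  also have "\<dots> \<le> prob ?t * (1 / 4)"
    using T_large by (intro mult_left_mono) (auto simp: d_def)
  finally have UA: "prob (\<Union>n. A n) \<le> prob ?t * (1 / 4)" .
  have "?t \<subseteq> (?t \<inter> calm i) \<union> (\<Union>n. A n)"
  proof
    fix \<omega> assume \<omega>: "\<omega> \<in> ?t"
    show "\<omega> \<in> (?t \<inter> calm i) \<union> (\<Union>n. A n)"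
    proof (cases "\<omega> \<in> calm i")
      case False
      then obtain m where m: "T < m" "\<omega> \<in> deviates i m (ln (real m))"
        using \<omega> by (auto simp: calm_def typed_def)
      then have "\<omega> \<in> A (m - Suc T)" using \<omega> by (simp add: A_def)
      then show ?thesis by blast
    qed (use \<omega> in blast)
  qed
  moreover have c: "?t \<inter> calm i \<in> events"
    by (intro sets.Int typed_events subsetD[OF info_events calm_info[OF UNIV_I]])
  ultimately have "prob ?t \<le> prob ((?t \<inter> calm i) \<union> (\<Union>n. A n))"
    using A by (intro finite_measure_mono) auto
  also have "\<dots> \<le> prob (?t \<inter> calm i) + prob (\<Union>n. A n)"
    using c A by (intro measure_Un_le) auto
  finally show ?thesis using UA by linarith
qed

lemma prob_independent_triple:
  assumes "i \<noteq> j"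
    and "A \<in> sets (info {Inl i})" "B \<in> sets (info {Inl j})" "C \<in> sets (info {Inr n})"
  shows "prob (A \<inter> (B \<inter> C)) = prob A * (prob B * prob C)"
proof -
  have "B \<inter> C \<in> sets (info {Inl j, Inr n})"
    using assms(3,4) info_mono[of "{Inl j}" "{Inl j, Inr n}"] info_mono[of "{Inr n}"
      "{Inl j, Inr n}"]
    by blast
  from info_indep[OF _ assms(2) this] have "prob (A \<inter> (B \<inter> C)) = prob A * prob (B \<inter> C)"
    using assms(1) by auto
  also have "prob (B \<inter> C) = prob B * prob C"
    by (rule info_indep[OF _ assms(3,4)]) auto
  finally show ?thesis .
qed

lemma real_T: "real T = of_int (T\<^sub>0 gap)"
  using T_large unfolding T_def by linarith

lemma beta_pos: "0 < \<beta>_gap gap"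
  unfolding \<beta>_gap_def real_T[symmetric] f_thr_def using T_large by (auto intro!: gauss_tail_pos)

lemma prob_mixed:
  "prob (mixed k) = g (2 * k) * (1 - g (2 * k + 1)) + (1 - g (2 * k)) * g (2 * k + 1)"
proof -
  have ind: "prob (typed (2 * k) a \<inter> typed (2 * k + 1) b) =
    prob (typed (2 * k) a) * prob (typed (2 * k + 1) b)" for a b
    by (rule info_indep[of "{Inl (2 * k)}" "{Inl (2 * k + 1)}"]) (auto intro: typed_info)
  have "prob (mixed k) = prob (typed (2 * k) Optimal \<inter> typed (2 * k + 1) Inferior) +
      prob (typed (2 * k) Inferior \<inter> typed (2 * k + 1) Optimal)"
    unfolding mixed_def by (intro finite_measure_Union sets.Int typed_events) (auto simp: typed_def)
  then show ?thesis unfolding ind prob_typed .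
qed

text \<open>On either half of \<open>mixed\<close>, the two arms and the Gaussian tail are three
  independent sources, and the upper and lower tails agree by symmetry.\<close>

lemma prob_survives: "\<beta>_gap gap * prob (mixed k) \<le> prob (survives k)"
proof -
  let ?f = "f_thr (real T)"
  let ?t = "gauss_tail ?f"
  let ?Z1 = "{\<omega> \<in> space M. ?f \<le> Z k \<omega>}" and ?Z2 = "{\<omega> \<in> space M. Z k \<omega> \<le> - ?f}"
  let ?C = "\<lambda>i a. typed i a \<inter> calm i"
  let ?A = "?C (2 * k) Optimal \<inter> (?C (2 * k + 1) Inferior \<inter> ?Z1)"
  let ?B = "?C (2 * k) Inferior \<inter> (?C (2 * k + 1) Optimal \<inter> ?Z2)"
  have eq: "survives k = ?A \<union> ?B"
    unfolding survives_def calm_def by (auto simp: typed_def)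
  have C: "?C i a \<in> sets (info {Inl i})" for i a
    by (intro sets.Int typed_info calm_info) auto
  have Zs: "?Z1 \<in> sets (info {Inr (Suc k)})" "?Z2 \<in> sets (info {Inr (Suc k)})"
    by (rule gaussian_sets_info; simp)+
  have t: "0 \<le> ?t" using gaussian_ge[of ?f] measure_nonneg by metis
  have bound: "1 / 2 * ?t * (prob (typed (2 * k) a) * prob (typed (2 * k + 1) b)) \<le>
      prob (?C (2 * k) a \<inter> (?C (2 * k + 1) b \<inter> E))"
    if E: "E \<in> sets (info {Inr (Suc k)})" "prob E = ?t" for a b E
  proof -
    \<comment> \<open>Each arm is calm with conditional probability at least 3/4, and
      \<open>9 / 16\<close> exceeds the factor 1/2 in \<open>\<beta>_gap\<close>.\<close>
    have "1 / 2 * ?t * (prob (typed (2 * k) a) * prob (typed (2 * k + 1) b)) \<le>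
        9 / 16 * ?t * (prob (typed (2 * k) a) * prob (typed (2 * k + 1) b))"
      using t by (intro mult_right_mono) auto
    also have "\<dots> = (3 / 4 * prob (typed (2 * k) a)) * (3 / 4 * prob (typed (2 * k + 1) b) * ?t)"
      by simp
    also have "\<dots> \<le> prob (?C (2 * k) a) * (prob (?C (2 * k + 1) b) * ?t)"
      using t by (intro mult_mono prob_typed_calm) auto
    also have "\<dots> = prob (?C (2 * k) a \<inter> (?C (2 * k + 1) b \<inter> E))"
      using prob_independent_triple[OF _ C C E(1), of "2 * k" "2 * k + 1" a b] E(2) by simp
    finally show ?thesis .
  qed
  have "\<beta>_gap gap * prob (mixed k) =
    1 / 2 * ?t * (prob (typed (2 * k) Optimal) * prob (typed (2 * k + 1) Inferior))
      + 1 / 2 * ?t * (prob (typed (2 * k) Inferior) * prob (typed (2 * k + 1) Optimal))"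
    unfolding prob_mixed prob_typed \<beta>_gap_def real_T[symmetric] by (simp add: algebra_simps)
  also have "\<dots> \<le> prob ?A + prob ?B"
    by (intro add_mono bound Zs gaussian_ge gaussian_le)
  also have "\<dots> = prob (survives k)"
  proof -
    have "?C i a \<in> events" "?Z1 \<in> events" "?Z2 \<in> events" for i a
      using C Zs info_events by blast+
    then have "?A \<in> events" "?B \<in> events" by blast+
    then show ?thesis
      unfolding eq by (intro finite_measure_Union[symmetric]) (auto simp: typed_def)
  qed
  finally show ?thesis .
qed

text \<open>Reaching epoch \<open>k\<close> and surviving it has probability at least
  \<open>\<beta>_gap gap * prob (reached k) * prob (mixed k)\<close>. These events are disjoint over
  \<open>k\<close>, which appears here as telescoping of \<open>prob (reached n)\<close>.\<close>

lemma sum_reached_mixed: "(\<Sum>k<n. prob (reached k) * prob (mixed k)) \<le> 1 / \<beta>_gap gap"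
proof -
  have "\<beta>_gap gap * (\<Sum>k<n. prob (reached k) * prob (mixed k)) \<le> 1 - prob (reached n)"
  proof (induction n)
    case (Suc n)
    have "prob (reached n) * (\<beta>_gap gap * prob (mixed n)) \<le> prob (reached n) * prob (survives n)"
      by (intro mult_left_mono prob_survives) auto
    then show ?case
      using Suc.IH unfolding prob_reached_Suc by (simp add: algebra_simps)
  qed simp
  also have "\<dots> \<le> 1" by simp
  finally show ?thesis using beta_pos by (simp add: field_simps)
qed

section \<open>From the series to the limit\<close>

lemma prob_reached_Suc_le: "prob (reached (Suc k)) \<le>
  prob (reached k) * exp (- (\<beta>_gap gap * prob (mixed k)))"
  unfolding prob_reached_Suc
proof (rule mult_left_mono)
  show "1 - prob (survives k) \<le> exp (- (\<beta>_gap gap * prob (mixed k)))"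
    using prob_survives[of k] exp_ge_add_one_self[of "- (\<beta>_gap gap * prob (mixed k))"] by linarith
qed simp

text \<open>If \<open>g (2 k) \<le> 1 / 2\<close>, then an epoch is mixed with probability at least \<open>g (2 k)\<close>; if this never
  happens, mixed epochs have probability at least \<open>(1 - c) / 2\<close>.\<close>

lemma summable_reached:
  assumes s: "summable (\<lambda>k. exp (- \<beta>_gap gap * (\<Sum>j<k. g (2 * j))))"
  shows "summable (\<lambda>k. prob (reached k))"
proof (cases "\<exists>k0. g (2 * k0) \<le> 1 / 2")
  case True
  then obtain k0 where k0: "g (2 * k0) \<le> 1 / 2" by blast
  let ?s = "\<lambda>k. exp (- \<beta>_gap gap * (\<Sum>j<k. g (2 * j)))"
  \<comment> \<open>Normalising by \<open>?s k0\<close> lets the induction start from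
    \<open>prob (reached k0) \<le> 1\<close>.\<close>
  have "prob (reached k) \<le> ?s k / ?s k0" if "k0 \<le> k" for k
    using that
  proof (induction k rule: nat_induct_at_least)
    case (Suc k)
    have "g (2 * k) \<le> 1 / 2"
      using antimonoD[OF g_antimono, of "2 * k0" "2 * k"] Suc.hyps k0 by simp
    \<comment> \<open>The product is exactly \<open>prob (mixed k) - g (2 * k)\<close>.\<close>
    then have "0 \<le> g (2 * k + 1) * (1 - 2 * g (2 * k))"
      using g_range[of "2 * k + 1"] by (intro mult_nonneg_nonneg) auto
    then have "g (2 * k) \<le> prob (mixed k)"
      unfolding prob_mixed by (simp add: algebra_simps)
    then have e: "exp (- (\<beta>_gap gap * prob (mixed k))) \<le> exp (- (\<beta>_gap gap * g (2 * k)))"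
      using beta_pos by simp
    have "prob (reached (Suc k)) \<le> prob (reached k) * exp (- (\<beta>_gap gap * prob (mixed k)))"
      by (rule prob_reached_Suc_le)
    also have "\<dots> \<le> ?s k / ?s k0 * exp (- (\<beta>_gap gap * g (2 * k)))"
      by (intro mult_mono Suc.IH e) auto
    also have "\<dots> = ?s (Suc k) / ?s k0"
      by (simp add: exp_add[symmetric] algebra_simps)
    finally show ?case .
  qed simp
  then show ?thesis
    by (intro summable_comparison_test'[OF summable_divide[OF s, of "?s k0"], of k0]) simp
next
  case False
  define x where "x = \<beta>_gap gap * ((1 - c) / 2)"
  have x: "0 < x" unfolding x_def using beta_pos c_bounds by simp
  have "prob (reached k) \<le> exp (- x) ^ k" for k
  proof (induction k)
    case (Suc k)
    have "1 / 2 \<le> g (2 * k)" using False by (simp add: not_le less_imp_le)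
    then have "1 / 2 * (1 - c) \<le> g (2 * k) * (1 - g (2 * k + 1))"
      using g_range c_bounds by (intro mult_mono) auto
    moreover have "0 \<le> (1 - g (2 * k)) * g (2 * k + 1)"
      using g_range[of "2 * k"] g_range[of "2 * k + 1"] c_bounds by (intro mult_nonneg_nonneg) auto
    ultimately have "(1 - c) / 2 \<le> prob (mixed k)"
      unfolding prob_mixed by linarith
    then have e: "exp (- (\<beta>_gap gap * prob (mixed k))) \<le> exp (- x)"
      unfolding x_def using beta_pos by simp
    have "prob (reached (Suc k)) \<le> prob (reached k) * exp (- (\<beta>_gap gap * prob (mixed k)))"
      by (rule prob_reached_Suc_le)
    also have "\<dots> \<le> exp (- x) ^ k * exp (- x)"
      by (intro mult_mono Suc.IH e) auto
    finally show ?case by (simp add: mult.commute)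
  qed simp
  then show ?thesis
    using x by (intro summable_comparison_test'[OF summable_geometric[of "exp (- x)"], of 0]) auto
qed

lemma expected_regret_le:
  assumes s: "summable (\<lambda>k. prob (reached k))"
  shows "(\<integral>\<omega>. nested_ucb_regret \<mu> X Z U tie n \<omega> \<partial>M) \<le>
    gap * (ucb_bound n / \<beta>_gap gap + 16916 * (\<Sum>k. prob (reached k)))"
proof -
  have "(\<Sum>k\<le>n. \<integral>\<omega>. inferior_pulls n k \<omega> \<partial>M) \<le>
      (\<Sum>k\<le>n. prob (reached k) * (prob (mixed k) * ucb_bound n + 16916))"
    by (intro sum_mono expected_inferior_pulls)
  also have "\<dots> = ucb_bound n * (\<Sum>k<Suc n. prob (reached k) * prob (mixed k)) +
    16916 * (\<Sum>k<Suc n. prob (reached k))"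
    by (simp only: lessThan_Suc_atMost sum_distrib_left sum.distrib[symmetric])
       (simp add: algebra_simps)
  also have "\<dots> \<le> ucb_bound n * (1 / \<beta>_gap gap) + 16916 * (\<Sum>k. prob (reached k))"
    using s by (intro add_mono mult_left_mono sum_reached_mixed ucb_bound_nonneg sum_le_suminf) auto
  finally show ?thesis
    unfolding expected_regret gap_def[symmetric] using gap_pos by (intro mult_left_mono) auto
qed

text \<open>As \<open>g\<close> is at most \<open>c\<close>, the series dominates the geometric one
  with ratio \<open>exp (- x)\<close> for \<open>x = \<beta>_gap gap * c\<close>, and
  \<open>1 - exp (- x) \<le> x\<close>. This is what cancels the factor \<open>c\<close> in the
  final bound.\<close>

lemma suminf_exp_ge:
  assumes s: "summable (\<lambda>k. exp (- \<beta>_gap gap * (\<Sum>j<k. g (2 * j))))"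
  shows "1 / (\<beta>_gap gap * c) \<le> (\<Sum>k. exp (- \<beta>_gap gap * (\<Sum>j<k. g (2 * j))))"
proof -
  let ?x = "\<beta>_gap gap * c"
  have x: "0 < ?x" using beta_pos c_bounds by simp
  have e: "0 < 1 - exp (- ?x)" using x by simp
  have "1 / ?x \<le> 1 / (1 - exp (- ?x))"
    using exp_ge_add_one_self[of "- ?x"] e x by (intro frac_le) linarith+
  also have "\<dots> = (\<Sum>k. exp (- ?x) ^ k)"
    using x by (intro suminf_geometric[symmetric]) simp
  also have "\<dots> \<le> (\<Sum>k. exp (- \<beta>_gap gap * (\<Sum>j<k. g (2 * j))))"
  proof (rule suminf_le[OF _ _ s])
    show "summable (\<lambda>k. exp (- ?x) ^ k)" using x by (intro summable_geometric) simp
    fix k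
    have "(\<Sum>j<k. g (2 * j)) \<le> (\<Sum>j<k. c)"
      using g_range by (intro sum_mono) auto
    then have "\<beta>_gap gap * (\<Sum>j<k. g (2 * j)) \<le> real k * ?x"
      using mult_left_mono[of "\<Sum>j<k. g (2 * j)" "real k * c" "\<beta>_gap gap"] beta_pos
        by (simp add: mult_ac)
    then show "exp (- ?x) ^ k \<le> exp (- \<beta>_gap gap * (\<Sum>j<k. g (2 * j)))"
      by (simp flip: exp_of_nat_mult)
  qed
  finally show ?thesis .
qed

theorem limsup_regret:
  "limsup (\<lambda>n. ereal (integral\<^sup>L M (nested_ucb_regret \<mu> X Z U tie n) / ln (real n)))
     \<le> ereal (16 * c / gap) * (\<Sum>k. ereal (exp (- \<beta>_gap gap * (\<Sum>j<k. g (2 * j)))))"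
    (is "_ \<le> _ * (\<Sum>k. ereal (?s k))")
proof (cases "summable ?s")
  \<comment> \<open>A divergent series makes the right-hand side infinite, as its coefficient is
    positive.\<close>
  case False
  have "(\<Sum>k. ereal (?s k)) = \<infinity>"
  proof (rule ccontr)
    assume "(\<Sum>k. ereal (?s k)) \<noteq> \<infinity>"
    then have "summable ?s" by (intro summable_ereal) auto
    with False show False ..
  qed
  then show ?thesis using gap_pos c_bounds by simp
next
  case True
  let ?\<beta> = "\<beta>_gap gap" and ?C = "\<Sum>k. prob (reached k)"
  let ?b = "\<lambda>n. gap * (ucb_bound n / ?\<beta> + 16916 * ?C) / ln (real n)"
  note \<beta> = beta_pos and gap = gap_pos
  have "limsup (\<lambda>n. ereal (integral\<^sup>L M (nested_ucb_regret \<mu> X Z U tie n) / ln (real n)))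
      \<le> limsup (\<lambda>n. ereal (?b n))"
  proof (rule Limsup_mono, rule eventually_sequentiallyI)
    fix n :: nat assume "1 \<le> n"
    then show "ereal (integral\<^sup>L M (nested_ucb_regret \<mu> X Z U tie n) / ln (real n)) \<le> ereal (?b n)"
      using expected_regret_le[OF summable_reached[OF True], of n] by (simp add: divide_right_mono)
  qed
  also have "\<dots> = ereal (8 / (gap * ?\<beta>))"
  proof (intro lim_imp_Limsup)
    let ?D = "gap * (2 / ?\<beta> + 16916 * ?C)"
    have "filterlim (\<lambda>n. ln (real n)) at_infinity sequentially"
      by (intro filterlim_at_top_imp_at_infinity filterlim_compose[OF ln_at_top
        filterlim_real_sequentially])
    then have "(\<lambda>n. gap * (8 / gap\<^sup>2 / ?\<beta>) + ?D / ln (real n)) \<longlonglongrightarrow> gap * (8 / gap\<^sup>2 / ?\<beta>) + 0"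
      by (intro tendsto_add tendsto_const tendsto_divide_0[OF tendsto_const])
    moreover have "\<forall>\<^sub>F n in sequentially. gap * (8 / gap\<^sup>2 / ?\<beta>) + ?D / ln (real n) = ?b n"
    proof (rule eventually_sequentiallyI)
      fix n :: nat assume "2 \<le> n"
      then have l: "ln (real n) \<noteq> 0" by simp
      have "?b n = gap * (8 / gap\<^sup>2 / ?\<beta>) * (ln (real n) / ln (real n)) + ?D / ln (real n)"
        unfolding ucb_bound_def by (simp add: add_divide_distrib distrib_left mult_ac)
      then show "gap * (8 / gap\<^sup>2 / ?\<beta>) + ?D / ln (real n) = ?b n"
        using l by simp
    qed
    ultimately have "?b \<longlonglongrightarrow> gap * (8 / gap\<^sup>2 / ?\<beta>)"
      by (subst (asm) tendsto_cong) auto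
    also have "gap * (8 / gap\<^sup>2 / ?\<beta>) = 8 / (gap * ?\<beta>)"
      using gap by (simp add: power2_eq_square)
    finally show "(\<lambda>n. ereal (?b n)) \<longlonglongrightarrow> ereal (8 / (gap * ?\<beta>))" by simp
  qed simp
  also have "\<dots> \<le> ereal (16 * c / gap * (\<Sum>k. ?s k))"
  proof -
    \<comment> \<open>A factor 2 is given away here to arrive at the coefficient 16.\<close>
    have "8 / (gap * ?\<beta>) \<le> 16 / (gap * ?\<beta>)"
      using gap \<beta> by (intro divide_right_mono) auto
    also have "\<dots> = 16 * c / gap * (1 / (?\<beta> * c))"
      using c_bounds by simp
    also have "\<dots> \<le> 16 * c / gap * (\<Sum>k. ?s k)"
      using suminf_exp_ge[OF True] gap c_bounds by (intro mult_left_mono) auto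
    finally show ?thesis by simp
  qed
  also have "\<dots> = ereal (16 * c / gap) * (\<Sum>k. ereal (?s k))"
    using True by (simp add: suminf_ereal')
  finally show ?thesis .
qed

end

theorem theorem5:
  fixes M :: "'w measure"
    and \<mu> :: "arm_type \<Rightarrow> real"
    and g :: "nat \<Rightarrow> real"
    and c \<Delta> :: real
    and \<kappa> :: "nat \<Rightarrow> 'w \<Rightarrow> arm_type"
    and X :: "nat \<Rightarrow> nat \<Rightarrow> 'w \<Rightarrow> real"
    and Z :: "nat \<Rightarrow> 'w \<Rightarrow> real"
    and U :: "'w \<Rightarrow> real"
    and tie :: "real \<Rightarrow> nat \<Rightarrow> history \<Rightarrow> bool"
  assumes "nested_ucb_bandit M \<mu> g c \<kappa> X Z U tie"
    and "\<Delta> = \<mu> Optimal - \<mu> Inferior"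
  shows "limsup (\<lambda>n. ereal (integral\<^sup>L M (nested_ucb_regret \<mu> X Z U tie n) / ln (real n)))
           \<le> ereal (16 * c / \<Delta>) * (\<Sum>k. ereal (exp (- \<beta>_gap \<Delta> * (\<Sum>j<k. g (2 * j)))))"
proof -
  interpret nested_ucb_bandit M \<mu> g c \<kappa> X Z U tie by fact
  show ?thesis
    using limsup_regret unfolding gap_def assms(2) .
qed

end
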